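(* Let $\mathcal V$ be a variety of $R$-modules expanded by multilinear operations. If $A\in\mathcal V$ is an extension $\pi:A\to Q$ (a surjective homomorphism) with $I=\ker\pi$ and associated 2-cocycle $T$, then there exists an exact sequence $$1\longrightarrow\mathrm{Der}(Q,I)\longrightarrow\mathrm{Aut}_{I}A\stackrel{\psi}{\longrightarrow}\mathrm{Aut}\,I\times\mathrm{Aut}\,Q\stackrel{W_{T}}{\longrightarrow}FA\left(H^{2}_{\mathcal V}(Q,I)\right),$$ where $FA(H^2_{\mathcal V}(Q,I))$ is the free abelian group on the set $H^2_{\mathcal V}(Q,I)$. Here the first two nontrivial maps are group homomorphisms, $W_T$ is a map of sets, and exactness at $\mathrm{Aut}\,I\times\mathrm{Aut}\,Q$ means $\mathrm{im}\,\psi=\{(\sigma,\kappa):W_T(\sigma,\kappa)=0\}$.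
   Context: $R$ is a ring; algebras in $\mathcal V$ are $R$-modules together with a family $F$ of operations $f$, each $R$-multilinear of arity $\mathrm{ar} f\ge1$. $I=\ker\pi$ denotes the ideal $\pi^{-1}(0)$, itself an algebra in the signature. $[n]=\{1,\dots,n\}$ and $[n]^\ast$ is the set of nonempty proper subsets of $[n]$. For $s\subseteq[n]$ and tuples $\vec b,\vec a$, the tuple $\vec b_s[\vec a]$ is $\vec b$ with $b_i$ replaced by $a_i$ for $i\in s$; similarly $g(\vec x,\vec b)_s[\vec a]=g(\vec x,\vec b_s[\vec a])$ and $f(\vec b)_s[\vec a]=f(\vec b_s[\vec a])$. **2-cocycles.** For an extension $p:B\to Q$ with $B\in\mathcal V$ and $p^{-1}(0)$ identified with $I$, and a lifting $l:Q\to B$ ($p\circ l=\mathrm{id}_Q$, $l(0)=0$), the associated 2-cocycle is the family $T=\{T_+,T_r,T_f,a(f,s):r\in R,f\in F,s\in[\mathrm{ar} f]^\ast\}$ of $I$-valued maps: $T_+(x,y)=l(x)+l(y)-l(x+y)$; $T_r(x)=r\cdot l(x)-l(r\cdot x)$; $T_f(\vec x)=f^B(l(\vec x))-l(f^Q(\vec x))$; and $a(f,s)(\vec x,\vec a)=f^B(\vec z)$ with $z_i=a_i\in I$ for $i\in s$ and $z_i=l(x_i)$ for $i\notin s$. $Z^2_{\mathcal V}(Q,I)$ (the $\mathcal V$-compatible 2-cocycles) is the set of all families $T$ arising in this way. From $T$ the extension is recovered as $I\rtimes_TQ$: universe $I\times Q$, $\langle a,x\rangle+\langle b,y\rangle=\langle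 a+b+T_+(x,y),x+y\rangle$, $r\cdot\langle a,x\rangle=\langle r\cdot a+T_r(x),r\cdot x\rangle$, and $f(\langle a_1,x_1\rangle,\dots,\langle a_n,x_n\rangle)=\langle f^I(\vec a)+\sum_{s\in[n]^\ast}a(f,s)(\vec x,\vec a)+T_f(\vec x),f^Q(\vec x)\rangle$; the isomorphism is $b\mapsto\langle b-l(p(b)),p(b)\rangle$. **Equivalence.** $T\sim T'$ (with action terms $a(f,s)$, $a'(f,s)$) iff there is $h:Q\to I$ with $h(0)=0$ such that, for all $r\in R$, all $f\in F$ with $n=\mathrm{ar} f$, and all $s\in[n]^\ast$: (E1) $T_+(x,y)-T'_+(x,y)=h(x)+h(y)-h(x+y)$; (E2) $T_r(x)-T'_r(x)=r\cdot h(x)-h(r\cdot x)$; (E3) $T_f(\vec x)-T'_f(\vec x)=\sum_{s\in[n]^\ast}(-1)^{1+|s|}a(f,s)(\vec x,h(\vec x))+(-1)^{1+n}f^I(h(\vec x))-h(f^Q(\vec x))$; (E4) $a(f,s)(\vec x,\vec a)-a'(f,s)(\vec x,\vec a)=\sum_{s\subsetneq r\subsetneq[n]}(-1)^{1+|r|-|s|}a(f,r)(\vec x,h(\vec x))_s[\vec a]+(-1)^{1+n-|s|}f^I(h(\vec x))_s[\vec a]$. (Equivalently, $\langle a,x\rangle\mapsto\langle a-h(x),x\rangle$ is an isomorphism $I\rtimes_{T'}Q\to I\rtimes_TQ$.) $H^2_{\mathcal V}(Q,I)$ is the set of $\sim$-classes $[T]$ of elements of $Z^2_{\mathcal V}(Q,I)$.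 **Derivations.** $\mathrm{Der}(Q,I)$ is the group, under pointwise addition, of maps $d:Q\to I$ witnessing $T\sim T$, i.e. satisfying (E1)–(E4) with $T'=T$, $h=d$, for the 2-cocycle $T$ of the extension; $d$ is sent to the automorphism of $A\cong I\rtimes_TQ$ given by $\langle a,x\rangle\mapsto\langle a-d(x),x\rangle$. **Maps.** $\mathrm{Aut}_IA=\{\phi\in\mathrm{Aut}\,A:\phi(I)=I\}$; $\psi(\phi)=(\phi|_I,\pi\circ\phi\circ l)$, independent of the lifting $l$ of $\pi$. For $(\sigma,\kappa)\in\mathrm{Aut}\,I\times\mathrm{Aut}\,Q$, the 2-cocycle $T^{(\sigma,\kappa)}\in Z^2_{\mathcal V}(Q,I)$ is given by $T^{(\sigma,\kappa)}_+(x,y)=\sigma(T_+(\kappa^{-1}(x),\kappa^{-1}(y)))$, $T^{(\sigma,\kappa)}_r(x)=\sigma(T_r(\kappa^{-1}(x)))$, $T^{(\sigma,\kappa)}_f(\vec x)=\sigma(T_f(\kappa^{-1}(\vec x)))$, $a(f,s)^{(\sigma,\kappa)}(\vec x,\vec a)=\sigma(a(f,s)(\kappa^{-1}(\vec x),\sigma^{-1}(\vec a)))$. The Wells map is the formal difference $W_T(\sigma,\kappa)=[T]-[T^{(\sigma,\kappa)}]\in FA(H^2_{\mathcal V}(Q,I))$. *)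

theory Defs
  imports "HOL-Algebra.Bij" "HOL-Algebra.Module" "HOL-Algebra.AbelCoset" "HOL-Algebra.Free_Abelian_Groups"
begin

section \<open>Modules expanded by multilinear operations\<close>

text \<open>
  The n-tuples over X are the extensional functions from \<open>{1..n}\<close> to X.
  The substitution \<open>b\<^sub>s[a]\<close> is the library function \<open>override_on b a s\<close>, and
  applying a map g entrywise to a tuple x is \<open>compose {1..n} g x\<close>.

  The fields \<open>mult\<close> and \<open>one\<close> that an algebra inherits from the library record of modules carry no
  meaning (exactly as for the modules of the library).
\<close>

record ('r, 'f, 'a) malg = "('r, 'a) module" +
  oper :: "'f \<Rightarrow> (nat \<Rightarrow> 'a) \<Rightarrow> 'a"

abbreviation tuples :: "nat \<Rightarrow> 'a set \<Rightarrow> (nat \<Rightarrow> 'a) set" where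
  "tuples n X \<equiv> {1..n} \<rightarrow>\<^sub>E X"

datatype ('r, 'f) mterm =
    TVar nat
  | TZero
  | TAdd "('r, 'f) mterm" "('r, 'f) mterm"
  | TNeg "('r, 'f) mterm"
  | TSmult 'r "('r, 'f) mterm"
  | TOp 'f "('r, 'f) mterm list"

text \<open>
  A variety is presented by its ring of scalars, its set F of multilinear operation symbols with
  their arities, and a set of identities; its members are the models of these identities among the
  modules expanded by multilinear operations. (A class of algebras quantified over all
  carrier types is not a HOL object, whence the equational presentation.)
\<close>

record ('r, 'f) variety_data =
  scalars :: "'r ring"
  ops :: "'f set"
  ar :: "'f \<Rightarrow> nat"
  idents :: "(('r, 'f) mterm \<times> ('r, 'f) mterm) set"

fun wf_mterm :: "('r, 'f) variety_data \<Rightarrow> ('r, 'f) mterm \<Rightarrow> bool" where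
  "wf_mterm V (TVar k) \<longleftrightarrow> True"
| "wf_mterm V TZero \<longleftrightarrow> True"
| "wf_mterm V (TAdd t u) \<longleftrightarrow> wf_mterm V t \<and> wf_mterm V u"
| "wf_mterm V (TNeg t) \<longleftrightarrow> wf_mterm V t"
| "wf_mterm V (TSmult r t) \<longleftrightarrow> r \<in> carrier (scalars V) \<and> wf_mterm V t"
| "wf_mterm V (TOp f ts) \<longleftrightarrow> f \<in> ops V \<and> length ts = ar V f \<and> (\<forall>t\<in>set ts. wf_mterm V t)"

primrec mterm_val :: "('r, 'f, 'a) malg \<Rightarrow> (nat \<Rightarrow> 'a) \<Rightarrow> ('r, 'f) mterm \<Rightarrow> 'a" where
  "mterm_val A v (TVar k) = v k"
| "mterm_val A v TZero = \<zero>\<^bsub>A\<^esub>"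
| "mterm_val A v (TAdd t u) = mterm_val A v t \<oplus>\<^bsub>A\<^esub> mterm_val A v u"
| "mterm_val A v (TNeg t) = \<ominus>\<^bsub>A\<^esub> mterm_val A v t"
| "mterm_val A v (TSmult r t) = r \<odot>\<^bsub>A\<^esub> mterm_val A v t"
| "mterm_val A v (TOp f ts) = oper A f (\<lambda>i\<in>{1..length ts}. map (mterm_val A v) ts ! (i - 1))"

definition variety :: "('r, 'f) variety_data \<Rightarrow> bool" where
  "variety V \<longleftrightarrow>
     ring (scalars V) \<and>
     (\<forall>f\<in>ops V. 1 \<le> ar V f) \<and>
     (\<forall>(t, u)\<in>idents V. wf_mterm V t \<and> wf_mterm V u)"

text \<open>The library locale \<open>module\<close> requires a commutative ring, so its axioms are restated here.\<close>

definition multilinear_expansion :: "('r, 'f) variety_data \<Rightarrow> ('r, 'f, 'a) malg \<Rightarrow> bool" where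
  "multilinear_expansion V A \<longleftrightarrow>
     abelian_group A \<and>
     (\<forall>r\<in>carrier (scalars V). \<forall>x\<in>carrier A. r \<odot>\<^bsub>A\<^esub> x \<in> carrier A) \<and>
     (\<forall>r\<in>carrier (scalars V). \<forall>s\<in>carrier (scalars V). \<forall>x\<in>carrier A.
        (r \<oplus>\<^bsub>scalars V\<^esub> s) \<odot>\<^bsub>A\<^esub> x = r \<odot>\<^bsub>A\<^esub> x \<oplus>\<^bsub>A\<^esub> s \<odot>\<^bsub>A\<^esub> x) \<and>
     (\<forall>r\<in>carrier (scalars V). \<forall>x\<in>carrier A. \<forall>y\<in>carrier A.
        r \<odot>\<^bsub>A\<^esub> (x \<oplus>\<^bsub>A\<^esub> y) = r \<odot>\<^bsub>A\<^esub> x \<oplus>\<^bsub>A\<^esub> r \<odot>\<^bsub>A\<^esub> y) \<and>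
     (\<forall>r\<in>carrier (scalars V). \<forall>s\<in>carrier (scalars V). \<forall>x\<in>carrier A.
        (r \<otimes>\<^bsub>scalars V\<^esub> s) \<odot>\<^bsub>A\<^esub> x = r \<odot>\<^bsub>A\<^esub> (s \<odot>\<^bsub>A\<^esub> x)) \<and>
     (\<forall>x\<in>carrier A. \<one>\<^bsub>scalars V\<^esub> \<odot>\<^bsub>A\<^esub> x = x) \<and>
     (\<forall>f\<in>ops V. \<forall>x\<in>tuples (ar V f) (carrier A).
        oper A f x \<in> carrier A \<and>
        (\<forall>i\<in>{1..ar V f}. \<forall>a\<in>carrier A.
           (\<forall>b\<in>carrier A.
              oper A f (x(i := a \<oplus>\<^bsub>A\<^esub> b)) = oper A f (x(i := a)) \<oplus>\<^bsub>A\<^esub> oper A f (x(i := b))) \<and>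
           (\<forall>r\<in>carrier (scalars V).
              oper A f (x(i := r \<odot>\<^bsub>A\<^esub> a)) = r \<odot>\<^bsub>A\<^esub> oper A f (x(i := a)))))"

definition in_variety :: "('r, 'f) variety_data \<Rightarrow> ('r, 'f, 'a) malg \<Rightarrow> bool" where
  "in_variety V A \<longleftrightarrow>
     multilinear_expansion V A \<and>
     (\<forall>(t, u)\<in>idents V. \<forall>v\<in>UNIV \<rightarrow> carrier A. mterm_val A v t = mterm_val A v u)"

definition malg_hom ::
    "('r, 'f) variety_data \<Rightarrow> ('r, 'f, 'a) malg \<Rightarrow> ('r, 'f, 'b) malg \<Rightarrow> ('a \<Rightarrow> 'b) set" where
  "malg_hom V A B =
     {\<phi> \<in> carrier A \<rightarrow> carrier B.
        (\<forall>x\<in>carrier A. \<forall>y\<in>carrier A. \<phi> (x \<oplus>\<^bsub>A\<^esub> y) = \<phi> x \<oplus>\<^bsub>B\<^esub> \<phi> y) \<and>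
        (\<forall>r\<in>carrier (scalars V). \<forall>x\<in>carrier A. \<phi> (r \<odot>\<^bsub>A\<^esub> x) = r \<odot>\<^bsub>B\<^esub> \<phi> x) \<and>
        (\<forall>f\<in>ops V. \<forall>x\<in>tuples (ar V f) (carrier A).
           \<phi> (oper A f x) = oper B f (compose {1..ar V f} \<phi> x))}"

definition malg_aut :: "('r, 'f) variety_data \<Rightarrow> ('r, 'f, 'a) malg \<Rightarrow> ('a \<Rightarrow> 'a) set" where
  "malg_aut V A = malg_hom V A A \<inter> Bij (carrier A)"

definition AutG :: "('r, 'f) variety_data \<Rightarrow> ('r, 'f, 'a) malg \<Rightarrow> ('a \<Rightarrow> 'a) monoid" where
  "AutG V A = BijGroup (carrier A) \<lparr>carrier := malg_aut V A\<rparr>"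

definition AutG_pres ::
    "('r, 'f) variety_data \<Rightarrow> ('r, 'f, 'a) malg \<Rightarrow> ('r, 'f, 'a) malg \<Rightarrow> ('a \<Rightarrow> 'a) monoid" where
  "AutG_pres V A I =
     BijGroup (carrier A) \<lparr>carrier := {\<phi> \<in> malg_aut V A. \<phi> ` carrier I = carrier I}\<rparr>"

section \<open>Extensions and 2-cocycles\<close>

definition extension ::
    "('r, 'f) variety_data \<Rightarrow> ('r, 'f, 'b) malg \<Rightarrow> ('r, 'f, 'q) malg \<Rightarrow> ('b \<Rightarrow> 'q) \<Rightarrow> bool" where
  "extension V B Q p \<longleftrightarrow>
     in_variety V B \<and> in_variety V Q \<and> p \<in> malg_hom V B Q \<and> p ` carrier B = carrier Q"

definition ideal_alg ::
    "('r, 'f, 'b) malg \<Rightarrow> ('r, 'f, 'q) malg \<Rightarrow> ('b \<Rightarrow> 'q) \<Rightarrow> ('r, 'f, 'b) malg" where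
  "ideal_alg B Q p = B\<lparr>carrier := a_kernel B Q p\<rparr>"

definition lifting ::
    "('r, 'f, 'b) malg \<Rightarrow> ('r, 'f, 'q) malg \<Rightarrow> ('b \<Rightarrow> 'q) \<Rightarrow> ('q \<Rightarrow> 'b) \<Rightarrow> bool" where
  "lifting B Q p l \<longleftrightarrow>
     l \<in> carrier Q \<rightarrow> carrier B \<and> (\<forall>x\<in>carrier Q. p (l x) = x) \<and> l \<zero>\<^bsub>Q\<^esub> = \<zero>\<^bsub>B\<^esub>"

definition proper_subsets :: "nat \<Rightarrow> nat set set" where
  "proper_subsets n = {s. s \<noteq> {} \<and> s \<subset> {1..n}}"

text \<open>
  All component functions of a cocycle are made extensional, so that two families are equal iff
  they agree on their actual domains.
\<close>

record ('r, 'f, 'a, 'q) cocycle =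
  coc_add :: "'q \<Rightarrow> 'q \<Rightarrow> 'a"
  coc_smult :: "'r \<Rightarrow> 'q \<Rightarrow> 'a"
  coc_op :: "'f \<Rightarrow> (nat \<Rightarrow> 'q) \<Rightarrow> 'a"
  coc_act :: "'f \<Rightarrow> nat set \<Rightarrow> (nat \<Rightarrow> 'q) \<Rightarrow> (nat \<Rightarrow> 'a) \<Rightarrow> 'a"

text \<open>
  The 2-cocycle of an extension B of Q with lifting l. The map \<open>i\<close> is the
  identification of I with the kernel of the extension; values in the kernel
  are read back in I through its inverse.
\<close>

definition cocycle_of ::
    "('r, 'f) variety_data \<Rightarrow> ('r, 'f, 'q) malg \<Rightarrow> ('r, 'f, 'a) malg \<Rightarrow>
     ('r, 'f, 'b) malg \<Rightarrow> ('a \<Rightarrow> 'b) \<Rightarrow> ('q \<Rightarrow> 'b) \<Rightarrow> ('r, 'f, 'a, 'q) cocycle" where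
  "cocycle_of V Q I B i l =
     (let inI = inv_into (carrier I) i in
      \<lparr>coc_add = (\<lambda>x\<in>carrier Q. \<lambda>y\<in>carrier Q. inI (l x \<oplus>\<^bsub>B\<^esub> l y \<ominus>\<^bsub>B\<^esub> l (x \<oplus>\<^bsub>Q\<^esub> y))),
       coc_smult = (\<lambda>r\<in>carrier (scalars V). \<lambda>x\<in>carrier Q.
         inI (r \<odot>\<^bsub>B\<^esub> l x \<ominus>\<^bsub>B\<^esub> l (r \<odot>\<^bsub>Q\<^esub> x))),
       coc_op = (\<lambda>f\<in>ops V. \<lambda>x\<in>tuples (ar V f) (carrier Q).
         inI (oper B f (compose {1..ar V f} l x) \<ominus>\<^bsub>B\<^esub> l (oper Q f x))),
       coc_act = (\<lambda>f\<in>ops V. \<lambda>s\<in>proper_subsets (ar V f).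
         \<lambda>x\<in>tuples (ar V f) (carrier Q). \<lambda>a\<in>tuples (ar V f) (carrier I).
         inI (oper B f (\<lambda>k\<in>{1..ar V f}. if k \<in> s then i (a k) else l (x k))))\<rparr>)"

text \<open>
  Up to isomorphism every extension of Q by I has a universe inside
  the type \<open>'a \<times> 'q\<close> (take the bijection with the product of the carriers), so restricting the
  extensions B to that type loses no cocycle.
\<close>

definition Z2 ::
    "('r, 'f) variety_data \<Rightarrow> ('r, 'f, 'q) malg \<Rightarrow> ('r, 'f, 'a) malg \<Rightarrow>
     ('r, 'f, 'a, 'q) cocycle set" where
  "Z2 V Q I =
     {T. \<exists>(B :: ('r, 'f, 'a \<times> 'q) malg) p i l.
           extension V B Q p \<and> lifting B Q p l \<and>
           i \<in> malg_hom V I (ideal_alg B Q p) \<and>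
           bij_betw i (carrier I) (carrier (ideal_alg B Q p)) \<and>
           T = cocycle_of V Q I B i l}"

definition witnesses ::
    "('r, 'f) variety_data \<Rightarrow> ('r, 'f, 'q) malg \<Rightarrow> ('r, 'f, 'a) malg \<Rightarrow> ('q \<Rightarrow> 'a) \<Rightarrow>
     ('r, 'f, 'a, 'q) cocycle \<Rightarrow> ('r, 'f, 'a, 'q) cocycle \<Rightarrow> bool" where
  "witnesses V Q I h T T' \<longleftrightarrow>
     h \<in> carrier Q \<rightarrow>\<^sub>E carrier I \<and> h \<zero>\<^bsub>Q\<^esub> = \<zero>\<^bsub>I\<^esub> \<and>
     (\<forall>x\<in>carrier Q. \<forall>y\<in>carrier Q.
        coc_add T x y \<ominus>\<^bsub>I\<^esub> coc_add T' x y = h x \<oplus>\<^bsub>I\<^esub> h y \<ominus>\<^bsub>I\<^esub> h (x \<oplus>\<^bsub>Q\<^esub> y)) \<and>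
     (\<forall>r\<in>carrier (scalars V). \<forall>x\<in>carrier Q.
        coc_smult T r x \<ominus>\<^bsub>I\<^esub> coc_smult T' r x = r \<odot>\<^bsub>I\<^esub> h x \<ominus>\<^bsub>I\<^esub> h (r \<odot>\<^bsub>Q\<^esub> x)) \<and>
     (\<forall>f\<in>ops V. \<forall>x\<in>tuples (ar V f) (carrier Q).
        let n = ar V f; hx = compose {1..n} h x in
        coc_op T f x \<ominus>\<^bsub>I\<^esub> coc_op T' f x =
          (\<Oplus>\<^bsub>I\<^esub>s\<in>proper_subsets n. [((- 1 :: int) ^ (1 + card s))] \<cdot>\<^bsub>I\<^esub> coc_act T f s x hx)
            \<oplus>\<^bsub>I\<^esub> [((- 1 :: int) ^ (1 + n))] \<cdot>\<^bsub>I\<^esub> oper I f hx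
            \<ominus>\<^bsub>I\<^esub> h (oper Q f x)) \<and>
     (\<forall>f\<in>ops V. \<forall>s\<in>proper_subsets (ar V f).
        \<forall>x\<in>tuples (ar V f) (carrier Q). \<forall>a\<in>tuples (ar V f) (carrier I).
        let n = ar V f; hxa = override_on (compose {1..n} h x) a s in
        coc_act T f s x a \<ominus>\<^bsub>I\<^esub> coc_act T' f s x a =
          (\<Oplus>\<^bsub>I\<^esub>r\<in>{r. s \<subset> r \<and> r \<subset> {1..n}}.
             [((- 1 :: int) ^ (1 + card r - card s))] \<cdot>\<^bsub>I\<^esub> coc_act T f r x hxa)
            \<oplus>\<^bsub>I\<^esub> [((- 1 :: int) ^ (1 + n - card s))] \<cdot>\<^bsub>I\<^esub> oper I f hxa)"

definition coc_equiv ::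
    "('r, 'f) variety_data \<Rightarrow> ('r, 'f, 'q) malg \<Rightarrow> ('r, 'f, 'a) malg \<Rightarrow>
     (('r, 'f, 'a, 'q) cocycle \<times> ('r, 'f, 'a, 'q) cocycle) set" where
  "coc_equiv V Q I = {(T, T'). T \<in> Z2 V Q I \<and> T' \<in> Z2 V Q I \<and> (\<exists>h. witnesses V Q I h T T')}"

definition coc_class ::
    "('r, 'f) variety_data \<Rightarrow> ('r, 'f, 'q) malg \<Rightarrow> ('r, 'f, 'a) malg \<Rightarrow>
     ('r, 'f, 'a, 'q) cocycle \<Rightarrow> ('r, 'f, 'a, 'q) cocycle set" where
  "coc_class V Q I T = coc_equiv V Q I `` {T}"

definition H2 ::
    "('r, 'f) variety_data \<Rightarrow> ('r, 'f, 'q) malg \<Rightarrow> ('r, 'f, 'a) malg \<Rightarrow>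
     ('r, 'f, 'a, 'q) cocycle set set" where
  "H2 V Q I = Z2 V Q I // coc_equiv V Q I"

section \<open>The maps of the sequence\<close>

definition DerG ::
    "('r, 'f) variety_data \<Rightarrow> ('r, 'f, 'q) malg \<Rightarrow> ('r, 'f, 'a) malg \<Rightarrow>
     ('r, 'f, 'a, 'q) cocycle \<Rightarrow> ('q \<Rightarrow> 'a) monoid" where
  "DerG V Q I T =
     \<lparr>carrier = {d. witnesses V Q I d T T},
      mult = (\<lambda>d e. \<lambda>x\<in>carrier Q. d x \<oplus>\<^bsub>I\<^esub> e x),
      one = (\<lambda>x\<in>carrier Q. \<zero>\<^bsub>I\<^esub>)\<rparr>"

text \<open>The isomorphism of A with the twisted product of I and Q, as a bijection of universes.\<close>

definition split_iso ::
    "('r, 'f, 'a) malg \<Rightarrow> ('a \<Rightarrow> 'q) \<Rightarrow> ('q \<Rightarrow> 'a) \<Rightarrow> 'a \<Rightarrow> 'a \<times> 'q" where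
  "split_iso A \<pi> l b = (b \<ominus>\<^bsub>A\<^esub> l (\<pi> b), \<pi> b)"

definition der_to_aut ::
    "('r, 'f, 'a) malg \<Rightarrow> ('r, 'f, 'a) malg \<Rightarrow> ('a \<Rightarrow> 'q) \<Rightarrow> ('q \<Rightarrow> 'a) \<Rightarrow>
     ('q \<Rightarrow> 'a) \<Rightarrow> 'a \<Rightarrow> 'a" where
  "der_to_aut A I \<pi> l d =
     (\<lambda>b\<in>carrier A. inv_into (carrier A) (split_iso A \<pi> l)
        (case split_iso A \<pi> l b of (a, x) \<Rightarrow> (a \<ominus>\<^bsub>I\<^esub> d x, x)))"

definition psi ::
    "('r, 'f, 'q) malg \<Rightarrow> ('r, 'f, 'a) malg \<Rightarrow> ('a \<Rightarrow> 'q) \<Rightarrow> ('q \<Rightarrow> 'a) \<Rightarrow>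
     ('a \<Rightarrow> 'a) \<Rightarrow> ('a \<Rightarrow> 'a) \<times> ('q \<Rightarrow> 'q)" where
  "psi Q I \<pi> l \<phi> = (restrict \<phi> (carrier I), \<lambda>x\<in>carrier Q. \<pi> (\<phi> (l x)))"

definition coc_twist ::
    "('r, 'f) variety_data \<Rightarrow> ('r, 'f, 'q) malg \<Rightarrow> ('r, 'f, 'a) malg \<Rightarrow>
     ('r, 'f, 'a, 'q) cocycle \<Rightarrow> ('a \<Rightarrow> 'a) \<times> ('q \<Rightarrow> 'q) \<Rightarrow> ('r, 'f, 'a, 'q) cocycle" where
  "coc_twist V Q I T = (\<lambda>(\<sigma>, \<kappa>).
     let \<sigma>' = inv_into (carrier I) \<sigma>; \<kappa>' = inv_into (carrier Q) \<kappa> in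
     \<lparr>coc_add = (\<lambda>x\<in>carrier Q. \<lambda>y\<in>carrier Q. \<sigma> (coc_add T (\<kappa>' x) (\<kappa>' y))),
      coc_smult = (\<lambda>r\<in>carrier (scalars V). \<lambda>x\<in>carrier Q. \<sigma> (coc_smult T r (\<kappa>' x))),
      coc_op = (\<lambda>f\<in>ops V. \<lambda>x\<in>tuples (ar V f) (carrier Q).
        \<sigma> (coc_op T f (compose {1..ar V f} \<kappa>' x))),
      coc_act = (\<lambda>f\<in>ops V. \<lambda>s\<in>proper_subsets (ar V f).
        \<lambda>x\<in>tuples (ar V f) (carrier Q). \<lambda>a\<in>tuples (ar V f) (carrier I).
        \<sigma> (coc_act T f s (compose {1..ar V f} \<kappa>' x) (compose {1..ar V f} \<sigma>' a)))\<rparr>)"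

definition wells ::
    "('r, 'f) variety_data \<Rightarrow> ('r, 'f, 'q) malg \<Rightarrow> ('r, 'f, 'a) malg \<Rightarrow>
     ('r, 'f, 'a, 'q) cocycle \<Rightarrow> ('a \<Rightarrow> 'a) \<times> ('q \<Rightarrow> 'q) \<Rightarrow>
     ('r, 'f, 'a, 'q) cocycle set \<Rightarrow>\<^sub>0 int" where
  "wells V Q I T \<sigma>\<kappa> =
     frag_of (coc_class V Q I T) - frag_of (coc_class V Q I (coc_twist V Q I T \<sigma>\<kappa>))"

end

theory Submission
  imports Defs
begin

text \<open>
  An extension \<open>p : B \<rightarrow> Q\<close> with lifting \<open>l\<close> writes every element of B uniquely as \<open>i a + l x\<close>.
  Given two extensions of Q by I and a map \<open>h : Q \<rightarrow> I\<close> with \<open>h 0 = 0\<close>, the conditions making h a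
  witness of the equivalence of their cocycles hold iff the bijection
  \<open>i' a + l' x \<mapsto> i a + l x - i (h x)\<close> is a homomorphism: multilinear expansion of
  \<open>f (l x - i (h x), ...)\<close>, with some arguments replaced by elements of I, produces exactly the signed
  sums over subsets. So equivalence of cocycles is isomorphism of extensions over I and Q.
  Derivations are then the automorphisms of A that induce the identity on I and Q. The twisted
  cocycle of \<open>(\<sigma>, \<kappa>)\<close> belongs to the same algebra A with projection \<open>\<kappa> \<circ> \<pi>\<close>, inclusion \<open>\<sigma>\<inverse>\<close> and
  lifting \<open>l \<circ> \<kappa>\<inverse>\<close>; an isomorphism from this extension to the original one is the same thing as an
  automorphism of A that induces \<open>(\<sigma>, \<kappa>)\<close>.
\<close>

text \<open>The twisted product of I and Q is never built. The conditions of
  \<open>witnesses\<close> are translated once, into the statement that a map between two given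
  extensions is a homomorphism; afterwards only identities, composites and inverses of morphisms
  occur. A morphism that induces the identity on I and Q is automatically bijective and determines
  its \<open>h\<close>, the difference of \<open>l x\<close> and \<open>\<phi> (l' x)\<close> read
  in I. For operations, the conditions on \<open>coc_op\<close> and \<open>coc_act\<close> are one
  identity for a set \<open>s\<close> of arguments taken from I, with \<open>s = {}\<close> for
  \<open>coc_op\<close>; only the full index set is missing, and there both sides are the operation
  of I. The remaining obstacle is one of types: \<open>Z2\<close> ranges over algebras on
  \<open>'a \<times> 'q\<close>, but A lives on \<open>'a\<close>. To place its cocycle and the
  twisted ones in \<open>Z2\<close>, the whole algebra is transported to pairs, together with the
  identities of the variety. This membership is essential: outside \<open>Z2\<close> every class is
  empty, so equal classes would say nothing about equivalence.\<close>

text \<open>Keeps the index sets \<open>{1..n}\<close> in the form used by the definitions.\<close>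

declare One_nat_def [simp del]

section \<open>Multilinear expansion\<close>

context abelian_group
begin

lemma add_pow_minus_one_Suc:
  assumes "x \<in> carrier G"
  shows "[((- 1 :: int) ^ Suc k)] \<cdot>\<^bsub>G\<^esub> x = \<ominus> ([((- 1 :: int) ^ k)] \<cdot>\<^bsub>G\<^esub> x)"
  using add.int_pow_neg[OF assms, of "(- 1) ^ k"] by (simp add: add_pow_def)

lemma add_pow_int_closed [simp, intro]: "x \<in> carrier G \<Longrightarrow> [(k :: int)] \<cdot>\<^bsub>G\<^esub> x \<in> carrier G"
  using add.int_pow_closed by (simp add: add_pow_def)

lemma add_pow_one [simp]: "x \<in> carrier G \<Longrightarrow> [(1 :: int)] \<cdot>\<^bsub>G\<^esub> x = x"
  using add.int_pow_1 by (simp add: add_pow_def)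

lemma a_inv_zero [simp]: "\<ominus> \<zero> = \<zero>"
  by (rule minus_equality) simp_all

lemma finsum_a_inv:
  assumes "f \<in> S \<rightarrow> carrier G"
  shows "(\<Oplus>x\<in>S. \<ominus> f x) = \<ominus> (\<Oplus>x\<in>S. f x)"
  using assms
proof (induction S rule: infinite_finite_induct)
  case (insert y S)
  then show ?case by (simp add: minus_add Pi_iff)
qed simp_all

end

lemma (in abelian_group_hom) hom_finsum_group:
  assumes "f \<in> S \<rightarrow> carrier G"
  shows "h (\<Oplus>\<^bsub>G\<^esub>x\<in>S. f x) = (\<Oplus>\<^bsub>H\<^esub>x\<in>S. h (f x))"
  using assms
proof (induction S rule: infinite_finite_induct)
  case (insert y S)
  then show ?case by (simp add: Pi_iff)
qed simp_all

lemma (in abelian_group_hom) hom_add_pow_int: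
  assumes "x \<in> carrier G"
  shows "h ([(k :: int)] \<cdot>\<^bsub>G\<^esub> x) = [k] \<cdot>\<^bsub>H\<^esub> h x"
  using group_hom.hom_int_pow[OF a_group_hom, of x k] assms by (simp add: add_pow_def)

lemma fun_upd_tuples:
  "x \<in> tuples n X \<Longrightarrow> k \<in> {1..n} \<Longrightarrow> a \<in> X \<Longrightarrow> x(k := a) \<in> tuples n X"
  by (auto simp: PiE_iff extensional_def)

lemma override_on_tuples:
  assumes "v \<in> tuples n X" "u \<in> s \<rightarrow> X" "s \<subseteq> {1..n}"
  shows "override_on v u s \<in> tuples n X"
  using assms by (fastforce simp: PiE_iff extensional_def override_on_def)

text \<open>Naming the group as a parent locale, with A as the implicit structure, makes the
  library's calculus for abelian groups available; \<open>multilinear_algebra_iff\<close> returns to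
  the plain predicate.\<close>

locale multilinear_algebra = abelian_group A
  for V :: "('r, 'f) variety_data" and A :: "('r, 'f, 'a) malg" (structure) +
  assumes mexp: "multilinear_expansion V A"

lemma multilinear_algebra_iff: "multilinear_algebra V A \<longleftrightarrow> multilinear_expansion V A"
  by (auto simp: multilinear_algebra_def multilinear_algebra_axioms_def multilinear_expansion_def)

context multilinear_algebra
begin

lemma smult_closed [simp]:
  "r \<in> carrier (scalars V) \<Longrightarrow> x \<in> carrier A \<Longrightarrow> r \<odot> x \<in> carrier A"
  using mexp unfolding multilinear_expansion_def by blast

lemma smult_r_distr:
  "r \<in> carrier (scalars V) \<Longrightarrow> x \<in> carrier A \<Longrightarrow> y \<in> carrier A \<Longrightarrow> r \<odot> (x \<oplus> y) = r \<odot> x \<oplus> r \<odot> y"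
  using mexp unfolding multilinear_expansion_def by blast

lemma smult_l_distr:
  "r \<in> carrier (scalars V) \<Longrightarrow> s \<in> carrier (scalars V) \<Longrightarrow> x \<in> carrier A \<Longrightarrow>
    (r \<oplus>\<^bsub>scalars V\<^esub> s) \<odot> x = r \<odot> x \<oplus> s \<odot> x"
  using mexp unfolding multilinear_expansion_def by blast

lemma smult_assoc:
  "r \<in> carrier (scalars V) \<Longrightarrow> s \<in> carrier (scalars V) \<Longrightarrow> x \<in> carrier A \<Longrightarrow>
    (r \<otimes>\<^bsub>scalars V\<^esub> s) \<odot> x = r \<odot> (s \<odot> x)"
  using mexp unfolding multilinear_expansion_def by blast

lemma smult_one: "x \<in> carrier A \<Longrightarrow> \<one>\<^bsub>scalars V\<^esub> \<odot> x = x"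
  using mexp unfolding multilinear_expansion_def by blast

lemma oper_closed [simp]:
  "f \<in> ops V \<Longrightarrow> x \<in> tuples (ar V f) (carrier A) \<Longrightarrow> oper A f x \<in> carrier A"
  using mexp unfolding multilinear_expansion_def by blast

lemma oper_add:
  assumes "f \<in> ops V" "x \<in> tuples (ar V f) (carrier A)" "k \<in> {1..ar V f}"
    "a \<in> carrier A" "b \<in> carrier A"
  shows "oper A f (x(k := a \<oplus> b)) = oper A f (x(k := a)) \<oplus> oper A f (x(k := b))"
  using mexp assms unfolding multilinear_expansion_def by blast

lemma oper_smult:
  assumes "f \<in> ops V" "x \<in> tuples (ar V f) (carrier A)" "k \<in> {1..ar V f}"
    "a \<in> carrier A" "r \<in> carrier (scalars V)"
  shows "oper A f (x(k := r \<odot> a)) = r \<odot> oper A f (x(k := a))"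
  using mexp assms unfolding multilinear_expansion_def by blast

lemma oper_zero:
  assumes f: "f \<in> ops V" and x: "x \<in> tuples (ar V f) (carrier A)" and k: "k \<in> {1..ar V f}"
  shows "oper A f (x(k := \<zero>)) = \<zero>"
proof -
  have cl: "oper A f (x(k := \<zero>)) \<in> carrier A"
    using f fun_upd_tuples[OF x k zero_closed] by (rule oper_closed)
  have "oper A f (x(k := \<zero>)) \<oplus> oper A f (x(k := \<zero>)) = oper A f (x(k := \<zero>)) \<oplus> \<zero>"
    using oper_add[OF f x k, of \<zero> \<zero>] cl by simp
  then show ?thesis
    using cl by (simp del: r_zero)
qed

lemma oper_neg:
  assumes f: "f \<in> ops V" and x: "x \<in> tuples (ar V f) (carrier A)" and k: "k \<in> {1..ar V f}"
    and a: "a \<in> carrier A"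
  shows "oper A f (x(k := \<ominus> a)) = \<ominus> oper A f (x(k := a))"
proof -
  have cl: "oper A f (x(k := b)) \<in> carrier A" if "b \<in> carrier A" for b
    using f fun_upd_tuples[OF x k that] by (rule oper_closed)
  have "oper A f (x(k := \<ominus> a)) \<oplus> oper A f (x(k := a)) = \<zero>"
    using oper_add[OF f x k, of "\<ominus> a" a] oper_zero[OF f x k] a by (simp add: l_neg)
  then show ?thesis
    using cl a by (metis a_inv_closed minus_equality)
qed

text \<open>Additivity at one new position \<open>j\<close> splits every term in two, according to
  whether entry \<open>j\<close> comes from \<open>u\<close> or from \<open>v\<close>; these are the
  subsets of \<open>insert j s\<close> with and without \<open>j\<close>.\<close>

lemma oper_override_add:
  assumes f: "f \<in> ops V" and s: "s \<subseteq> {1..ar V f}"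
    and v: "v \<in> tuples (ar V f) (carrier A)" and u: "u \<in> s \<rightarrow> carrier A"
  shows "oper A f (override_on v (\<lambda>k. u k \<oplus> v k) s)
    = (\<Oplus>t\<in>Pow s. oper A f (override_on v u t))"
proof -
  have "finite s"
    using s finite_subset by blast
  then show ?thesis
    using s v u
  \<comment> \<open>\<open>v\<close> must vary: taking entry \<open>j\<close> from \<open>u\<close>
    changes the base tuple to \<open>v(j := u j)\<close>.\<close>
  proof (induction s arbitrary: v)
    case empty
    then show ?case using f by simp
  next
    case (insert j s)
    let ?w = "\<lambda>v s. override_on v (\<lambda>k. u k \<oplus> v k) s"
    have j: "j \<in> {1..ar V f}" and uj: "u j \<in> carrier A" and vj: "v j \<in> carrier A"
      using insert.prems by auto
    have us: "u \<in> s \<rightarrow> carrier A" and s: "s \<subseteq> {1..ar V f}"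
      using insert.prems by auto
    have w: "?w v s \<in> tuples (ar V f) (carrier A)"
      using insert.prems by (intro override_on_tuples) auto
    have v': "v(j := u j) \<in> tuples (ar V f) (carrier A)"
      using insert.prems(2) j uj by (rule fun_upd_tuples)
    have e1: "?w v (insert j s) = (?w v s)(j := u j \<oplus> v j)"
      by (rule override_on_insert)
    have e2: "(?w v s)(j := u j) = ?w (v(j := u j)) s"
      using insert.hyps by (auto simp: override_on_def fun_eq_iff)
    have e3: "(?w v s)(j := v j) = ?w v s"
      using insert.hyps by (auto simp: override_on_def fun_eq_iff)
    have e4: "override_on (v(j := u j)) u t = override_on v u (insert j t)" for t
      by (auto simp: override_on_def fun_eq_iff)
    have cl: "oper A f (override_on v u t) \<in> carrier A" if "t \<subseteq> insert j s" for t
      by (intro oper_closed[OF f] override_on_tuples[OF insert.prems(2)])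
        (use that insert.prems in auto)
    have inj: "inj_on (insert j) (Pow s)"
      using insert.hyps by (auto simp: inj_on_def)
    have disj: "Pow s \<inter> insert j ` Pow s = {}"
      using insert.hyps by auto
    have "oper A f (?w v (insert j s)) = oper A f (?w (v(j := u j)) s) \<oplus> oper A f (?w v s)"
      unfolding e1 using oper_add[OF f w j uj vj] by (simp only: e2 e3)
    also have "oper A f (?w (v(j := u j)) s) = (\<Oplus>t\<in>Pow s. oper A f (override_on v u (insert j t)))"
      using insert.IH[OF s v' us] by (simp only: e4)
    also have "\<dots> = (\<Oplus>t\<in>insert j ` Pow s. oper A f (override_on v u t))"
      by (rule finsum_reindex[OF _ inj, symmetric]) (auto intro!: cl)
    also have "oper A f (?w v s) = (\<Oplus>t\<in>Pow s. oper A f (override_on v u t))"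
      by (rule insert.IH[OF s insert.prems(2) us])
    also have "(\<Oplus>t\<in>insert j ` Pow s. oper A f (override_on v u t))
        \<oplus> (\<Oplus>t\<in>Pow s. oper A f (override_on v u t))
      = (\<Oplus>t\<in>Pow (insert j s). oper A f (override_on v u t))"
    proof -
      have "(\<Oplus>t\<in>Pow s \<union> insert j ` Pow s. oper A f (override_on v u t))
        = (\<Oplus>t\<in>Pow s. oper A f (override_on v u t))
          \<oplus> (\<Oplus>t\<in>insert j ` Pow s. oper A f (override_on v u t))"
        using insert.hyps(1) disj by (intro finsum_Un_disjoint) (auto intro!: cl)
      then show ?thesis
        unfolding Pow_insert
        by (simp add: a_comm finsum_closed cl image_subset_iff subset_insertI2 Pi_iff insert_mono)
    qed
    finally show ?case .
  qed
qed

lemma oper_override_neg: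
  assumes f: "f \<in> ops V" and s: "s \<subseteq> {1..ar V f}"
    and v: "v \<in> tuples (ar V f) (carrier A)" and u: "u \<in> s \<rightarrow> carrier A"
  shows "oper A f (override_on v (\<lambda>k. \<ominus> u k) s)
    = [((- 1 :: int) ^ card s)] \<cdot> oper A f (override_on v u s)"
proof -
  have "finite s"
    using s finite_subset by blast
  then show ?thesis
    using s v u
  proof (induction s arbitrary: v)
    case empty
    then show ?case using f by simp
  next
    case (insert j s)
    have j: "j \<in> {1..ar V f}" and uj: "u j \<in> carrier A"
      using insert.prems by auto
    have us: "u \<in> s \<rightarrow> carrier A" and s: "s \<subseteq> {1..ar V f}"
      using insert.prems by auto
    have w: "override_on v (\<lambda>k. \<ominus> u k) s \<in> tuples (ar V f) (carrier A)"
      using insert.prems by (intro override_on_tuples) auto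
    have v': "v(j := u j) \<in> tuples (ar V f) (carrier A)"
      using insert.prems(2) j uj by (rule fun_upd_tuples)
    have e: "(override_on v (\<lambda>k. \<ominus> u k) s)(j := u j) = override_on (v(j := u j)) (\<lambda>k. \<ominus> u k) s"
      using insert.hyps by (auto simp: override_on_def fun_eq_iff)
    have w': "override_on v u (insert j s) \<in> tuples (ar V f) (carrier A)"
      using insert.prems by (intro override_on_tuples) auto
    have "oper A f (override_on v (\<lambda>k. \<ominus> u k) (insert j s))
        = \<ominus> oper A f (override_on (v(j := u j)) (\<lambda>k. \<ominus> u k) s)"
      unfolding override_on_insert oper_neg[OF f w j uj] e ..
    also have "\<dots> = [((- 1 :: int) ^ card (insert j s))] \<cdot> oper A f (override_on v u (insert j s))"
      unfolding insert.IH[OF s v' us] card_insert_disjoint[OF insert.hyps]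
        override_on_insert'
      by (rule add_pow_minus_one_Suc[symmetric])
        (rule oper_closed[OF f w'[unfolded override_on_insert']])
    finally show ?case .
  qed
qed

text \<open>The difference is written with \<open>\<ominus> u k\<close> first, so that the expansion
  replaces entries of \<open>v\<close> by negated entries of \<open>u\<close>; each replacement then
  contributes one sign.\<close>

lemma oper_override_minus:
  assumes f: "f \<in> ops V" and s: "s \<subseteq> {1..ar V f}"
    and v: "v \<in> tuples (ar V f) (carrier A)" and u: "u \<in> s \<rightarrow> carrier A"
  shows "oper A f (override_on v (\<lambda>k. v k \<ominus> u k) s)
    = (\<Oplus>t\<in>Pow s. [((- 1 :: int) ^ card t)] \<cdot> oper A f (override_on v u t))"
proof -
  have "override_on v (\<lambda>k. v k \<ominus> u k) s = override_on v (\<lambda>k. \<ominus> u k \<oplus> v k) s"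
  proof
    fix k
    have "v k \<ominus> u k = \<ominus> u k \<oplus> v k" if "k \<in> s"
    proof -
      have "v k \<in> carrier A" "u k \<in> carrier A"
        using that s v u by (auto simp: PiE_iff)
      then show ?thesis by (simp add: a_minus_def a_comm)
    qed
    then show "override_on v (\<lambda>k. v k \<ominus> u k) s k = override_on v (\<lambda>k. \<ominus> u k \<oplus> v k) s k"
      by (simp add: override_on_def)
  qed
  then have "oper A f (override_on v (\<lambda>k. v k \<ominus> u k) s)
      = (\<Oplus>t\<in>Pow s. oper A f (override_on v (\<lambda>k. \<ominus> u k) t))"
    using oper_override_add[OF f s v, of "\<lambda>k. \<ominus> u k"] u by (auto simp: Pi_iff)
  also have "\<dots> = (\<Oplus>t\<in>Pow s. [((- 1 :: int) ^ card t)] \<cdot> oper A f (override_on v u t))"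
  proof (rule finsum_cong')
    show "(\<lambda>t. [((- 1 :: int) ^ card t)] \<cdot> oper A f (override_on v u t)) \<in> Pow s \<rightarrow> carrier A"
      by (intro Pi_I add_pow_int_closed oper_closed[OF f] override_on_tuples[OF v])
        (use s u in auto)
    show "oper A f (override_on v (\<lambda>k. \<ominus> u k) t)
        = [((- 1 :: int) ^ card t)] \<cdot> oper A f (override_on v u t)" if "t \<in> Pow s" for t
      using that s u by (intro oper_override_neg f v) auto
  qed simp
  finally show ?thesis .
qed

end

section \<open>Equations between differences in an abelian group\<close>

context abelian_group
begin

lemma minus_eq_iff: "\<lbrakk>x \<in> carrier G; y \<in> carrier G; z \<in> carrier G\<rbrakk> \<Longrightarrow> x \<ominus> y = z \<longleftrightarrow> x = z \<oplus> y"
  by (metis a_minus_def add.inv_solve_right' a_inv_closed a_closed)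

lemma eq_minus_iff: "\<lbrakk>x \<in> carrier G; y \<in> carrier G; z \<in> carrier G\<rbrakk> \<Longrightarrow> x = z \<ominus> y \<longleftrightarrow> x \<oplus> y = z"
  using minus_eq_iff[of z y x] by auto

lemma add_minus_eq:
  "\<lbrakk>x \<in> carrier G; y \<in> carrier G; z \<in> carrier G\<rbrakk> \<Longrightarrow> x \<oplus> (y \<ominus> z) = (x \<oplus> y) \<ominus> z"
  by (simp add: a_minus_def a_assoc)

lemma minus_add_eq:
  "\<lbrakk>x \<in> carrier G; y \<in> carrier G; z \<in> carrier G\<rbrakk> \<Longrightarrow> (x \<ominus> y) \<oplus> z = (x \<oplus> z) \<ominus> y"
  by (simp add: a_minus_def a_ac)

lemma minus_minus_eq:
  "\<lbrakk>x \<in> carrier G; y \<in> carrier G; z \<in> carrier G\<rbrakk> \<Longrightarrow> x \<ominus> y \<ominus> z = x \<ominus> (y \<oplus> z)"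
  by (simp add: a_minus_def a_ac minus_add)

lemma minus_minus_eq2:
  "\<lbrakk>x \<in> carrier G; y \<in> carrier G; z \<in> carrier G\<rbrakk> \<Longrightarrow> x \<ominus> (y \<ominus> z) = (x \<oplus> z) \<ominus> y"
  by (simp add: a_minus_def a_ac minus_add)

lemma minus_add_cancel: "\<lbrakk>x \<in> carrier G; y \<in> carrier G\<rbrakk> \<Longrightarrow> (x \<ominus> y) \<oplus> y = x"
  by (simp add: a_minus_def a_assoc l_neg)

text \<open>Used as rewrite rules: differences are gathered on the outside and subtracted terms
  moved across the equation, until only sums remain for \<open>a_ac\<close>.\<close>

lemmas group_simps = minus_eq_iff eq_minus_iff add_minus_eq minus_add_eq minus_minus_eq
  minus_minus_eq2 a_ac

end

lemma (in abelian_group_hom) hom_minus [simp]: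
  "x \<in> carrier G \<Longrightarrow> y \<in> carrier G \<Longrightarrow> h (x \<ominus>\<^bsub>G\<^esub> y) = h x \<ominus>\<^bsub>H\<^esub> h y"
  by (simp add: a_minus_def)

lemma (in multilinear_algebra) smult_minus:
  assumes "r \<in> carrier (scalars V)" "x \<in> carrier A" "y \<in> carrier A"
  shows "r \<odot> (x \<ominus> y) = r \<odot> x \<ominus> r \<odot> y"
  using smult_r_distr[of r "x \<ominus> y" y] assms by (simp add: eq_minus_iff minus_add_cancel)

text \<open>This brings the expansion into the shape of the signed sums in \<open>witnesses\<close>.
  The entries in \<open>s\<close> stay fixed and the others become differences, so the terms are
  indexed by the subsets \<open>t\<close> of the complement of \<open>s\<close>, renamed to
  \<open>r = s \<union> t\<close>. The empty \<open>t\<close> gives the leading term and the full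
  complement the last one; pulling a minus sign out of the others explains the extra 1 in the
  exponents.\<close>

lemma (in multilinear_algebra) oper_override_minus_split:
  assumes f: "f \<in> ops V" and s: "s \<subset> {1..ar V f}"
    and v: "v \<in> tuples (ar V f) (carrier A)" and u: "u \<in> {1..ar V f} \<rightarrow> carrier A"
  shows "oper A f (override_on v (\<lambda>k. v k \<ominus> u k) ({1..ar V f} - s))
    = oper A f v \<ominus>
      ((\<Oplus>r\<in>{r. s \<subset> r \<and> r \<subset> {1..ar V f}}.
          [((- 1 :: int) ^ (1 + card r - card s))] \<cdot> oper A f (override_on v u (r - s)))
       \<oplus> [((- 1 :: int) ^ (1 + ar V f - card s))] \<cdot> oper A f (override_on v u ({1..ar V f} - s)))"
proof -
  let ?n = "{1..ar V f}" and ?R = "{r. s \<subset> r \<and> r \<subset> {1..ar V f}}"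
  let ?g = "\<lambda>t. [((- 1 :: int) ^ card t)] \<cdot> oper A f (override_on v u t)"
  let ?g' = "\<lambda>r. [((- 1 :: int) ^ (1 + card r - card s))] \<cdot> oper A f (override_on v u (r - s))"
  have oc: "oper A f (override_on v u t) \<in> carrier A" if "t \<subseteq> ?n" for t
    by (intro oper_closed[OF f] override_on_tuples[OF v]) (use that u in auto)
  have gc: "?g t \<in> carrier A" if "t \<subseteq> ?n" for t
    using oc[OF that] by simp
  have fin: "finite ?R"
    by (rule finite_subset[of _ "Pow ?n"]) auto
  have inj: "inj_on (\<lambda>r. r - s) ?R"
    by (auto simp: inj_on_def)
  have Pow: "Pow (?n - s) = insert {} (insert (?n - s) ((\<lambda>r. r - s) ` ?R))"
  proof (intro equalityI subsetI)
    fix t assume t: "t \<in> Pow (?n - s)"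
    show "t \<in> insert {} (insert (?n - s) ((\<lambda>r. r - s) ` ?R))"
    proof (cases "t = {} \<or> t = ?n - s")
      case False
      with t s have "s \<union> t \<in> ?R" "t = s \<union> t - s"
        by auto
      then show ?thesis by blast
    qed auto
  qed (use s in auto)
  have neg: "?g (r - s) = \<ominus> ?g' r" if "s \<subseteq> r" "r \<subseteq> ?n" for r
  proof -
    have "card (r - s) = card r - card s" "card s \<le> card r"
      using that finite_subset[OF that(2)] finite_subset[OF that(1)]
      by (auto intro: card_Diff_subset card_mono)
    \<comment> \<open>Subtraction of naturals is harmless: the exponent parses as
      \<open>(1 + card r) - card s\<close>, and \<open>card s \<le> card r\<close>.\<close>
    then have e: "1 + card r - card s = Suc (card (r - s))"
      by simp
    have "r - s \<subseteq> ?n"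
      using that by auto
    then show ?thesis
      using oc unfolding e
      by (subst add_pow_minus_one_Suc) (auto simp: minus_minus)
  qed
  have gc': "?g' r \<in> carrier A" if "s \<subseteq> r" "r \<subseteq> ?n" for r
    using oc[of "r - s"] that by auto
  have "oper A f (override_on v (\<lambda>k. v k \<ominus> u k) (?n - s)) = (\<Oplus>t\<in>Pow (?n - s). ?g t)"
    using u by (intro oper_override_minus f v) auto
  \<comment> \<open>\<open>s\<close> is a proper subset, so \<open>{}\<close> and the full
    complement are distinct and can be split off as separate summands.\<close>
  also have "\<dots> = ?g {} \<oplus> (?g (?n - s) \<oplus> (\<Oplus>t\<in>(\<lambda>r. r - s) ` ?R. ?g t))"
  proof -
    have "(\<Oplus>t\<in>insert (?n - s) ((\<lambda>r. r - s) ` ?R). ?g t)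
        = ?g (?n - s) \<oplus> (\<Oplus>t\<in>(\<lambda>r. r - s) ` ?R. ?g t)"
      using fin by (intro finsum_insert) (auto intro!: gc)
    moreover have "(\<Oplus>t\<in>insert {} (insert (?n - s) ((\<lambda>r. r - s) ` ?R)). ?g t)
        = ?g {} \<oplus> (\<Oplus>t\<in>insert (?n - s) ((\<lambda>r. r - s) ` ?R). ?g t)"
      using fin s oper_closed[OF f v] by (intro finsum_insert) (auto intro!: gc)
    ultimately show ?thesis
      unfolding Pow by simp
  qed
  also have "(\<Oplus>t\<in>(\<lambda>r. r - s) ` ?R. ?g t) = (\<Oplus>r\<in>?R. ?g (r - s))"
    by (rule finsum_reindex[OF _ inj]) (auto intro!: gc)
  also have "\<dots> = (\<Oplus>r\<in>?R. \<ominus> ?g' r)"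
    by (rule finsum_cong') (auto intro!: neg gc')
  also have "\<dots> = \<ominus> (\<Oplus>r\<in>?R. ?g' r)"
    by (rule finsum_a_inv) (auto intro!: gc')
  also have "?g (?n - s) = \<ominus> ?g' ?n"
    using s by (intro neg) auto
  also have "?g {} \<oplus> (\<ominus> ?g' ?n \<oplus> \<ominus> (\<Oplus>r\<in>?R. ?g' r)) = ?g {} \<ominus> ((\<Oplus>r\<in>?R. ?g' r) \<oplus> ?g' ?n)"
  proof -
    have "?g' ?n \<in> carrier A"
      using s by (intro gc') auto
    moreover have "?g {} \<in> carrier A"
      by (rule gc) simp
    moreover have "(\<Oplus>r\<in>?R. ?g' r) \<in> carrier A"
      by (intro finsum_closed Pi_I gc') auto
    ultimately show ?thesis
      by (simp only: a_minus_def minus_add a_ac a_inv_closed)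
  qed
  finally show ?thesis
    using v f by simp
qed

section \<open>Homomorphisms and subalgebras\<close>

lemma varietyD:
  assumes "variety V"
  shows "f \<in> ops V \<Longrightarrow> 1 \<le> ar V f" "(t, u) \<in> idents V \<Longrightarrow> wf_mterm V t"
    "(t, u) \<in> idents V \<Longrightarrow> wf_mterm V u"
  using assms unfolding variety_def by auto

lemma compose_tuples: "g \<in> X \<rightarrow> Y \<Longrightarrow> x \<in> tuples n X \<Longrightarrow> compose {1..n} g x \<in> tuples n Y"
  by (auto simp: compose_def PiE_iff extensional_def)

lemma compose_tuples_id:
  assumes "\<And>a. a \<in> X \<Longrightarrow> h (g a) = a" "x \<in> tuples n X"
  shows "compose {1..n} h (compose {1..n} g x) = x"
proof
  fix k
  show "compose {1..n} h (compose {1..n} g x) k = x k"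
    using assms by (cases "k \<in> {1..n}") (auto simp: compose_def PiE_iff extensional_def)
qed

lemma compose_fun_upd:
  "k \<in> {1..n} \<Longrightarrow> compose {1..n} g (x(k := a)) = (compose {1..n} g x)(k := g a)"
  by (auto simp: compose_def fun_eq_iff)

lemma malg_homD:
  assumes "\<phi> \<in> malg_hom V A B"
  shows "x \<in> carrier A \<Longrightarrow> \<phi> x \<in> carrier B"
    "x \<in> carrier A \<Longrightarrow> y \<in> carrier A \<Longrightarrow> \<phi> (x \<oplus>\<^bsub>A\<^esub> y) = \<phi> x \<oplus>\<^bsub>B\<^esub> \<phi> y"
    "r \<in> carrier (scalars V) \<Longrightarrow> x \<in> carrier A \<Longrightarrow> \<phi> (r \<odot>\<^bsub>A\<^esub> x) = r \<odot>\<^bsub>B\<^esub> \<phi> x"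
    "f \<in> ops V \<Longrightarrow> v \<in> tuples (ar V f) (carrier A) \<Longrightarrow>
      \<phi> (oper A f v) = oper B f (compose {1..ar V f} \<phi> v)"
  using assms unfolding malg_hom_def by auto

lemma malg_homI:
  assumes "\<And>x. x \<in> carrier A \<Longrightarrow> \<phi> x \<in> carrier B"
    "\<And>x y. x \<in> carrier A \<Longrightarrow> y \<in> carrier A \<Longrightarrow> \<phi> (x \<oplus>\<^bsub>A\<^esub> y) = \<phi> x \<oplus>\<^bsub>B\<^esub> \<phi> y"
    "\<And>r x. r \<in> carrier (scalars V) \<Longrightarrow> x \<in> carrier A \<Longrightarrow> \<phi> (r \<odot>\<^bsub>A\<^esub> x) = r \<odot>\<^bsub>B\<^esub> \<phi> x"
    "\<And>f v. f \<in> ops V \<Longrightarrow> v \<in> tuples (ar V f) (carrier A) \<Longrightarrow>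
      \<phi> (oper A f v) = oper B f (compose {1..ar V f} \<phi> v)"
  shows "\<phi> \<in> malg_hom V A B"
  using assms unfolding malg_hom_def by auto

lemma malg_hom_abelian_group_hom:
  assumes "multilinear_algebra V A" "multilinear_algebra V B" "\<phi> \<in> malg_hom V A B"
  shows "abelian_group_hom A B \<phi>"
proof -
  interpret A: multilinear_algebra V A by fact
  interpret B: multilinear_algebra V B by fact
  have "\<phi> \<in> hom (add_monoid A) (add_monoid B)"
    using malg_homD[OF assms(3)] by (auto simp: hom_def)
  then show ?thesis
    by (intro abelian_group_homI A.abelian_group_axioms B.abelian_group_axioms
        group_hom.intro group_hom_axioms.intro A.a_group B.a_group)
qed

lemma malg_hom_compose:
  assumes "\<phi> \<in> malg_hom V A B" "\<psi> \<in> malg_hom V B C"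
  shows "(\<lambda>x. \<psi> (\<phi> x)) \<in> malg_hom V A C"
proof (rule malg_homI)
  fix f v
  assume f: "f \<in> ops V" and v: "v \<in> tuples (ar V f) (carrier A)"
  have "compose {1..ar V f} \<phi> v \<in> tuples (ar V f) (carrier B)"
    using malg_homD(1)[OF assms(1)] v by (intro compose_tuples) auto
  moreover have "compose {1..ar V f} \<psi> (compose {1..ar V f} \<phi> v)
      = compose {1..ar V f} (\<lambda>x. \<psi> (\<phi> x)) v"
    by (auto simp: compose_def)
  ultimately show "\<psi> (\<phi> (oper A f v)) = oper C f (compose {1..ar V f} (\<lambda>x. \<psi> (\<phi> x)) v)"
    using f v malg_homD(4)[OF assms(1)] malg_homD(4)[OF assms(2)] by simp
qed (use malg_homD[OF assms(1)] malg_homD[OF assms(2)] in simp_all)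

text \<open>Elements of the automorphism groups are extensional, whereas plain composites and
  \<open>inv_into\<close> are not; agreement on the carrier is enough to pass between them.\<close>

lemma (in multilinear_algebra) malg_hom_cong:
  assumes "\<phi> \<in> malg_hom V A B" "\<And>x. x \<in> carrier A \<Longrightarrow> \<psi> x = \<phi> x"
  shows "\<psi> \<in> malg_hom V A B"
proof (rule malg_homI)
  fix f v
  assume f: "f \<in> ops V" and v: "v \<in> tuples (ar V f) (carrier A)"
  have "compose {1..ar V f} \<psi> v = compose {1..ar V f} \<phi> v"
    using v assms(2) by (auto simp: compose_def PiE_iff fun_eq_iff)
  then show "\<psi> (oper A f v) = oper B f (compose {1..ar V f} \<psi> v)"
    using malg_homD(4)[OF assms(1) f v] assms(2) f v by simp
qed (use malg_homD[OF assms(1)] assms(2) in simp_all)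

lemma (in multilinear_algebra) id_malg_hom: "(\<lambda>x. x) \<in> malg_hom V A A"
  using compose_tuples_id[of _ "\<lambda>x. x" "\<lambda>x. x"]
  by (intro malg_homI) (simp_all add: compose_def PiE_restrict)

text \<open>Each law follows by applying the inverse to the law of \<open>\<phi>\<close> at
  preimages. Algebra axioms enter only on the side of A, so B may be a structure just transported
  along \<open>\<phi>\<close>, as in \<open>coc_in_Z2\<close>.\<close>

lemma (in multilinear_algebra) inv_into_malg_hom:
  assumes "\<phi> \<in> malg_hom V A B" "bij_betw \<phi> (carrier A) (carrier B)"
  shows "inv_into (carrier A) \<phi> \<in> malg_hom V B A"
proof -
  let ?k = "inv_into (carrier A) \<phi>"
  have k: "?k y \<in> carrier A" "\<phi> (?k y) = y" if "y \<in> carrier B" for y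
    using that assms(2) by (auto simp: bij_betw_def inv_into_into f_inv_into_f)
  have k': "?k (\<phi> x) = x" if "x \<in> carrier A" for x
    using that assms(2) by (simp add: bij_betw_def)
  show ?thesis
  proof (rule malg_homI)
    fix x y
    assume "x \<in> carrier B" "y \<in> carrier B"
    then show "?k (x \<oplus>\<^bsub>B\<^esub> y) = ?k x \<oplus> ?k y"
      using malg_homD(2)[OF assms(1), of "?k x" "?k y"] k k' a_closed by metis
  next
    fix r x
    assume "r \<in> carrier (scalars V)" "x \<in> carrier B"
    then show "?k (r \<odot>\<^bsub>B\<^esub> x) = r \<odot> ?k x"
      using malg_homD(3)[OF assms(1), of r "?k x"] k k' smult_closed by metis
  next
    fix f v
    assume f: "f \<in> ops V" and v: "v \<in> tuples (ar V f) (carrier B)"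
    have kv: "compose {1..ar V f} ?k v \<in> tuples (ar V f) (carrier A)"
      using v k by (intro compose_tuples) auto
    have "compose {1..ar V f} \<phi> (compose {1..ar V f} ?k v) = v"
      using k(2) v by (rule compose_tuples_id)
    then show "?k (oper B f v) = oper A f (compose {1..ar V f} ?k v)"
      using malg_homD(4)[OF assms(1) f kv] k'[OF oper_closed[OF f kv]] by simp
  qed (rule k)
qed

lemma (in multilinear_algebra) multilinear_algebra_subset:
  assumes "K \<subseteq> carrier A" "\<zero> \<in> K" "\<And>x. x \<in> K \<Longrightarrow> \<ominus> x \<in> K"
    "\<And>x y. x \<in> K \<Longrightarrow> y \<in> K \<Longrightarrow> x \<oplus> y \<in> K"
    "\<And>r x. r \<in> carrier (scalars V) \<Longrightarrow> x \<in> K \<Longrightarrow> r \<odot> x \<in> K"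
    "\<And>f v. f \<in> ops V \<Longrightarrow> v \<in> tuples (ar V f) K \<Longrightarrow> oper A f v \<in> K"
  shows "multilinear_algebra V (A\<lparr>carrier := K\<rparr>)"
  unfolding multilinear_algebra_iff multilinear_expansion_def
proof (intro conjI ballI)
  have K: "x \<in> carrier A" if "x \<in> K" for x
    using that assms(1) by auto
  show "abelian_group (A\<lparr>carrier := K\<rparr>)"
  proof (rule abelian_groupI)
    fix x assume "x \<in> carrier (A\<lparr>carrier := K\<rparr>)"
    then show "\<exists>y\<in>carrier (A\<lparr>carrier := K\<rparr>).
        y \<oplus>\<^bsub>A\<lparr>carrier := K\<rparr>\<^esub> x = \<zero>\<^bsub>A\<lparr>carrier := K\<rparr>\<^esub>"
      using assms(3) K by (auto intro!: bexI[of _ "\<ominus> x"] simp: l_neg)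
  qed (use assms(2,4) K in \<open>simp_all add: a_ac\<close>)
  fix f v
  assume f: "f \<in> ops V" and v: "v \<in> tuples (ar V f) (carrier (A\<lparr>carrier := K\<rparr>))"
  show "oper (A\<lparr>carrier := K\<rparr>) f v \<in> carrier (A\<lparr>carrier := K\<rparr>)"
    using f v assms(6) by simp
  have v': "v \<in> tuples (ar V f) (carrier A)"
    using v K by (auto simp: PiE_iff)
  fix k a
  assume k: "k \<in> {1..ar V f}" and a: "a \<in> carrier (A\<lparr>carrier := K\<rparr>)"
  fix b
  show "b \<in> carrier (A\<lparr>carrier := K\<rparr>) \<Longrightarrow> oper (A\<lparr>carrier := K\<rparr>) f (v(k := a \<oplus>\<^bsub>A\<lparr>carrier := K\<rparr>\<^esub> b))
    = oper (A\<lparr>carrier := K\<rparr>) f (v(k := a))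
      \<oplus>\<^bsub>A\<lparr>carrier := K\<rparr>\<^esub> oper (A\<lparr>carrier := K\<rparr>) f (v(k := b))"
    using oper_add[OF f v' k] a K by simp
next
  fix f v k a r
  assume f: "f \<in> ops V" and v: "v \<in> tuples (ar V f) (carrier (A\<lparr>carrier := K\<rparr>))"
    and k: "k \<in> {1..ar V f}" and a: "a \<in> carrier (A\<lparr>carrier := K\<rparr>)"
    and r: "r \<in> carrier (scalars V)"
  have "v \<in> tuples (ar V f) (carrier A)" "a \<in> carrier A"
    using v a assms(1) by (auto simp: PiE_iff)
  then show "oper (A\<lparr>carrier := K\<rparr>) f (v(k := r \<odot>\<^bsub>A\<lparr>carrier := K\<rparr>\<^esub> a))
    = r \<odot>\<^bsub>A\<lparr>carrier := K\<rparr>\<^esub> oper (A\<lparr>carrier := K\<rparr>) f (v(k := a))"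
    using oper_smult[OF f _ k _ r] by simp
qed (use assms(1,5) in \<open>simp_all add: subset_iff smult_l_distr smult_r_distr smult_assoc smult_one\<close>)

text \<open>The arity bound matters here: if there is at least one argument and all lie in the
  kernel, \<open>p\<close> sends the value to an operation of Q at a tuple with a zero entry. A
  constant could leave the kernel.\<close>

lemma multilinear_algebra_ideal_alg:
  assumes "variety V" "multilinear_algebra V B" "multilinear_algebra V Q" "p \<in> malg_hom V B Q"
  shows "multilinear_algebra V (ideal_alg B Q p)"
proof -
  interpret B: multilinear_algebra V B by fact
  interpret Q: multilinear_algebra V Q by fact
  interpret p: abelian_group_hom B Q p
    by (rule malg_hom_abelian_group_hom) fact+
  have smult_zero: "r \<odot>\<^bsub>Q\<^esub> \<zero>\<^bsub>Q\<^esub> = \<zero>\<^bsub>Q\<^esub>" if "r \<in> carrier (scalars V)" for r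
    using Q.smult_r_distr[OF that, of "\<zero>\<^bsub>Q\<^esub>" "\<zero>\<^bsub>Q\<^esub>"] Q.smult_closed[OF that, of "\<zero>\<^bsub>Q\<^esub>"]
    by (metis Q.add.l_cancel_one Q.l_zero Q.zero_closed)
  show ?thesis
    unfolding ideal_alg_def
  proof (rule B.multilinear_algebra_subset)
    fix f v
    assume f: "f \<in> ops V" and v: "v \<in> tuples (ar V f) (a_kernel B Q p)"
    let ?w = "compose {1..ar V f} p v"
    have vB: "v \<in> tuples (ar V f) (carrier B)"
      using v by (auto simp: PiE_iff a_kernel_def')
    then have w: "?w \<in> tuples (ar V f) (carrier Q)"
      by (intro compose_tuples) auto
    have one: "1 \<in> {1..ar V f}"
      using varietyD(1)[OF assms(1) f] by simp
    \<comment> \<open>Writes the zero entry as an update, the form required by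
      \<open>oper_zero\<close>.\<close>
    then have "?w(1 := \<zero>\<^bsub>Q\<^esub>) = ?w"
      using v by (auto simp: compose_def a_kernel_def' PiE_iff fun_eq_iff)
    then have "oper Q f ?w = \<zero>\<^bsub>Q\<^esub>"
      using Q.oper_zero[OF f w one] by simp
    then show "oper B f v \<in> a_kernel B Q p"
      using f vB malg_homD(4)[OF assms(4) f vB] by (simp add: a_kernel_def')
  qed (use malg_homD[OF assms(4)] smult_zero in \<open>auto simp: a_kernel_def'\<close>)
qed

section \<open>Automorphism groups\<close>

text \<open>One proof for both groups: \<open>K = {}\<close> gives \<open>AutG\<close>,
  \<open>K = carrier I\<close> gives \<open>AutG_pres\<close>. Equality of \<open>K\<close> with its
  image, instead of inclusion, makes the set closed under inverses.\<close>

lemma (in multilinear_algebra) subgroup_malg_aut_pres: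
  assumes "K \<subseteq> carrier A"
  shows "subgroup {\<phi> \<in> malg_aut V A. \<phi> ` K = K} (BijGroup (carrier A))"
proof (rule subgroup.intro)
  show "{\<phi> \<in> malg_aut V A. \<phi> ` K = K} \<subseteq> carrier (BijGroup (carrier A))"
    by (auto simp: malg_aut_def BijGroup_def)
next
  fix \<phi> \<psi>
  assume *: "\<phi> \<in> {\<phi> \<in> malg_aut V A. \<phi> ` K = K}" "\<psi> \<in> {\<phi> \<in> malg_aut V A. \<phi> ` K = K}"
  then have B: "\<phi> \<in> Bij (carrier A)" "\<psi> \<in> Bij (carrier A)"
    by (auto simp: malg_aut_def)
  have "compose (carrier A) \<phi> \<psi> \<in> malg_hom V A A"
    by (rule malg_hom_cong[OF malg_hom_compose[of \<psi> V A A \<phi>]])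
      (use * in \<open>simp_all add: malg_aut_def compose_def\<close>)
  moreover have "compose (carrier A) \<phi> \<psi> ` K = \<phi> ` (\<psi> ` K)"
    unfolding image_image using assms by (intro image_cong) (auto simp: compose_def)
  ultimately show "\<phi> \<otimes>\<^bsub>BijGroup (carrier A)\<^esub> \<psi> \<in> {\<phi> \<in> malg_aut V A. \<phi> ` K = K}"
    using * B compose_Bij[OF B] by (simp add: malg_aut_def BijGroup_def)
next
  have "(\<lambda>x\<in>carrier A. x) \<in> malg_hom V A A"
    by (rule malg_hom_cong[OF id_malg_hom]) simp
  moreover have "(\<lambda>x\<in>carrier A. x) ` K = K"
    using assms by (auto simp: image_iff)
  ultimately show "\<one>\<^bsub>BijGroup (carrier A)\<^esub> \<in> {\<phi> \<in> malg_aut V A. \<phi> ` K = K}"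
    by (simp add: BijGroup_def malg_aut_def id_Bij)
next
  fix \<phi>
  assume *: "\<phi> \<in> {\<phi> \<in> malg_aut V A. \<phi> ` K = K}"
  then have B: "\<phi> \<in> Bij (carrier A)" and b: "bij_betw \<phi> (carrier A) (carrier A)"
    by (auto simp: malg_aut_def Bij_def)
  let ?k = "\<lambda>x\<in>carrier A. inv_into (carrier A) \<phi> x"
  have "?k \<in> malg_hom V A A"
    by (rule malg_hom_cong[OF inv_into_malg_hom[of \<phi> A]])
      (use * b in \<open>simp_all add: malg_aut_def\<close>)
  moreover have "?k ` K = K"
  proof -
    have "?k ` K = (\<lambda>x. inv_into (carrier A) \<phi> x) ` (\<phi> ` K)"
      using * assms by (intro image_cong) (simp_all add: subset_iff)
    also have "\<dots> = K"
      using b assms by (simp add: bij_betw_def inv_into_image_cancel)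
    finally show ?thesis .
  qed
  ultimately show "inv\<^bsub>BijGroup (carrier A)\<^esub> \<phi> \<in> {\<phi> \<in> malg_aut V A. \<phi> ` K = K}"
    using B by (simp add: inv_BijGroup malg_aut_def restrict_inv_into_Bij)
qed

lemma (in multilinear_algebra) group_AutG: "group (AutG V A)"
  using subgroup.subgroup_is_group[OF subgroup_malg_aut_pres[of "{}"] group_BijGroup]
  by (simp add: AutG_def)

lemma (in multilinear_algebra) group_AutG_pres:
  "carrier I \<subseteq> carrier A \<Longrightarrow> group (AutG_pres V A I)"
  using subgroup.subgroup_is_group[OF subgroup_malg_aut_pres group_BijGroup]
  by (simp add: AutG_pres_def)

section \<open>Transport of structure\<close>

lemma (in multilinear_algebra) mterm_val_closed:
  assumes "wf_mterm V t" "\<And>k. v k \<in> carrier A"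
  shows "mterm_val A v t \<in> carrier A"
  using assms
proof (induction t)
  case (TOp f ts)
  have "ts ! (k - 1) \<in> set ts" if "k \<in> {1..length ts}" for k
    using that by (intro nth_mem) auto
  then show ?case
    using TOp by (auto intro!: oper_closed)
qed auto

lemma mterm_val_hom:
  assumes "multilinear_algebra V A" "multilinear_algebra V B" "\<phi> \<in> malg_hom V A B"
    "wf_mterm V t" "\<And>k. v k \<in> carrier A"
  shows "\<phi> (mterm_val A v t) = mterm_val B (\<lambda>k. \<phi> (v k)) t"
proof -
  interpret A: multilinear_algebra V A by fact
  interpret h: abelian_group_hom A B \<phi>
    by (rule malg_hom_abelian_group_hom) fact+
  show ?thesis
    using assms(4,5)
  proof (induction t)
    case (TOp f ts)
    have mem: "ts ! (k - 1) \<in> set ts" if "k \<in> {1..length ts}" for k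
      using that by (intro nth_mem) auto
    let ?w = "\<lambda>k\<in>{1..length ts}. map (mterm_val A v) ts ! (k - 1)"
    have w: "?w \<in> tuples (ar V f) (carrier A)"
      using TOp.prems mem by (auto intro!: A.mterm_val_closed)
    have "compose {1..ar V f} \<phi> ?w
      = (\<lambda>k\<in>{1..length ts}. map (mterm_val B (\<lambda>k. \<phi> (v k))) ts ! (k - 1))"
      using TOp mem by (auto simp: compose_def fun_eq_iff)
    then show ?case
      using malg_homD(4)[OF assms(3) _ w] TOp.prems by simp
  qed (use A.mterm_val_closed malg_homD[OF assms(3)] in auto)
qed

text \<open>The axioms of B are pulled back: every element and tuple of B is an image, and the
  homomorphism equations read from right to left turn each axiom into that of A. Preservation of
  zero is a separate premise because \<open>malg_hom\<close> does not mention zero and it can be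
  deduced only once B is a group.\<close>

lemma (in multilinear_algebra) multilinear_algebra_bij:
  assumes V: "variety V" and g: "g \<in> malg_hom V A B" and bij: "bij_betw g (carrier A) (carrier B)"
    and zero: "g \<zero> = \<zero>\<^bsub>B\<^esub>"
  shows "multilinear_algebra V B"
proof -
  interpret R: ring "scalars V"
    using V by (simp add: variety_def)
  have sur: "\<exists>x\<in>carrier A. y = g x" if "y \<in> carrier B" for y
    using that bij by (auto simp: bij_betw_def)
  have gc: "g x \<in> carrier B" if "x \<in> carrier A" for x
    using malg_homD(1)[OF g that] .
  have sur': "\<exists>x\<in>tuples n (carrier A). y = compose {1..n} g x" if "y \<in> tuples n (carrier B)" for y n
  proof -
    let ?k = "inv_into (carrier A) g"
    have "?k b \<in> carrier A" "g (?k b) = b" if "b \<in> carrier B" for b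
      using that bij by (auto simp: bij_betw_def inv_into_into f_inv_into_f)
    then show ?thesis
      using that compose_tuples[of ?k "carrier B" "carrier A" y n]
        compose_tuples_id[of "carrier B" g ?k y n]
      by (intro bexI[of _ "compose {1..n} ?k y"]) auto
  qed
  note add = malg_homD(2)[OF g, symmetric] and smult = malg_homD(3)[OF g, symmetric]
    and oper = malg_homD(4)[OF g, symmetric]
  show ?thesis
    unfolding multilinear_algebra_iff multilinear_expansion_def
  proof (intro conjI ballI)
    show "abelian_group B"
    proof (rule abelian_groupI)
      fix x assume "x \<in> carrier B"
      then obtain x' where "x' \<in> carrier A" "x = g x'"
        using sur by auto
      then show "\<exists>y\<in>carrier B. y \<oplus>\<^bsub>B\<^esub> x = \<zero>\<^bsub>B\<^esub>"
        by (intro bexI[of _ "g (\<ominus> x')"]) (simp_all add: add gc l_neg zero)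
    qed (auto dest!: sur simp: add gc a_ac zero[symmetric])
    fix f v
    assume f: "f \<in> ops V" and v: "v \<in> tuples (ar V f) (carrier B)"
    obtain w where w: "w \<in> tuples (ar V f) (carrier A)" and vw: "v = compose {1..ar V f} g w"
      using sur'[OF v] by auto
    show "oper B f v \<in> carrier B"
      using f w by (simp add: vw oper gc)
    fix k a
    assume k: "k \<in> {1..ar V f}" and "a \<in> carrier B"
    then obtain a' where a': "a' \<in> carrier A" "a = g a'"
      using sur by auto
    note upd = compose_fun_upd[OF k, symmetric] and tup = fun_upd_tuples[OF w k]
    show "oper B f (v(k := a \<oplus>\<^bsub>B\<^esub> b)) = oper B f (v(k := a)) \<oplus>\<^bsub>B\<^esub> oper B f (v(k := b))"
      if "b \<in> carrier B" for b
      using sur[OF that] a' f w k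
      by (auto simp: vw upd add oper tup oper_add)
    show "oper B f (v(k := r \<odot>\<^bsub>B\<^esub> a)) = r \<odot>\<^bsub>B\<^esub> oper B f (v(k := a))"
      if "r \<in> carrier (scalars V)" for r
      using that a' f w k
      by (auto simp: vw upd smult oper tup oper_smult)
  qed (auto dest!: sur simp: add smult gc smult_l_distr smult_r_distr smult_assoc smult_one)
qed

text \<open>A valuation in B is the image of the valuation by preimages in A, where the identities
  hold, and \<open>g\<close> commutes with the evaluation of terms.\<close>

lemma in_variety_bij:
  assumes "variety V" "in_variety V A" "g \<in> malg_hom V A B"
    "bij_betw g (carrier A) (carrier B)" "g \<zero>\<^bsub>A\<^esub> = \<zero>\<^bsub>B\<^esub>"
  shows "in_variety V B"
proof -
  interpret A: multilinear_algebra V A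
    using assms(2) by (simp add: in_variety_def multilinear_algebra_iff)
  have B: "multilinear_algebra V B"
    by (rule A.multilinear_algebra_bij) fact+
  have "mterm_val B v t = mterm_val B v u" if tu: "(t, u) \<in> idents V" and v: "v \<in> UNIV \<rightarrow> carrier B" for t u v
  proof -
    let ?w = "\<lambda>k. inv_into (carrier A) g (v k)"
    have "v k \<in> g ` carrier A" for k
      using v assms(4) by (auto simp: bij_betw_def)
    then have w: "?w k \<in> carrier A" "g (?w k) = v k" for k
      by (simp_all add: inv_into_into f_inv_into_f)
    have "mterm_val A ?w t = mterm_val A ?w u"
      using assms(2) tu w(1) unfolding in_variety_def by fast
    then show ?thesis
      using mterm_val_hom[OF A.multilinear_algebra_axioms B assms(3)
            varietyD(2)[OF assms(1) tu], of ?w, OF w(1)]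
        mterm_val_hom[OF A.multilinear_algebra_axioms B assms(3)
            varietyD(3)[OF assms(1) tu], of ?w, OF w(1)]
      by (simp only: w(2))
  qed
  then show ?thesis
    using B by (auto simp: in_variety_def multilinear_algebra_iff)
qed

text \<open>Serves to move an extension to the type of pairs over which \<open>Z2\<close>
  quantifies; the operations have their intended meaning when \<open>g\<close> is injective on the
  carrier.\<close>

definition image_alg ::
    "('r, 'f) variety_data \<Rightarrow> ('a \<Rightarrow> 'b) \<Rightarrow> ('r, 'f, 'a) malg \<Rightarrow> ('r, 'f, 'b) malg" where
  "image_alg V g A =
     (let k = inv_into (carrier A) g in
      \<lparr>carrier = g ` carrier A, mult = undefined, one = undefined, ring.zero = g \<zero>\<^bsub>A\<^esub>,
       ring.add = (\<lambda>x y. g (k x \<oplus>\<^bsub>A\<^esub> k y)), smult = (\<lambda>r x. g (r \<odot>\<^bsub>A\<^esub> k x)),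
       oper = (\<lambda>f x. g (oper A f (compose {1..ar V f} k x)))\<rparr>)"

lemma image_alg:
  assumes "inj_on g (carrier A)"
  shows "g \<in> malg_hom V A (image_alg V g A)"
    "bij_betw g (carrier A) (carrier (image_alg V g A))"
    "g \<zero>\<^bsub>A\<^esub> = \<zero>\<^bsub>image_alg V g A\<^esub>"
  using assms compose_tuples_id[of "carrier A" "inv_into (carrier A) g" g]
  by (auto intro!: malg_homI simp: image_alg_def Let_def bij_betw_def)

section \<open>Extensions\<close>

text \<open>I is an algebra of its own, identified with the kernel by \<open>i\<close>, as in
  \<open>Z2\<close>. This generality serves three cases: the members of \<open>Z2\<close>, the given
  extension with \<open>i\<close> the identity, and its twist with \<open>i\<close> an inverse
  automorphism.\<close>

locale algebra_extension =
  I: multilinear_algebra V I + B: multilinear_algebra V B + Q: multilinear_algebra V Q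
  for V :: "('r, 'f) variety_data" and I :: "('r, 'f, 'a) malg" and B :: "('r, 'f, 'b) malg"
    and Q :: "('r, 'f, 'q) malg" +
  fixes p :: "'b \<Rightarrow> 'q" and i :: "'a \<Rightarrow> 'b" and l :: "'q \<Rightarrow> 'b"
  assumes V: "variety V"
    and ext: "extension V B Q p"
    and lift: "lifting B Q p l"
    and i_hom: "i \<in> malg_hom V I (ideal_alg B Q p)"
    and i_bij: "bij_betw i (carrier I) (carrier (ideal_alg B Q p))"

lemma algebra_extensionI:
  assumes "variety V" "multilinear_algebra V I" "extension V B Q p" "lifting B Q p l"
    "i \<in> malg_hom V I (ideal_alg B Q p)" "bij_betw i (carrier I) (carrier (ideal_alg B Q p))"
  shows "algebra_extension V I B Q p i l"
proof -
  have "multilinear_algebra V B" "multilinear_algebra V Q"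
    using assms(3) by (auto simp: extension_def in_variety_def multilinear_algebra_iff)
  then show ?thesis
    using assms by (simp add: algebra_extension_def algebra_extension_axioms_def)
qed

context algebra_extension
begin

abbreviation "coc \<equiv> cocycle_of V Q I B i l"

lemma p_hom: "p \<in> malg_hom V B Q"
  using ext by (simp add: extension_def)

lemma l_closed [simp]: "x \<in> carrier Q \<Longrightarrow> l x \<in> carrier B"
  and p_l [simp]: "x \<in> carrier Q \<Longrightarrow> p (l x) = x"
  and l_zero [simp]: "l \<zero>\<^bsub>Q\<^esub> = \<zero>\<^bsub>B\<^esub>"
  using lift by (auto simp: lifting_def)

lemma i_closed [simp]: "a \<in> carrier I \<Longrightarrow> i a \<in> carrier B"
  and p_i [simp]: "a \<in> carrier I \<Longrightarrow> p (i a) = \<zero>\<^bsub>Q\<^esub>"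
  using malg_homD(1)[OF i_hom, of a] by (auto simp: ideal_alg_def a_kernel_def')

lemma i_inj: "inj_on i (carrier I)"
  using i_bij by (simp add: bij_betw_def)

lemma i_eq_iff: "a \<in> carrier I \<Longrightarrow> b \<in> carrier I \<Longrightarrow> i a = i b \<longleftrightarrow> a = b"
  using i_inj by (auto simp: inj_on_def)

lemma inv_i:
  assumes "b \<in> carrier B" "p b = \<zero>\<^bsub>Q\<^esub>"
  shows "inv_into (carrier I) i b \<in> carrier I" "i (inv_into (carrier I) i b) = b"
proof -
  have "b \<in> i ` carrier I"
    using assms i_bij by (simp add: bij_betw_def ideal_alg_def a_kernel_def')
  then show "inv_into (carrier I) i b \<in> carrier I" "i (inv_into (carrier I) i b) = b"
    by (simp_all add: inv_into_into f_inv_into_f)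
qed

lemma i_hom_B: "i \<in> malg_hom V I B"
  using malg_homD[OF i_hom] by (intro malg_homI) (auto simp: ideal_alg_def)

sublocale p: abelian_group_hom B Q p
  by (rule malg_hom_abelian_group_hom[OF B.multilinear_algebra_axioms Q.multilinear_algebra_axioms p_hom])

sublocale i: abelian_group_hom I B i
  by (rule malg_hom_abelian_group_hom[OF I.multilinear_algebra_axioms B.multilinear_algebra_axioms i_hom_B])

lemma p_closed [simp]: "b \<in> carrier B \<Longrightarrow> p b \<in> carrier Q"
  by simp

lemma decompose:
  assumes "b \<in> carrier B"
  obtains a where "a \<in> carrier I" "b = i a \<oplus>\<^bsub>B\<^esub> l (p b)"
proof -
  let ?c = "b \<ominus>\<^bsub>B\<^esub> l (p b)"
  have c: "?c \<in> carrier B" "p ?c = \<zero>\<^bsub>Q\<^esub>"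
    using assms by (auto simp: a_minus_def Q.r_neg)
  have "b = ?c \<oplus>\<^bsub>B\<^esub> l (p b)"
    using assms by (simp add: B.minus_add_cancel)
  then show ?thesis
    using that inv_i[OF c] by metis
qed

lemma i_smult: "r \<in> carrier (scalars V) \<Longrightarrow> a \<in> carrier I \<Longrightarrow> i (r \<odot>\<^bsub>I\<^esub> a) = r \<odot>\<^bsub>B\<^esub> i a"
  by (rule malg_homD(3)[OF i_hom_B])

lemma i_oper:
  "f \<in> ops V \<Longrightarrow> a \<in> tuples (ar V f) (carrier I) \<Longrightarrow>
    i (oper I f a) = oper B f (compose {1..ar V f} i a)"
  by (rule malg_homD(4)[OF i_hom_B])

text \<open>Cocycle components are always handled through their images under \<open>i\<close>, where
  \<open>inv_into\<close> disappears. The image lies in the kernel because \<open>p\<close> is a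
  homomorphism with \<open>p (l x) = x\<close>.\<close>

lemma coc_add:
  assumes "x \<in> carrier Q" "y \<in> carrier Q"
  shows "coc_add coc x y \<in> carrier I"
    "i (coc_add coc x y) = l x \<oplus>\<^bsub>B\<^esub> l y \<ominus>\<^bsub>B\<^esub> l (x \<oplus>\<^bsub>Q\<^esub> y)"
  using inv_i[of "l x \<oplus>\<^bsub>B\<^esub> l y \<ominus>\<^bsub>B\<^esub> l (x \<oplus>\<^bsub>Q\<^esub> y)"] assms
  by (simp_all add: cocycle_of_def Let_def Q.minus_eq_iff)

lemma coc_smult:
  assumes "r \<in> carrier (scalars V)" "x \<in> carrier Q"
  shows "coc_smult coc r x \<in> carrier I"
    "i (coc_smult coc r x) = r \<odot>\<^bsub>B\<^esub> l x \<ominus>\<^bsub>B\<^esub> l (r \<odot>\<^bsub>Q\<^esub> x)"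
  using inv_i[of "r \<odot>\<^bsub>B\<^esub> l x \<ominus>\<^bsub>B\<^esub> l (r \<odot>\<^bsub>Q\<^esub> x)"] assms malg_homD(3)[OF p_hom assms(1), of "l x"]
  by (simp_all add: cocycle_of_def Let_def Q.minus_eq_iff)

lemma compose_l:
  "x \<in> tuples n (carrier Q) \<Longrightarrow> compose {1..n} l x \<in> tuples n (carrier B)"
  by (rule compose_tuples) auto

lemma coc_op:
  assumes f: "f \<in> ops V" and x: "x \<in> tuples (ar V f) (carrier Q)"
  shows "coc_op coc f x \<in> carrier I"
    "i (coc_op coc f x) = oper B f (compose {1..ar V f} l x) \<ominus>\<^bsub>B\<^esub> l (oper Q f x)"
proof -
  have "compose {1..ar V f} p (compose {1..ar V f} l x) = x"
    using p_l x by (rule compose_tuples_id)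
  then have "p (oper B f (compose {1..ar V f} l x)) = oper Q f x"
    using malg_homD(4)[OF p_hom f compose_l[OF x]] by simp
  then show "coc_op coc f x \<in> carrier I"
    "i (coc_op coc f x) = oper B f (compose {1..ar V f} l x) \<ominus>\<^bsub>B\<^esub> l (oper Q f x)"
    using inv_i[of "oper B f (compose {1..ar V f} l x) \<ominus>\<^bsub>B\<^esub> l (oper Q f x)"] f x compose_l[OF x]
    by (simp_all add: cocycle_of_def Let_def Q.minus_eq_iff)
qed

lemma override_l:
  assumes "x \<in> tuples n (carrier Q)" "a \<in> tuples n (carrier I)" "s \<subseteq> {1..n}"
  shows "override_on (compose {1..n} l x) (\<lambda>k. i (a k)) s \<in> tuples n (carrier B)"
  using assms(2,3) by (intro override_on_tuples compose_l[OF assms(1)] assms(3)) (auto simp: PiE_iff)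

lemma coc_act:
  assumes f: "f \<in> ops V" and s: "s \<in> proper_subsets (ar V f)"
    and x: "x \<in> tuples (ar V f) (carrier Q)" and a: "a \<in> tuples (ar V f) (carrier I)"
  shows "coc_act coc f s x a \<in> carrier I"
    "i (coc_act coc f s x a)
      = oper B f (override_on (compose {1..ar V f} l x) (\<lambda>k. i (a k)) s)"
proof -
  let ?z = "override_on (compose {1..ar V f} l x) (\<lambda>k. i (a k)) s"
  have z: "?z \<in> tuples (ar V f) (carrier B)"
    using s by (intro override_l x a) (auto simp: proper_subsets_def)
  \<comment> \<open>\<open>s\<close> is nonempty, so some argument comes from I and is sent to zero
    by \<open>p\<close>; hence the value lies in the kernel.\<close>
  obtain k where k: "k \<in> s" "k \<in> {1..ar V f}"
    using s by (fastforce simp: proper_subsets_def)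
  have "(compose {1..ar V f} p ?z)(k := \<zero>\<^bsub>Q\<^esub>) = compose {1..ar V f} p ?z"
    using k a by (auto simp: compose_def override_on_def PiE_iff fun_eq_iff)
  moreover have "compose {1..ar V f} p ?z \<in> tuples (ar V f) (carrier Q)"
    using z by (rule compose_tuples[rotated]) auto
  ultimately have "p (oper B f ?z) = \<zero>\<^bsub>Q\<^esub>"
    using malg_homD(4)[OF p_hom f z] Q.oper_zero[OF f _ k(2)] by metis
  moreover have "(\<lambda>k\<in>{1..ar V f}. if k \<in> s then i (a k) else l (x k)) = ?z"
    using s by (auto simp: override_on_def compose_def proper_subsets_def fun_eq_iff)
  ultimately show "coc_act coc f s x a \<in> carrier I" "i (coc_act coc f s x a) = oper B f ?z"
    using inv_i[of "oper B f ?z"] f s x a z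
    by (simp_all add: cocycle_of_def Let_def)
qed

end

section \<open>Equivalence of cocycles\<close>

text \<open>Sign and direction follow the convention for \<open>h\<close> as a witness from the
  cocycle of \<open>B\<close> to that of \<open>B'\<close>: the map goes from \<open>B'\<close> to
  \<open>B\<close> and subtracts \<open>h\<close>. It is fixed by its values on decomposed elements;
  whether it respects the operations is the question to be decided.\<close>

locale extension_map =
  E: algebra_extension V I B Q p i l + E': algebra_extension V I B' Q p' i' l'
  for V :: "('r, 'f) variety_data" and I :: "('r, 'f, 'a) malg"
    and B :: "('r, 'f, 'b) malg" and B' :: "('r, 'f, 'c) malg" and Q :: "('r, 'f, 'q) malg"
    and p i l p' i' l' +
  fixes h :: "'q \<Rightarrow> 'a" and \<phi> :: "'c \<Rightarrow> 'b"
  assumes h: "h \<in> carrier Q \<rightarrow>\<^sub>E carrier I" and h_zero: "h \<zero>\<^bsub>Q\<^esub> = \<zero>\<^bsub>I\<^esub>"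
    and map_eq: "\<And>a x. a \<in> carrier I \<Longrightarrow> x \<in> carrier Q \<Longrightarrow>
      \<phi> (i' a \<oplus>\<^bsub>B'\<^esub> l' x) = i a \<oplus>\<^bsub>B\<^esub> (l x \<ominus>\<^bsub>B\<^esub> i (h x))"
begin

lemma h_closed [simp]: "x \<in> carrier Q \<Longrightarrow> h x \<in> carrier I"
  using h by auto

lemma map_l: "x \<in> carrier Q \<Longrightarrow> \<phi> (l' x) = l x \<ominus>\<^bsub>B\<^esub> i (h x)"
  using map_eq[of "\<zero>\<^bsub>I\<^esub>" x] by simp

lemma map_i: "a \<in> carrier I \<Longrightarrow> \<phi> (i' a) = i a"
  using map_eq[of a "\<zero>\<^bsub>Q\<^esub>"] h_zero by (simp add: E.B.minus_eq_iff a_minus_def)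

text \<open>Holds before \<open>\<phi>\<close> is known to be additive, since it only moves summands
  from I; it reduces additivity of \<open>\<phi>\<close> to sums of lifted elements.\<close>

lemma map_translate:
  assumes "a \<in> carrier I" "b \<in> carrier B'"
  shows "\<phi> (i' a \<oplus>\<^bsub>B'\<^esub> b) = i a \<oplus>\<^bsub>B\<^esub> \<phi> b"
proof -
  obtain c where c: "c \<in> carrier I" "b = i' c \<oplus>\<^bsub>B'\<^esub> l' (p' b)"
    using assms(2) by (rule E'.decompose)
  have x: "p' b \<in> carrier Q"
    using assms(2) by simp
  have "i' a \<oplus>\<^bsub>B'\<^esub> (i' c \<oplus>\<^bsub>B'\<^esub> l' (p' b)) = i' (a \<oplus>\<^bsub>I\<^esub> c) \<oplus>\<^bsub>B'\<^esub> l' (p' b)"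
    using assms c(1) by (simp add: E'.B.a_assoc)
  then have "\<phi> (i' a \<oplus>\<^bsub>B'\<^esub> (i' c \<oplus>\<^bsub>B'\<^esub> l' (p' b)))
      = i (a \<oplus>\<^bsub>I\<^esub> c) \<oplus>\<^bsub>B\<^esub> (l (p' b) \<ominus>\<^bsub>B\<^esub> i (h (p' b)))"
    using map_eq[of "a \<oplus>\<^bsub>I\<^esub> c" "p' b"] assms(1) c(1) x by simp
  then have "\<phi> (i' a \<oplus>\<^bsub>B'\<^esub> (i' c \<oplus>\<^bsub>B'\<^esub> l' (p' b))) = i a \<oplus>\<^bsub>B\<^esub> \<phi> (i' c \<oplus>\<^bsub>B'\<^esub> l' (p' b))"
    using assms(1) c(1) x by (simp add: map_eq E.B.a_assoc)
  then show ?thesis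
    using c(2) by simp
qed

lemma map_closed [simp]: "b \<in> carrier B' \<Longrightarrow> \<phi> b \<in> carrier B"
proof -
  assume b: "b \<in> carrier B'"
  then obtain a where a: "a \<in> carrier I" "b = i' a \<oplus>\<^bsub>B'\<^esub> l' (p' b)"
    by (rule E'.decompose)
  have "\<phi> (i' a \<oplus>\<^bsub>B'\<^esub> l' (p' b)) \<in> carrier B"
    using a(1) b by (simp add: map_eq)
  then show ?thesis
    using a(2) by simp
qed

text \<open>Common core of the conditions on \<open>coc_add\<close>, \<open>coc_smult\<close> and
  \<open>coc_op\<close>. An operation applied to lifted elements gives \<open>b\<close> in
  \<open>B'\<close> and \<open>c\<close> in \<open>B\<close>, both over \<open>x\<close>; the
  cocycle values \<open>t'\<close> and \<open>t\<close> are their distances from the lifts of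
  \<open>x\<close>, and \<open>d\<close> is the correction by \<open>h\<close>. In each application
  \<open>c\<close> minus \<open>i d\<close> is the operation applied to images under
  \<open>\<phi>\<close>, so the equivalence says that \<open>\<phi>\<close> respects this
  instance.\<close>

lemma defect_iff:
  assumes "b \<in> carrier B'" "x \<in> carrier Q" "t \<in> carrier I" "t' \<in> carrier I" "c \<in> carrier B"
    "d \<in> carrier I"
    and t': "i' t' = b \<ominus>\<^bsub>B'\<^esub> l' x"
    and t: "i t = c \<ominus>\<^bsub>B\<^esub> l x"
  shows "t \<ominus>\<^bsub>I\<^esub> t' = d \<ominus>\<^bsub>I\<^esub> h x \<longleftrightarrow> \<phi> b = c \<ominus>\<^bsub>B\<^esub> i d"
proof -
  have "b = i' t' \<oplus>\<^bsub>B'\<^esub> l' x"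
    using assms(1,2) by (simp add: t' E'.B.minus_add_cancel)
  then have "\<phi> b = i t' \<oplus>\<^bsub>B\<^esub> (l x \<ominus>\<^bsub>B\<^esub> i (h x))"
    using map_eq[OF assms(4,2)] by metis
  moreover have "t \<ominus>\<^bsub>I\<^esub> t' = d \<ominus>\<^bsub>I\<^esub> h x \<longleftrightarrow> i t \<ominus>\<^bsub>B\<^esub> i t' = i d \<ominus>\<^bsub>B\<^esub> i (h x)"
    using assms E.i_eq_iff[of "t \<ominus>\<^bsub>I\<^esub> t'" "d \<ominus>\<^bsub>I\<^esub> h x"] by simp
  moreover have "c \<ominus>\<^bsub>B\<^esub> l x \<ominus>\<^bsub>B\<^esub> i t' = i d \<ominus>\<^bsub>B\<^esub> i (h x)
      \<longleftrightarrow> i t' \<oplus>\<^bsub>B\<^esub> (l x \<ominus>\<^bsub>B\<^esub> i (h x)) = c \<ominus>\<^bsub>B\<^esub> i d"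
    using assms(2,4-6) by (auto simp: E.B.group_simps)
  ultimately show ?thesis
    unfolding t by simp
qed

lemma add_iff:
  assumes "x \<in> carrier Q" "y \<in> carrier Q"
  shows "coc_add E.coc x y \<ominus>\<^bsub>I\<^esub> coc_add E'.coc x y = h x \<oplus>\<^bsub>I\<^esub> h y \<ominus>\<^bsub>I\<^esub> h (x \<oplus>\<^bsub>Q\<^esub> y)
    \<longleftrightarrow> \<phi> (l' x \<oplus>\<^bsub>B'\<^esub> l' y) = \<phi> (l' x) \<oplus>\<^bsub>B\<^esub> \<phi> (l' y)"
proof -
  have "(l x \<oplus>\<^bsub>B\<^esub> l y) \<ominus>\<^bsub>B\<^esub> i (h x \<oplus>\<^bsub>I\<^esub> h y) = \<phi> (l' x) \<oplus>\<^bsub>B\<^esub> \<phi> (l' y)"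
    using assms by (simp add: map_l E.B.group_simps)
  then show ?thesis
    using defect_iff[OF _ _ E.coc_add(1)[OF assms] E'.coc_add(1)[OF assms] _ _
        E'.coc_add(2)[OF assms] E.coc_add(2)[OF assms], of "h x \<oplus>\<^bsub>I\<^esub> h y"] assms
    by simp
qed

lemma smult_iff:
  assumes "r \<in> carrier (scalars V)" "x \<in> carrier Q"
  shows "coc_smult E.coc r x \<ominus>\<^bsub>I\<^esub> coc_smult E'.coc r x = r \<odot>\<^bsub>I\<^esub> h x \<ominus>\<^bsub>I\<^esub> h (r \<odot>\<^bsub>Q\<^esub> x)
    \<longleftrightarrow> \<phi> (r \<odot>\<^bsub>B'\<^esub> l' x) = r \<odot>\<^bsub>B\<^esub> \<phi> (l' x)"
proof -
  have "(r \<odot>\<^bsub>B\<^esub> l x) \<ominus>\<^bsub>B\<^esub> i (r \<odot>\<^bsub>I\<^esub> h x) = r \<odot>\<^bsub>B\<^esub> \<phi> (l' x)"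
    using assms by (simp add: map_l E.B.smult_minus E.i_smult)
  then show ?thesis
    using defect_iff[OF _ _ E.coc_smult(1)[OF assms] E'.coc_smult(1)[OF assms] _ _
        E'.coc_smult(2)[OF assms] E.coc_smult(2)[OF assms], of "r \<odot>\<^bsub>I\<^esub> h x"] assms
    by simp
qed

text \<open>The signed sums in the last two conditions of \<open>witnesses\<close>; the first is the case \<open>s = {}\<close>, where a plays no role.\<close>

definition correction where
  "correction f s x a =
    (let n = ar V f; hxa = override_on (compose {1..n} h x) a s in
      (\<Oplus>\<^bsub>I\<^esub>r\<in>{r. s \<subset> r \<and> r \<subset> {1..n}}.
         [((- 1 :: int) ^ (1 + card r - card s))] \<cdot>\<^bsub>I\<^esub> coc_act E.coc f r x hxa)
      \<oplus>\<^bsub>I\<^esub> [((- 1 :: int) ^ (1 + n - card s))] \<cdot>\<^bsub>I\<^esub> oper I f hxa)"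

text \<open>Expand the operation on the right by \<open>oper_override_minus_split\<close>: outside
  \<open>s\<close> its arguments are \<open>l x\<close> minus \<open>i (h x)\<close>, by
  \<open>map_l\<close>. A term that takes the entries at \<open>r - s\<close> from \<open>h\<close>
  is the image under \<open>i\<close> of an action term, or of the operation of I when
  \<open>r\<close> is the full index set.\<close>

lemma correction:
  assumes f: "f \<in> ops V" and s: "s \<subset> {1..ar V f}"
    and x: "x \<in> tuples (ar V f) (carrier Q)" and a: "a \<in> tuples (ar V f) (carrier I)"
  shows "correction f s x a \<in> carrier I"
    "oper B f (override_on (compose {1..ar V f} l x) (\<lambda>k. i (a k)) s) \<ominus>\<^bsub>B\<^esub> i (correction f s x a)
      = oper B f (override_on (compose {1..ar V f} (\<lambda>x. \<phi> (l' x)) x) (\<lambda>k. i (a k)) s)"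
proof -
  let ?n = "ar V f"
  let ?hx = "override_on (compose {1..?n} h x) a s" and ?R = "{r. s \<subset> r \<and> r \<subset> {1..?n}}"
  let ?w = "override_on (compose {1..?n} l x) (\<lambda>k. i (a k)) s"
  let ?u = "\<lambda>k. i (h (x k))"
  have hx: "?hx \<in> tuples ?n (carrier I)"
    using s x a h by (intro override_on_tuples compose_tuples[of h "carrier Q"]) (auto simp: PiE_iff)
  have w: "?w \<in> tuples ?n (carrier B)"
    using s by (intro E.override_l x a) auto
  have R: "r \<in> proper_subsets ?n" if "r \<in> ?R" for r
    using that by (auto simp: proper_subsets_def)
  have act: "coc_act E.coc f r x ?hx \<in> carrier I"
    "i (coc_act E.coc f r x ?hx) = oper B f (override_on ?w ?u (r - s))" if "r \<in> ?R" for r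
  proof -
    show "coc_act E.coc f r x ?hx \<in> carrier I"
      by (rule E.coc_act(1)[OF f R[OF that] x hx])
    \<comment> \<open>The entries of \<open>?hx\<close> are \<open>a\<close> on \<open>s\<close> and
      \<open>h x\<close> elsewhere, and \<open>?w\<close> already carries \<open>a\<close> on
      \<open>s\<close>; so only the positions \<open>r - s\<close> differ.\<close>
    have "override_on (compose {1..?n} l x) (\<lambda>k. i (?hx k)) r = override_on ?w ?u (r - s)"
      using that by (auto simp: override_on_def compose_def fun_eq_iff)
    then show "i (coc_act E.coc f r x ?hx) = oper B f (override_on ?w ?u (r - s))"
      using E.coc_act(2)[OF f R[OF that] x hx] by simp
  qed
  have "compose {1..?n} i ?hx = override_on ?w ?u ({1..?n} - s)"
    using s by (auto simp: override_on_def compose_def fun_eq_iff)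
  then have full: "i (oper I f ?hx) = oper B f (override_on ?w ?u ({1..?n} - s))"
    using E.i_oper[OF f hx] by simp
  show corr: "correction f s x a \<in> carrier I"
    unfolding correction_def Let_def
    using f hx act(1) by (intro E.I.a_closed E.I.finsum_closed Pi_I E.I.add_pow_int_closed) auto
  have "i (correction f s x a) =
      (\<Oplus>\<^bsub>B\<^esub>r\<in>?R. i ([((- 1 :: int) ^ (1 + card r - card s))] \<cdot>\<^bsub>I\<^esub> coc_act E.coc f r x ?hx))
      \<oplus>\<^bsub>B\<^esub> [((- 1 :: int) ^ (1 + ?n - card s))] \<cdot>\<^bsub>B\<^esub> i (oper I f ?hx)"
    unfolding correction_def Let_def using f hx act(1)
    by (simp add: E.i.hom_finsum_group E.i.hom_add_pow_int E.I.finsum_closed Pi_iff)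
  also have "(\<Oplus>\<^bsub>B\<^esub>r\<in>?R. i ([((- 1 :: int) ^ (1 + card r - card s))] \<cdot>\<^bsub>I\<^esub> coc_act E.coc f r x ?hx))
    = (\<Oplus>\<^bsub>B\<^esub>r\<in>?R. [((- 1 :: int) ^ (1 + card r - card s))] \<cdot>\<^bsub>B\<^esub> oper B f (override_on ?w ?u (r - s)))"
    using act by (intro E.B.finsum_cong') (auto simp: E.i.hom_add_pow_int simp flip: act(2))
  finally have "oper B f ?w \<ominus>\<^bsub>B\<^esub> i (correction f s x a)
      = oper B f (override_on ?w (\<lambda>k. ?w k \<ominus>\<^bsub>B\<^esub> ?u k) ({1..?n} - s))"
    unfolding full using E.B.oper_override_minus_split[OF f s w, of ?u] x by (auto simp: PiE_iff)
  also have "override_on ?w (\<lambda>k. ?w k \<ominus>\<^bsub>B\<^esub> ?u k) ({1..?n} - s)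
      = override_on (compose {1..?n} (\<lambda>x. \<phi> (l' x)) x) (\<lambda>k. i (a k)) s"
    using s x by (auto simp: override_on_def compose_def fun_eq_iff map_l PiE_iff)
  finally show "oper B f ?w \<ominus>\<^bsub>B\<^esub> i (correction f s x a)
      = oper B f (override_on (compose {1..?n} (\<lambda>x. \<phi> (l' x)) x) (\<lambda>k. i (a k)) s)" .
qed

lemma op_iff:
  assumes f: "f \<in> ops V" and x: "x \<in> tuples (ar V f) (carrier Q)"
    and a: "a \<in> tuples (ar V f) (carrier I)"
  shows "coc_op E.coc f x \<ominus>\<^bsub>I\<^esub> coc_op E'.coc f x = correction f {} x a \<ominus>\<^bsub>I\<^esub> h (oper Q f x)
    \<longleftrightarrow> \<phi> (oper B' f (compose {1..ar V f} l' x))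
      = oper B f (compose {1..ar V f} (\<lambda>x. \<phi> (l' x)) x)"
proof -
  \<comment> \<open>Arity at least 1 makes the empty set a proper subset of the index set, so
    \<open>correction\<close> applies to it.\<close>
  have s: "{} \<subset> {1..ar V f}"
    using varietyD(1)[OF E.V f] by auto
  have c: "correction f {} x a \<in> carrier I"
    "oper B f (compose {1..ar V f} l x) \<ominus>\<^bsub>B\<^esub> i (correction f {} x a)
      = oper B f (compose {1..ar V f} (\<lambda>x. \<phi> (l' x)) x)"
    using correction[OF f s x a] by simp_all
  show ?thesis
    using defect_iff[OF _ _ E.coc_op(1)[OF f x] E'.coc_op(1)[OF f x] _ _
        E'.coc_op(2)[OF f x] E.coc_op(2)[OF f x], of "correction f {} x a"]
      f x c E.compose_l[OF x] E'.compose_l[OF x] by simp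
qed

text \<open>Both values lie in the kernels and no lift of a result occurs, so \<open>map_i\<close>
  takes the place of \<open>defect_iff\<close>.\<close>

lemma act_iff:
  assumes f: "f \<in> ops V" and s: "s \<in> proper_subsets (ar V f)"
    and x: "x \<in> tuples (ar V f) (carrier Q)" and a: "a \<in> tuples (ar V f) (carrier I)"
  shows "coc_act E.coc f s x a \<ominus>\<^bsub>I\<^esub> coc_act E'.coc f s x a = correction f s x a
    \<longleftrightarrow> \<phi> (oper B' f (override_on (compose {1..ar V f} l' x) (\<lambda>k. i' (a k)) s))
      = oper B f (override_on (compose {1..ar V f} (\<lambda>x. \<phi> (l' x)) x) (\<lambda>k. i (a k)) s)"
proof -
  have s': "s \<subset> {1..ar V f}"
    using s by (auto simp: proper_subsets_def)
  note act = E.coc_act[OF f s x a] and act' = E'.coc_act[OF f s x a] and c = correction[OF f s' x a]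
  have "coc_act E.coc f s x a \<ominus>\<^bsub>I\<^esub> coc_act E'.coc f s x a = correction f s x a
    \<longleftrightarrow> i (coc_act E.coc f s x a) \<ominus>\<^bsub>B\<^esub> i (coc_act E'.coc f s x a) = i (correction f s x a)"
    using E.i_eq_iff[of "coc_act E.coc f s x a \<ominus>\<^bsub>I\<^esub> coc_act E'.coc f s x a" "correction f s x a"] act(1) act'(1) c(1)
    by simp
  also have "\<dots> \<longleftrightarrow> i (coc_act E'.coc f s x a)
      = i (coc_act E.coc f s x a) \<ominus>\<^bsub>B\<^esub> i (correction f s x a)"
    using act(1) act'(1) c(1) by (auto simp: E.B.group_simps)
  finally show ?thesis
    unfolding act(2) c(2) act'(2)[symmetric] using map_i[OF act'(1)] by simp
qed

text \<open>The two conditions on operations merge into one clause: \<open>s = {}\<close> is the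
  condition on \<open>coc_op\<close>, the nonempty \<open>s\<close> form the condition on
  \<open>coc_act\<close>.\<close>

lemma witnesses_iff:
  "witnesses V Q I h E.coc E'.coc \<longleftrightarrow>
    (\<forall>x\<in>carrier Q. \<forall>y\<in>carrier Q. \<phi> (l' x \<oplus>\<^bsub>B'\<^esub> l' y) = \<phi> (l' x) \<oplus>\<^bsub>B\<^esub> \<phi> (l' y)) \<and>
    (\<forall>r\<in>carrier (scalars V). \<forall>x\<in>carrier Q. \<phi> (r \<odot>\<^bsub>B'\<^esub> l' x) = r \<odot>\<^bsub>B\<^esub> \<phi> (l' x)) \<and>
    (\<forall>f\<in>ops V. \<forall>s. s \<subset> {1..ar V f} \<longrightarrow>
      (\<forall>x\<in>tuples (ar V f) (carrier Q). \<forall>a\<in>tuples (ar V f) (carrier I).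
        \<phi> (oper B' f (override_on (compose {1..ar V f} l' x) (\<lambda>k. i' (a k)) s))
        = oper B f (override_on (compose {1..ar V f} (\<lambda>x. \<phi> (l' x)) x) (\<lambda>k. i (a k)) s)))"
    (is "_ \<longleftrightarrow> ?A \<and> ?S \<and> (\<forall>f\<in>ops V. \<forall>s. _ \<longrightarrow> (\<forall>x\<in>_. \<forall>a\<in>_. ?W f s x a))")
proof -
  \<comment> \<open>The condition on \<open>coc_op\<close> has no variable \<open>a\<close>, but the
    merged clause quantifies over it; some tuple over I is needed to drop that quantifier.\<close>
  have ne: "tuples n (carrier I) \<noteq> {}" for n
    using E.I.zero_closed by (auto simp: PiE_eq_empty_iff)
  have R: "{r. {} \<subset> r \<and> r \<subset> {1..n}} = proper_subsets n" for n :: nat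
    by (auto simp: proper_subsets_def)
  have op: "coc_op E.coc f x \<ominus>\<^bsub>I\<^esub> coc_op E'.coc f x =
      (\<Oplus>\<^bsub>I\<^esub>s\<in>proper_subsets (ar V f).
        [((- 1 :: int) ^ (1 + card s))] \<cdot>\<^bsub>I\<^esub> coc_act E.coc f s x (compose {1..ar V f} h x))
      \<oplus>\<^bsub>I\<^esub> [((- 1 :: int) ^ (1 + ar V f))] \<cdot>\<^bsub>I\<^esub> oper I f (compose {1..ar V f} h x)
      \<ominus>\<^bsub>I\<^esub> h (oper Q f x)
    \<longleftrightarrow> (\<forall>a\<in>tuples (ar V f) (carrier I). ?W f {} x a)"
    if "f \<in> ops V" "x \<in> tuples (ar V f) (carrier Q)" for f x
  proof -
    obtain a where "a \<in> tuples (ar V f) (carrier I)"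
      using ne by blast
    then show ?thesis
      using op_iff[OF that] by (auto simp: correction_def Let_def R)
  qed
  have act: "(let hxa = override_on (compose {1..ar V f} h x) a s in
        coc_act E.coc f s x a \<ominus>\<^bsub>I\<^esub> coc_act E'.coc f s x a =
          (\<Oplus>\<^bsub>I\<^esub>r\<in>{r. s \<subset> r \<and> r \<subset> {1..ar V f}}.
             [((- 1 :: int) ^ (1 + card r - card s))] \<cdot>\<^bsub>I\<^esub> coc_act E.coc f r x hxa)
            \<oplus>\<^bsub>I\<^esub> [((- 1 :: int) ^ (1 + ar V f - card s))] \<cdot>\<^bsub>I\<^esub> oper I f hxa) \<longleftrightarrow> ?W f s x a"
    if "f \<in> ops V" "s \<in> proper_subsets (ar V f)" "x \<in> tuples (ar V f) (carrier Q)"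
      "a \<in> tuples (ar V f) (carrier I)" for f s x a
    using act_iff[OF that] by (simp only: correction_def Let_def)
  have split: "(\<forall>s. s \<subset> {1..ar V f} \<longrightarrow> P s) \<longleftrightarrow> P {} \<and> (\<forall>s\<in>proper_subsets (ar V f). P s)"
    if "f \<in> ops V" for f and P :: "nat set \<Rightarrow> bool"
  proof -
    have "{} \<subset> {1..ar V f}"
      using varietyD(1)[OF E.V that] by auto
    then show ?thesis
      unfolding proper_subsets_def by blast
  qed
  show ?thesis
    unfolding witnesses_def
    using h h_zero
    by (simp add: add_iff smult_iff op act split Let_def[of "ar V _"] Let_def[of "compose _ h _"]
        ball_conj_distrib cong: ball_cong)
qed

text \<open>The clauses of \<open>witnesses_iff\<close> are special cases of the homomorphism laws.
  Conversely, every argument is a sum of an element of I and a lift, so by multilinearity an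
  operation on \<open>B'\<close> is a sum of mixed terms, which are matched one by one with the
  terms of the same expansion in \<open>B\<close>.\<close>

theorem witnesses_iff_hom: "witnesses V Q I h E.coc E'.coc \<longleftrightarrow> \<phi> \<in> malg_hom V B' B"
proof
  assume \<phi>: "\<phi> \<in> malg_hom V B' B"
  show "witnesses V Q I h E.coc E'.coc"
    unfolding witnesses_iff
  proof (intro conjI ballI allI impI)
    fix f s x a
    assume f: "f \<in> ops V" and s: "s \<subset> {1..ar V f}"
      and x: "x \<in> tuples (ar V f) (carrier Q)" and a: "a \<in> tuples (ar V f) (carrier I)"
    have "override_on (compose {1..ar V f} l' x) (\<lambda>k. i' (a k)) s \<in> tuples (ar V f) (carrier B')"
      using s by (intro E'.override_l x a) auto
    moreover have "compose {1..ar V f} \<phi> (override_on (compose {1..ar V f} l' x) (\<lambda>k. i' (a k)) s)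
      = override_on (compose {1..ar V f} (\<lambda>x. \<phi> (l' x)) x) (\<lambda>k. i (a k)) s"
      using s a by (auto simp: compose_def override_on_def fun_eq_iff map_i PiE_iff)
    ultimately show "\<phi> (oper B' f (override_on (compose {1..ar V f} l' x) (\<lambda>k. i' (a k)) s))
        = oper B f (override_on (compose {1..ar V f} (\<lambda>x. \<phi> (l' x)) x) (\<lambda>k. i (a k)) s)"
      using malg_homD(4)[OF \<phi> f] by simp
  qed (use malg_homD(2,3)[OF \<phi>] in auto)
next
  assume "witnesses V Q I h E.coc E'.coc"
  then have add: "\<And>x y. x \<in> carrier Q \<Longrightarrow> y \<in> carrier Q \<Longrightarrow>
        \<phi> (l' x \<oplus>\<^bsub>B'\<^esub> l' y) = \<phi> (l' x) \<oplus>\<^bsub>B\<^esub> \<phi> (l' y)"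
    and smult: "\<And>r x. r \<in> carrier (scalars V) \<Longrightarrow> x \<in> carrier Q \<Longrightarrow>
        \<phi> (r \<odot>\<^bsub>B'\<^esub> l' x) = r \<odot>\<^bsub>B\<^esub> \<phi> (l' x)"
    and op: "\<And>f s x a. f \<in> ops V \<Longrightarrow> s \<subset> {1..ar V f} \<Longrightarrow>
        x \<in> tuples (ar V f) (carrier Q) \<Longrightarrow> a \<in> tuples (ar V f) (carrier I) \<Longrightarrow>
        \<phi> (oper B' f (override_on (compose {1..ar V f} l' x) (\<lambda>k. i' (a k)) s))
        = oper B f (override_on (compose {1..ar V f} (\<lambda>x. \<phi> (l' x)) x) (\<lambda>k. i (a k)) s)"
    unfolding witnesses_iff by blast+
  have add': "\<phi> (b \<oplus>\<^bsub>B'\<^esub> c) = \<phi> b \<oplus>\<^bsub>B\<^esub> \<phi> c" if b: "b \<in> carrier B'" and c: "c \<in> carrier B'" for b c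
  proof -
    let ?x = "p' b" and ?y = "p' c"
    obtain a where a: "a \<in> carrier I" "b = i' a \<oplus>\<^bsub>B'\<^esub> l' ?x"
      using b by (rule E'.decompose)
    obtain a' where a': "a' \<in> carrier I" "c = i' a' \<oplus>\<^bsub>B'\<^esub> l' ?y"
      using c by (rule E'.decompose)
    have xy: "?x \<in> carrier Q" "?y \<in> carrier Q"
      using b c by auto
    have "(i' a \<oplus>\<^bsub>B'\<^esub> l' ?x) \<oplus>\<^bsub>B'\<^esub> (i' a' \<oplus>\<^bsub>B'\<^esub> l' ?y)
        = i' (a \<oplus>\<^bsub>I\<^esub> a') \<oplus>\<^bsub>B'\<^esub> (l' ?x \<oplus>\<^bsub>B'\<^esub> l' ?y)"
      using a(1) a'(1) xy by (simp add: E'.B.a_ac)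
    then have "\<phi> ((i' a \<oplus>\<^bsub>B'\<^esub> l' ?x) \<oplus>\<^bsub>B'\<^esub> (i' a' \<oplus>\<^bsub>B'\<^esub> l' ?y))
        = i (a \<oplus>\<^bsub>I\<^esub> a') \<oplus>\<^bsub>B\<^esub> (\<phi> (l' ?x) \<oplus>\<^bsub>B\<^esub> \<phi> (l' ?y))"
      using a(1) a'(1) xy by (simp only: map_translate add E'.B.a_closed E.I.a_closed E'.l_closed)
    also have "\<dots> = \<phi> (i' a \<oplus>\<^bsub>B'\<^esub> l' ?x) \<oplus>\<^bsub>B\<^esub> \<phi> (i' a' \<oplus>\<^bsub>B'\<^esub> l' ?y)"
      using a(1) a'(1) xy by (simp add: map_translate E.B.a_ac)
    finally show ?thesis
      using a(2) a'(2) by simp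
  qed
  \<comment> \<open>Additivity comes first because \<open>\<phi>\<close> must be moved through the
    finite sum of the expansion.\<close>
  interpret \<phi>: abelian_group_hom B' B \<phi>
    using add' by (intro abelian_group_homI group_hom.intro group_hom_axioms.intro
        E.B.abelian_group_axioms E'.B.abelian_group_axioms E.B.a_group E'.B.a_group)
      (auto simp: hom_def)
  show "\<phi> \<in> malg_hom V B' B"
  proof (rule malg_homI)
    fix r b assume r: "r \<in> carrier (scalars V)" and b: "b \<in> carrier B'"
    obtain a where a: "a \<in> carrier I" "b = i' a \<oplus>\<^bsub>B'\<^esub> l' (p' b)"
      using b by (rule E'.decompose)
    have x: "p' b \<in> carrier Q"
      using b by simp
    have "\<phi> (r \<odot>\<^bsub>B'\<^esub> (i' a \<oplus>\<^bsub>B'\<^esub> l' (p' b))) = \<phi> (i' (r \<odot>\<^bsub>I\<^esub> a) \<oplus>\<^bsub>B'\<^esub> r \<odot>\<^bsub>B'\<^esub> l' (p' b))"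
      using r a(1) x by (simp add: E'.B.smult_r_distr E'.i_smult)
    also have "\<dots> = r \<odot>\<^bsub>B\<^esub> \<phi> (i' a \<oplus>\<^bsub>B'\<^esub> l' (p' b))"
      using r a(1) x by (simp only: map_translate smult E.i_smult E.I.smult_closed E'.B.smult_closed E'.l_closed
        E.B.smult_r_distr E.i_closed map_closed)
    finally show "\<phi> (r \<odot>\<^bsub>B'\<^esub> b) = r \<odot>\<^bsub>B\<^esub> \<phi> b"
      using a(2) by simp
  next
    fix f v assume f: "f \<in> ops V" and v: "v \<in> tuples (ar V f) (carrier B')"
    let ?n = "{1..ar V f}"
    have "\<forall>k\<in>?n. \<exists>a. a \<in> carrier I \<and> v k = i' a \<oplus>\<^bsub>B'\<^esub> l' (p' (v k))"
      using v by (auto simp: PiE_iff elim!: E'.decompose)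
    then obtain a0 where a0: "\<And>k. k \<in> ?n \<Longrightarrow> a0 k \<in> carrier I"
        "\<And>k. k \<in> ?n \<Longrightarrow> v k = i' (a0 k) \<oplus>\<^bsub>B'\<^esub> l' (p' (v k))"
      by metis
    define a where "a = restrict a0 ?n"
    define x where "x = compose ?n p' v"
    have a: "a \<in> tuples (ar V f) (carrier I)"
      using a0(1) by (auto simp: a_def)
    have x: "x \<in> tuples (ar V f) (carrier Q)"
      unfolding x_def using v by (rule compose_tuples[rotated]) auto
    let ?lx' = "compose ?n l' x" and ?ex = "compose ?n (\<lambda>x. \<phi> (l' x)) x"
    have ex: "?ex \<in> tuples (ar V f) (carrier B)"
      using x by (rule compose_tuples[rotated]) auto
    have "v = override_on ?lx' (\<lambda>k. i' (a k) \<oplus>\<^bsub>B'\<^esub> ?lx' k) ?n"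
    proof
      fix k
      show "v k = override_on ?lx' (\<lambda>k. i' (a k) \<oplus>\<^bsub>B'\<^esub> ?lx' k) ?n k"
        using a0(2)[of k] v
        by (cases "k \<in> ?n") (auto simp: a_def x_def compose_def override_on_def PiE_iff extensional_def)
    qed
    then have "oper B' f v = (\<Oplus>\<^bsub>B'\<^esub>s\<in>Pow ?n. oper B' f (override_on ?lx' (\<lambda>k. i' (a k)) s))"
      using E'.B.oper_override_add[OF f _ E'.compose_l[OF x], of ?n "\<lambda>k. i' (a k)"] a
      by (simp add: PiE_iff)
    then have "\<phi> (oper B' f v) = (\<Oplus>\<^bsub>B\<^esub>s\<in>Pow ?n. \<phi> (oper B' f (override_on ?lx' (\<lambda>k. i' (a k)) s)))"
      using f x a by (simp add: \<phi>.hom_finsum_group E'.override_l)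
    also have "\<dots> = (\<Oplus>\<^bsub>B\<^esub>s\<in>Pow ?n. oper B f (override_on ?ex (\<lambda>k. i (a k)) s))"
    proof (rule E.B.finsum_cong')
      show "(\<lambda>s. oper B f (override_on ?ex (\<lambda>k. i (a k)) s)) \<in> Pow ?n \<rightarrow> carrier B"
        by (intro Pi_I E.B.oper_closed[OF f] override_on_tuples[OF ex]) (use a in \<open>auto simp: PiE_iff\<close>)
      fix s assume "s \<in> Pow ?n"
      then consider "s \<subset> ?n" | "s = ?n"
        by auto
      then show "\<phi> (oper B' f (override_on ?lx' (\<lambda>k. i' (a k)) s))
        = oper B f (override_on ?ex (\<lambda>k. i (a k)) s)"
      proof cases
        \<comment> \<open>The full index set is not covered by \<open>op\<close>; here both sides
          come from the operation of I, which \<open>i\<close> and \<open>i'\<close>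
          preserve.\<close>
        case 2
        have "override_on ?lx' (\<lambda>k. i' (a k)) ?n = compose ?n i' a"
          "override_on ?ex (\<lambda>k. i (a k)) ?n = compose ?n i a"
          by (auto simp: override_on_def compose_def fun_eq_iff)
        then show ?thesis
          using f a by (simp add: 2 map_i flip: E'.i_oper E.i_oper)
      qed (rule op[OF f _ x a])
    qed simp
    \<comment> \<open>The same expansion, collected again in \<open>B\<close>.\<close>
    also have "\<dots> = oper B f (override_on ?ex (\<lambda>k. i (a k) \<oplus>\<^bsub>B\<^esub> ?ex k) ?n)"
      using E.B.oper_override_add[OF f _ ex, of ?n "\<lambda>k. i (a k)"] a by (simp add: PiE_iff)
    also have "override_on ?ex (\<lambda>k. i (a k) \<oplus>\<^bsub>B\<^esub> ?ex k) ?n = compose ?n \<phi> v"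
    proof
      fix k
      show "override_on ?ex (\<lambda>k. i (a k) \<oplus>\<^bsub>B\<^esub> ?ex k) ?n k = compose ?n \<phi> v k"
      proof (cases "k \<in> ?n")
        case True
        then have "p' (v k) \<in> carrier Q"
          using v by (auto simp: PiE_iff)
        then have "\<phi> (i' (a0 k) \<oplus>\<^bsub>B'\<^esub> l' (p' (v k))) = i (a0 k) \<oplus>\<^bsub>B\<^esub> \<phi> (l' (p' (v k)))"
          using a0(1)[OF True] by (intro map_translate) auto
        then show ?thesis
          using True a0(2)[OF True] by (simp add: a_def x_def compose_def)
      qed (auto simp: compose_def)
    qed
    finally show "\<phi> (oper B' f v) = oper B f (compose ?n \<phi> v)" .
  qed (use add' in auto)
qed

end

context extension_map
begin

lemma p_map: "b \<in> carrier B' \<Longrightarrow> p (\<phi> b) = p' b"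
proof -
  assume b: "b \<in> carrier B'"
  then obtain a where a: "a \<in> carrier I" "b = i' a \<oplus>\<^bsub>B'\<^esub> l' (p' b)"
    by (rule E'.decompose)
  have "p (\<phi> (i' a \<oplus>\<^bsub>B'\<^esub> l' (p' b))) = p' b"
    using a(1) b by (simp add: map_eq a_minus_def)
  then show ?thesis
    using a(2) by simp
qed

text \<open>Follows from the shape of \<open>\<phi>\<close> alone, homomorphism or not: the image in
  Q is kept by \<open>p_map\<close>, and over a fixed \<open>x\<close> the part from I is translated
  by the negative of \<open>h x\<close>.\<close>

lemma bij_map: "bij_betw \<phi> (carrier B') (carrier B)"
  unfolding bij_betw_def
proof
  show "inj_on \<phi> (carrier B')"
  proof (rule inj_onI)
    fix b c
    assume b: "b \<in> carrier B'" and c: "c \<in> carrier B'" and eq: "\<phi> b = \<phi> c"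
    obtain a where a: "a \<in> carrier I" "b = i' a \<oplus>\<^bsub>B'\<^esub> l' (p' b)"
      using b by (rule E'.decompose)
    obtain a' where a': "a' \<in> carrier I" "c = i' a' \<oplus>\<^bsub>B'\<^esub> l' (p' c)"
      using c by (rule E'.decompose)
    have x: "p' c \<in> carrier Q" "p' b = p' c"
      using E'.p_closed[OF c] p_map[OF b] p_map[OF c] eq by simp_all
    then have "i a \<oplus>\<^bsub>B\<^esub> (l (p' c) \<ominus>\<^bsub>B\<^esub> i (h (p' c))) = i a' \<oplus>\<^bsub>B\<^esub> (l (p' c) \<ominus>\<^bsub>B\<^esub> i (h (p' c)))"
      using eq a a' map_eq by metis
    then have "a = a'"
      using a(1) a'(1) x(1) E.i_eq_iff by simp
    then show "b = c"
      using a(2) a'(2) x(2) by simp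
  qed
next
  show "\<phi> ` carrier B' = carrier B"
  proof (intro equalityI subsetI)
    fix b assume b: "b \<in> carrier B"
    then obtain a where a: "a \<in> carrier I" "b = i a \<oplus>\<^bsub>B\<^esub> l (p b)"
      by (rule E.decompose)
    have x: "p b \<in> carrier Q"
      using b by simp
    \<comment> \<open>Adding \<open>h (p b)\<close> to the part in I compensates the subtraction in
      \<open>map_eq\<close>.\<close>
    have "\<phi> (i' (a \<oplus>\<^bsub>I\<^esub> h (p b)) \<oplus>\<^bsub>B'\<^esub> l' (p b))
        = i (a \<oplus>\<^bsub>I\<^esub> h (p b)) \<oplus>\<^bsub>B\<^esub> (l (p b) \<ominus>\<^bsub>B\<^esub> i (h (p b)))"
      using a(1) x by (intro map_eq) auto
    also have "\<dots> = i a \<oplus>\<^bsub>B\<^esub> l (p b)"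
      using a(1) x by (simp add: E.B.group_simps)
    finally have "\<phi> (i' (a \<oplus>\<^bsub>I\<^esub> h (p b)) \<oplus>\<^bsub>B'\<^esub> l' (p b)) = b"
      using a(2) by simp
    then show "b \<in> \<phi> ` carrier B'"
      using a(1) x by (intro image_eqI[where x = "i' (a \<oplus>\<^bsub>I\<^esub> h (p b)) \<oplus>\<^bsub>B'\<^esub> l' (p b)"]) auto
  qed auto
qed

end

section \<open>Morphisms of extensions over the identities of I and Q\<close>

definition extension_homs where
  "extension_homs V I B' p' i' B p i =
    {\<phi> \<in> malg_hom V B' B.
      (\<forall>a\<in>carrier I. \<phi> (i' a) = i a) \<and> (\<forall>b\<in>carrier B'. p (\<phi> b) = p' b)}"

text \<open>Compatibility with the inclusions and projections is automatic for the map of the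
  locale, so membership only asks for a homomorphism.\<close>

lemma (in extension_map) extension_homs_iff:
  "\<phi> \<in> extension_homs V I B' p' i' B p i \<longleftrightarrow> witnesses V Q I h E.coc E'.coc"
  by (auto simp: extension_homs_def witnesses_iff_hom map_i p_map)

text \<open>Every morphism arises from some \<open>h\<close>: \<open>l x\<close> and
  \<open>\<phi> (l' x)\<close> have the same image \<open>x\<close> in Q, so their difference lies
  in the kernel and can be read in I.\<close>

lemma extension_map_of_hom:
  assumes E: "algebra_extension V I B Q p i l" and E': "algebra_extension V I B' Q p' i' l'"
    and \<phi>: "\<phi> \<in> extension_homs V I B' p' i' B p i"
  shows "extension_map V I B B' Q p i l p' i' l'
    (\<lambda>x\<in>carrier Q. inv_into (carrier I) i (l x \<ominus>\<^bsub>B\<^esub> \<phi> (l' x))) \<phi>"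
    (is "extension_map _ _ _ _ _ _ _ _ _ _ _ ?h _")
proof -
  interpret E: algebra_extension V I B Q p i l by fact
  interpret E': algebra_extension V I B' Q p' i' l' by fact
  have \<phi>i: "\<phi> (i' a) = i a" if "a \<in> carrier I" for a
    using \<phi> that by (auto simp: extension_homs_def)
  have \<phi>p: "p (\<phi> b) = p' b" if "b \<in> carrier B'" for b
    using \<phi> that by (auto simp: extension_homs_def)
  have hom: "\<phi> \<in> malg_hom V B' B"
    using \<phi> by (auto simp: extension_homs_def)
  have d: "l x \<ominus>\<^bsub>B\<^esub> \<phi> (l' x) \<in> carrier B" "p (l x \<ominus>\<^bsub>B\<^esub> \<phi> (l' x)) = \<zero>\<^bsub>Q\<^esub>"
    if "x \<in> carrier Q" for x
    using that malg_homD(1)[OF hom] by (auto simp: \<phi>p a_minus_def E.Q.r_neg)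
  have h: "?h x \<in> carrier I" "i (?h x) = l x \<ominus>\<^bsub>B\<^esub> \<phi> (l' x)" if "x \<in> carrier Q" for x
    using E.inv_i[OF d[OF that]] that by simp_all
  have "\<phi> \<zero>\<^bsub>B'\<^esub> = \<zero>\<^bsub>B\<^esub>"
    using \<phi>i[of "\<zero>\<^bsub>I\<^esub>"] by simp
  then have "i (?h \<zero>\<^bsub>Q\<^esub>) = i \<zero>\<^bsub>I\<^esub>"
    using h(2)[of "\<zero>\<^bsub>Q\<^esub>"] by (simp add: a_minus_def)
  then have "?h \<zero>\<^bsub>Q\<^esub> = \<zero>\<^bsub>I\<^esub>"
    using E.i_eq_iff[of "?h \<zero>\<^bsub>Q\<^esub>" "\<zero>\<^bsub>I\<^esub>"] h(1)[of "\<zero>\<^bsub>Q\<^esub>"] by simp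
  moreover have "\<phi> (i' a \<oplus>\<^bsub>B'\<^esub> l' x) = i a \<oplus>\<^bsub>B\<^esub> (l x \<ominus>\<^bsub>B\<^esub> i (?h x))"
    if "a \<in> carrier I" "x \<in> carrier Q" for a x
  proof -
    have "l x \<ominus>\<^bsub>B\<^esub> i (?h x) = \<phi> (l' x)"
      unfolding h(2)[OF that(2)] using that malg_homD(1)[OF hom] by (simp add: E.B.group_simps)
    then show ?thesis
      using malg_homD(2)[OF hom, of "i' a" "l' x"] that \<phi>i by simp
  qed
  moreover have "?h \<in> carrier Q \<rightarrow>\<^sub>E carrier I"
    using h(1) by auto
  ultimately show ?thesis
    using E E' by (simp add: extension_map_def extension_map_axioms_def)
qed

text \<open>The map reads off both coordinates of \<open>b\<close> with respect to \<open>l'\<close>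
  and reassembles them using \<open>l\<close> minus \<open>h\<close>.\<close>

lemma ex_extension_map:
  assumes E: "algebra_extension V I B Q p i l" and E': "algebra_extension V I B' Q p' i' l'"
    and h: "h \<in> carrier Q \<rightarrow>\<^sub>E carrier I" "h \<zero>\<^bsub>Q\<^esub> = \<zero>\<^bsub>I\<^esub>"
  shows "\<exists>\<phi>. extension_map V I B B' Q p i l p' i' l' h \<phi>"
proof -
  interpret E: algebra_extension V I B Q p i l by fact
  interpret E': algebra_extension V I B' Q p' i' l' by fact
  let ?\<phi> = "\<lambda>b. i (inv_into (carrier I) i' (b \<ominus>\<^bsub>B'\<^esub> l' (p' b)))
    \<oplus>\<^bsub>B\<^esub> (l (p' b) \<ominus>\<^bsub>B\<^esub> i (h (p' b)))"
  have "?\<phi> (i' a \<oplus>\<^bsub>B'\<^esub> l' x) = i a \<oplus>\<^bsub>B\<^esub> (l x \<ominus>\<^bsub>B\<^esub> i (h x))"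
    if "a \<in> carrier I" "x \<in> carrier Q" for a x
  proof -
    have "i' a \<oplus>\<^bsub>B'\<^esub> l' x \<ominus>\<^bsub>B'\<^esub> l' x = i' a"
      using that by (simp add: E'.B.group_simps)
    then show ?thesis
      using that E'.i_inj by simp
  qed
  then have "extension_map V I B B' Q p i l p' i' l' h ?\<phi>"
    using assms by (simp add: extension_map_def extension_map_axioms_def)
  then show ?thesis
    by blast
qed

text \<open>Eliminates \<open>h\<close>: from here on, equivalence of cocycles is a statement about
  morphisms, which go from the right-hand extension to the left-hand one.\<close>

lemma ex_witnesses_iff:
  assumes E: "algebra_extension V I B Q p i l" and E': "algebra_extension V I B' Q p' i' l'"
  shows "(\<exists>h. witnesses V Q I h (cocycle_of V Q I B i l) (cocycle_of V Q I B' i' l'))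
    \<longleftrightarrow> extension_homs V I B' p' i' B p i \<noteq> {}"
proof
  assume "\<exists>h. witnesses V Q I h (cocycle_of V Q I B i l) (cocycle_of V Q I B' i' l')"
  then obtain h where h: "witnesses V Q I h (cocycle_of V Q I B i l) (cocycle_of V Q I B' i' l')" ..
  then have "h \<in> carrier Q \<rightarrow>\<^sub>E carrier I" "h \<zero>\<^bsub>Q\<^esub> = \<zero>\<^bsub>I\<^esub>"
    by (auto simp: witnesses_def)
  from ex_extension_map[OF E E' this]
  obtain \<phi> where \<phi>: "extension_map V I B B' Q p i l p' i' l' h \<phi>" ..
  show "extension_homs V I B' p' i' B p i \<noteq> {}"
    using extension_map.extension_homs_iff[OF \<phi>] h by auto
next
  assume "extension_homs V I B' p' i' B p i \<noteq> {}"
  then obtain \<phi> where \<phi>: "\<phi> \<in> extension_homs V I B' p' i' B p i"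
    by auto
  show "\<exists>h. witnesses V Q I h (cocycle_of V Q I B i l) (cocycle_of V Q I B' i' l')"
    using extension_map.extension_homs_iff[OF extension_map_of_hom[OF E E' \<phi>]] \<phi> by auto
qed

lemma extension_homs_id:
  assumes "multilinear_algebra V B"
  shows "(\<lambda>b. b) \<in> extension_homs V I B p i B p i"
  using multilinear_algebra.id_malg_hom[OF assms] by (simp add: extension_homs_def)

lemma extension_homs_compose:
  assumes "\<phi> \<in> extension_homs V I B p i C q j" "\<psi> \<in> extension_homs V I C q j D r k"
  shows "(\<lambda>b. \<psi> (\<phi> b)) \<in> extension_homs V I B p i D r k"
  using assms malg_hom_compose[of \<phi> V B C \<psi> D] malg_homD(1)[of \<phi> V B C]
  by (simp add: extension_homs_def)

text \<open>The short five lemma in elementary form: a morphism has the shape of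
  \<open>extension_map\<close> for some \<open>h\<close>, hence is bijective.\<close>

lemma extension_homs_inv_into:
  assumes E: "algebra_extension V I B Q p i l" and E': "algebra_extension V I B' Q p' i' l'"
    and \<phi>: "\<phi> \<in> extension_homs V I B' p' i' B p i"
  shows "inv_into (carrier B') \<phi> \<in> extension_homs V I B p i B' p' i'"
proof -
  interpret E: algebra_extension V I B Q p i l by fact
  interpret E': algebra_extension V I B' Q p' i' l' by fact
  have bij: "bij_betw \<phi> (carrier B') (carrier B)"
    by (rule extension_map.bij_map[OF extension_map_of_hom[OF E E' \<phi>]])
  have "inv_into (carrier B') \<phi> \<in> malg_hom V B B'"
    using \<phi> bij by (intro E'.B.inv_into_malg_hom) (auto simp: extension_homs_def)
  moreover have "inv_into (carrier B') \<phi> (i a) = i' a" if "a \<in> carrier I" for a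
    using \<phi> that bij by (intro inv_into_f_eq) (auto simp: extension_homs_def bij_betw_def)
  moreover have "p' (inv_into (carrier B') \<phi> b) = p b" if "b \<in> carrier B" for b
  proof -
    have "inv_into (carrier B') \<phi> b \<in> carrier B'" "\<phi> (inv_into (carrier B') \<phi> b) = b"
      using that bij by (auto simp: bij_betw_def inv_into_into f_inv_into_f)
    then show ?thesis
      using \<phi> by (auto simp: extension_homs_def)
  qed
  ultimately show ?thesis
    by (simp add: extension_homs_def)
qed

lemma Z2_E:
  fixes Q :: "('r, 'f, 'q) malg" and I :: "('r, 'f, 'a) malg"
  assumes "T \<in> Z2 V Q I" "variety V" "multilinear_algebra V I"
  obtains B :: "('r, 'f, 'a \<times> 'q) malg" and p i l
  where "algebra_extension V I B Q p i l" "T = cocycle_of V Q I B i l"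
proof -
  obtain B :: "('r, 'f, 'a \<times> 'q) malg" and p i l
    where "extension V B Q p" "lifting B Q p l" "i \<in> malg_hom V I (ideal_alg B Q p)"
      "bij_betw i (carrier I) (carrier (ideal_alg B Q p))" "T = cocycle_of V Q I B i l"
    using assms(1) unfolding Z2_def by blast
  then show ?thesis
    using that algebra_extensionI[OF assms(2,3)] by blast
qed

text \<open>Identity, inverse and composite of morphisms give the three properties, in place of
  calculations with signed sums.\<close>

lemma equiv_coc_equiv:
  fixes Q :: "('r, 'f, 'q) malg" and I :: "('r, 'f, 'a) malg"
  assumes V: "variety V" and I: "multilinear_algebra V I"
  shows "equiv (Z2 V Q I) (coc_equiv V Q I)"
proof (rule equivI)
  show "coc_equiv V Q I \<subseteq> Z2 V Q I \<times> Z2 V Q I"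
    by (auto simp: coc_equiv_def)
  show "refl_on (Z2 V Q I) (coc_equiv V Q I)"
  proof (rule refl_onI)
    fix T assume T: "T \<in> Z2 V Q I"
    then obtain B :: "('r, 'f, 'a \<times> 'q) malg" and p i l
      where B: "algebra_extension V I B Q p i l" "T = cocycle_of V Q I B i l"
      using V I by (rule Z2_E)
    then have "(\<lambda>b. b) \<in> extension_homs V I B p i B p i"
      by (intro extension_homs_id) (simp add: algebra_extension_def)
    then show "(T, T) \<in> coc_equiv V Q I"
      using T ex_witnesses_iff[OF B(1) B(1)] B(2) by (auto simp: coc_equiv_def)
  qed
  show "sym (coc_equiv V Q I)"
  proof (rule symI)
    fix T T' assume *: "(T, T') \<in> coc_equiv V Q I"
    then have T: "T \<in> Z2 V Q I" and T': "T' \<in> Z2 V Q I"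
      by (auto simp: coc_equiv_def)
    obtain B :: "('r, 'f, 'a \<times> 'q) malg" and p i l
      where B: "algebra_extension V I B Q p i l" "T = cocycle_of V Q I B i l"
      using T V I by (rule Z2_E)
    obtain B' :: "('r, 'f, 'a \<times> 'q) malg" and p' i' l'
      where B': "algebra_extension V I B' Q p' i' l'" "T' = cocycle_of V Q I B' i' l'"
      using T' V I by (rule Z2_E)
    obtain \<phi> where "\<phi> \<in> extension_homs V I B' p' i' B p i"
      using * ex_witnesses_iff[OF B(1) B'(1)] B(2) B'(2) by (auto simp: coc_equiv_def)
    then have "inv_into (carrier B') \<phi> \<in> extension_homs V I B p i B' p' i'"
      by (rule extension_homs_inv_into[OF B(1) B'(1)])
    then show "(T', T) \<in> coc_equiv V Q I"
      using T T' ex_witnesses_iff[OF B'(1) B(1)] B(2) B'(2) by (auto simp: coc_equiv_def)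
  qed
  show "trans (coc_equiv V Q I)"
  proof (rule transI)
    fix T T' T'' assume *: "(T, T') \<in> coc_equiv V Q I" "(T', T'') \<in> coc_equiv V Q I"
    then have T: "T \<in> Z2 V Q I" and T': "T' \<in> Z2 V Q I" and T'': "T'' \<in> Z2 V Q I"
      by (auto simp: coc_equiv_def)
    obtain B :: "('r, 'f, 'a \<times> 'q) malg" and p i l
      where B: "algebra_extension V I B Q p i l" "T = cocycle_of V Q I B i l"
      using T V I by (rule Z2_E)
    obtain B' :: "('r, 'f, 'a \<times> 'q) malg" and p' i' l'
      where B': "algebra_extension V I B' Q p' i' l'" "T' = cocycle_of V Q I B' i' l'"
      using T' V I by (rule Z2_E)
    obtain C :: "('r, 'f, 'a \<times> 'q) malg" and q j m
      where C: "algebra_extension V I C Q q j m" "T'' = cocycle_of V Q I C j m"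
      using T'' V I by (rule Z2_E)
    obtain \<phi> where \<phi>: "\<phi> \<in> extension_homs V I B' p' i' B p i"
      using *(1) ex_witnesses_iff[OF B(1) B'(1)] B(2) B'(2) by (auto simp: coc_equiv_def)
    obtain \<psi> where \<psi>: "\<psi> \<in> extension_homs V I C q j B' p' i'"
      using *(2) ex_witnesses_iff[OF B'(1) C(1)] B'(2) C(2) by (auto simp: coc_equiv_def)
    show "(T, T'') \<in> coc_equiv V Q I"
      using T T'' ex_witnesses_iff[OF B(1) C(1)] B(2) C(2) extension_homs_compose[OF \<psi> \<phi>]
      by (auto simp: coc_equiv_def)
  qed
qed

section \<open>Equality of cocycles and transport to pairs\<close>

definition extensional_cocycle where
  "extensional_cocycle V Q I c \<longleftrightarrow>
    coc_add c \<in> extensional (carrier Q) \<and>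
    (\<forall>x\<in>carrier Q. coc_add c x \<in> extensional (carrier Q)) \<and>
    coc_smult c \<in> extensional (carrier (scalars V)) \<and>
    (\<forall>r\<in>carrier (scalars V). coc_smult c r \<in> extensional (carrier Q)) \<and>
    coc_op c \<in> extensional (ops V) \<and>
    (\<forall>f\<in>ops V. coc_op c f \<in> extensional (tuples (ar V f) (carrier Q))) \<and>
    coc_act c \<in> extensional (ops V) \<and>
    (\<forall>f\<in>ops V. coc_act c f \<in> extensional (proper_subsets (ar V f)) \<and>
      (\<forall>s\<in>proper_subsets (ar V f).
        coc_act c f s \<in> extensional (tuples (ar V f) (carrier Q)) \<and>
        (\<forall>x\<in>tuples (ar V f) (carrier Q).
          coc_act c f s x \<in> extensional (tuples (ar V f) (carrier I)))))"

lemma extensional_cocycle_of: "extensional_cocycle V Q I (cocycle_of V Q I B i l)"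
  by (simp add: extensional_cocycle_def cocycle_of_def Let_def)

lemma extensional_coc_twist: "extensional_cocycle V Q I (coc_twist V Q I T \<sigma>\<kappa>)"
  by (cases \<sigma>\<kappa>) (simp add: extensional_cocycle_def coc_twist_def Let_def)

lemma extensional_cocycle_eqI:
  fixes c c' :: "('r, 'f, 'a, 'q) cocycle"
  assumes "extensional_cocycle V Q I c" "extensional_cocycle V Q I c'"
    and add: "\<And>x y. x \<in> carrier Q \<Longrightarrow> y \<in> carrier Q \<Longrightarrow> coc_add c x y = coc_add c' x y"
    and smult: "\<And>r x. r \<in> carrier (scalars V) \<Longrightarrow> x \<in> carrier Q \<Longrightarrow>
      coc_smult c r x = coc_smult c' r x"
    and op: "\<And>f x. f \<in> ops V \<Longrightarrow> x \<in> tuples (ar V f) (carrier Q) \<Longrightarrow>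
      coc_op c f x = coc_op c' f x"
    and act: "\<And>f s x a. f \<in> ops V \<Longrightarrow> s \<in> proper_subsets (ar V f) \<Longrightarrow>
      x \<in> tuples (ar V f) (carrier Q) \<Longrightarrow> a \<in> tuples (ar V f) (carrier I) \<Longrightarrow>
      coc_act c f s x a = coc_act c' f s x a"
  shows "c = c'"
proof (rule cocycle.equality)
  note ex = assms(1,2)[unfolded extensional_cocycle_def]
  show "coc_add c = coc_add c'"
    using ex by (intro extensionalityI[of _ "carrier Q"] add) auto
  show "coc_smult c = coc_smult c'"
    using ex by (intro extensionalityI[of _ "carrier (scalars V)"]
        extensionalityI[of "coc_smult _ _" "carrier Q"] smult) auto
  show "coc_op c = coc_op c'"
    using ex by (intro extensionalityI[of _ "ops V"]
        extensionalityI[of "coc_op _ f" "tuples (ar V f) (carrier Q)" for f] op) auto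
  show "coc_act c = coc_act c'"
  proof (rule extensionalityI[of _ "ops V"])
    fix f assume f: "f \<in> ops V"
    show "coc_act c f = coc_act c' f"
    proof (rule extensionalityI[of _ "proper_subsets (ar V f)"])
      fix s assume s: "s \<in> proper_subsets (ar V f)"
      show "coc_act c f s = coc_act c' f s"
      proof (rule extensionalityI[of _ "tuples (ar V f) (carrier Q)"])
        fix x assume x: "x \<in> tuples (ar V f) (carrier Q)"
        show "coc_act c f s x = coc_act c' f s x"
          using ex f s x by (intro extensionalityI[of _ "tuples (ar V f) (carrier I)"] act) auto
      qed (use ex f s in auto)
    qed (use ex f in auto)
  qed (use ex in auto)
qed simp

text \<open>\<open>i'\<close> is injective, so components are compared in \<open>B'\<close>; there
  \<open>g\<close> carries the expression defining one cocycle to the expression defining the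
  other.\<close>

lemma cocycle_of_transport:
  assumes E: "algebra_extension V I B Q p i l" and E': "algebra_extension V I B' Q p' i' l'"
    and g: "g \<in> malg_hom V B B'" and gi: "\<And>a. a \<in> carrier I \<Longrightarrow> g (i a) = i' a"
    and gl: "\<And>x. x \<in> carrier Q \<Longrightarrow> g (l x) = l' x"
  shows "cocycle_of V Q I B i l = cocycle_of V Q I B' i' l'"
proof -
  interpret E: algebra_extension V I B Q p i l by fact
  interpret E': algebra_extension V I B' Q p' i' l' by fact
  interpret g: abelian_group_hom B B' g
    by (rule malg_hom_abelian_group_hom[OF E.B.multilinear_algebra_axioms E'.B.multilinear_algebra_axioms g])
  have eqI: "c = c'" if "c \<in> carrier I" "c' \<in> carrier I" "g (i c) = i' c'" for c c'
    using that gi E'.i_eq_iff by simp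
  show ?thesis
  proof (rule extensional_cocycle_eqI[OF extensional_cocycle_of extensional_cocycle_of])
    fix x y assume xy: "x \<in> carrier Q" "y \<in> carrier Q"
    show "coc_add E.coc x y = coc_add E'.coc x y"
      using E.coc_add[OF xy] E'.coc_add[OF xy] xy by (intro eqI) (simp_all add: gl)
  next
    fix r x assume rx: "r \<in> carrier (scalars V)" "x \<in> carrier Q"
    show "coc_smult E.coc r x = coc_smult E'.coc r x"
      using E.coc_smult[OF rx] E'.coc_smult[OF rx] rx
      by (intro eqI) (simp_all add: gl malg_homD(3)[OF g])
  next
    fix f x assume f: "f \<in> ops V" and x: "x \<in> tuples (ar V f) (carrier Q)"
    have "compose {1..ar V f} g (compose {1..ar V f} l x) = compose {1..ar V f} l' x"
      using x by (auto simp: compose_def fun_eq_iff gl PiE_iff)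
    then show "coc_op E.coc f x = coc_op E'.coc f x"
      using E.coc_op[OF f x] E'.coc_op[OF f x] f x E.compose_l[OF x]
      by (intro eqI) (simp_all add: gl malg_homD(4)[OF g])
  next
    fix f s x a assume f: "f \<in> ops V" and s: "s \<in> proper_subsets (ar V f)"
      and x: "x \<in> tuples (ar V f) (carrier Q)" and a: "a \<in> tuples (ar V f) (carrier I)"
    have s': "s \<subseteq> {1..ar V f}"
      using s by (auto simp: proper_subsets_def)
    have "compose {1..ar V f} g (override_on (compose {1..ar V f} l x) (\<lambda>k. i (a k)) s)
        = override_on (compose {1..ar V f} l' x) (\<lambda>k. i' (a k)) s"
      using x a s' by (auto simp: compose_def override_on_def fun_eq_iff gl gi PiE_iff)
    then show "coc_act E.coc f s x a = coc_act E'.coc f s x a"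
      using E.coc_act[OF f s x a] E'.coc_act[OF f s x a] f E.override_l[OF x a s']
      by (intro eqI) (simp_all add: malg_homD(4)[OF g])
  qed
qed

text \<open>\<open>Z2\<close> admits only algebras on the type of pairs, so the extension is
  transported along its coordinate map \<open>g\<close>, with projection, inclusion and lifting
  carried along; by \<open>cocycle_of_transport\<close> the cocycle does not change.\<close>

lemma (in algebra_extension) coc_in_Z2: "coc \<in> Z2 V Q I"
proof -
  define g where "g b = (inv_into (carrier I) i (b \<ominus>\<^bsub>B\<^esub> l (p b)), p b)" for b
  have inj: "inj_on g (carrier B)"
  proof (rule inj_onI)
    fix b c assume bc: "b \<in> carrier B" "c \<in> carrier B" and gbc: "g b = g c"
    have eq: "inv_into (carrier I) i (b \<ominus>\<^bsub>B\<^esub> l (p b)) = inv_into (carrier I) i (c \<ominus>\<^bsub>B\<^esub> l (p c))"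
      using arg_cong[OF gbc, of fst] by (simp only: g_def fst_conv)
    have pbc: "p b = p c"
      using arg_cong[OF gbc, of snd] by (simp only: g_def snd_conv)
    \<comment> \<open>An element is recovered from its two coordinates, whence \<open>g\<close> is
      injective.\<close>
    have d: "d = i (inv_into (carrier I) i (d \<ominus>\<^bsub>B\<^esub> l (p d))) \<oplus>\<^bsub>B\<^esub> l (p d)" if "d \<in> carrier B" for d
    proof -
      have "p (d \<ominus>\<^bsub>B\<^esub> l (p d)) = \<zero>\<^bsub>Q\<^esub>"
        using that by (simp add: a_minus_def Q.r_neg)
      then have "i (inv_into (carrier I) i (d \<ominus>\<^bsub>B\<^esub> l (p d))) = d \<ominus>\<^bsub>B\<^esub> l (p d)"
        using that by (intro inv_i(2)) auto
      then show ?thesis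
        using that by (simp add: B.minus_add_cancel)
    qed
    show "b = c"
      using d[OF bc(1)] d[OF bc(2)] unfolding eq unfolding pbc by (rule trans[OF _ sym])
  qed
  let ?B = "image_alg V g B" and ?k = "inv_into (carrier B) g"
  note g = image_alg[OF inj, of V]
  have V_B: "in_variety V B" and V_Q: "in_variety V Q" and sur: "p ` carrier B = carrier Q"
    using ext by (auto simp: extension_def)
  have k: "?k \<in> malg_hom V ?B B"
    by (rule B.inv_into_malg_hom[OF g(1,2)])
  have kg: "?k (g b) = b" if "b \<in> carrier B" for b
    using that inj by simp
  have im: "carrier ?B = g ` carrier B"
    by (simp add: image_alg_def Let_def)
  have ker: "a_kernel ?B Q (\<lambda>b. p (?k b)) = g ` a_kernel B Q p"
  proof (intro equalityI subsetI)
    fix c assume "c \<in> a_kernel ?B Q (\<lambda>b. p (?k b))"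
    then obtain b where "b \<in> carrier B" "c = g b" "p (?k c) = \<zero>\<^bsub>Q\<^esub>"
      by (auto simp: a_kernel_def' im)
    then show "c \<in> g ` a_kernel B Q p"
      using kg by (auto simp: a_kernel_def')
  qed (auto simp: a_kernel_def' im kg)
  have "in_variety V ?B"
    by (rule in_variety_bij[OF V V_B g])
  moreover have "(\<lambda>b. p (?k b)) ` carrier ?B = carrier Q"
    unfolding im image_image sur[symmetric] by (intro image_cong refl) (simp add: kg)
  ultimately have ext': "extension V ?B Q (\<lambda>b. p (?k b))"
    using malg_hom_compose[OF k p_hom] V_Q by (simp add: extension_def)
  have lift': "lifting ?B Q (\<lambda>b. p (?k b)) (\<lambda>x. g (l x))"
    using g(3) by (auto simp: lifting_def im kg)
  have gi: "(\<lambda>a. g (i a)) \<in> malg_hom V I ?B"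
    by (rule malg_hom_compose[OF i_hom_B g(1)])
  have hom': "(\<lambda>a. g (i a)) \<in> malg_hom V I (ideal_alg ?B Q (\<lambda>b. p (?k b)))"
  proof (rule malg_homI)
    fix a assume "a \<in> carrier I"
    then show "g (i a) \<in> carrier (ideal_alg ?B Q (\<lambda>b. p (?k b)))"
      by (simp add: ideal_alg_def a_kernel_def' im kg)
  qed (use malg_homD(2-4)[OF gi] in \<open>simp_all add: ideal_alg_def del: i.hom_add\<close>)
  have "inj_on (\<lambda>a. g (i a)) (carrier I)"
    using comp_inj_on[OF i_inj inj_on_subset[OF inj]] by (auto simp: o_def image_subset_iff)
  moreover have "(\<lambda>a. g (i a)) ` carrier I = g ` a_kernel B Q p"
    using i_bij image_image[of g i "carrier I"] by (simp add: ideal_alg_def bij_betw_def)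
  ultimately have bij': "bij_betw (\<lambda>a. g (i a)) (carrier I) (carrier (ideal_alg ?B Q (\<lambda>b. p (?k b))))"
    by (simp add: ideal_alg_def ker bij_betw_def)
  have "algebra_extension V I ?B Q (\<lambda>b. p (?k b)) (\<lambda>a. g (i a)) (\<lambda>x. g (l x))"
    by (intro algebra_extensionI V I.multilinear_algebra_axioms ext' lift' hom' bij')
  then have "coc = cocycle_of V Q I ?B (\<lambda>a. g (i a)) (\<lambda>x. g (l x))"
    by (intro cocycle_of_transport[OF algebra_extension_axioms _ g(1)]) auto
  then show ?thesis
    unfolding Z2_def using ext' lift' hom' bij' by blast
qed

section \<open>The exact sequence\<close>

text \<open>I differs from A only in its carrier, so its inclusion is the identity function and the
  operations coincide, as recorded in \<open>I_simps\<close>.\<close>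

locale ideal_extension = algebra_extension V I A Q \<pi> "\<lambda>a. a" l
  for V :: "('r, 'f) variety_data" and I A :: "('r, 'f, 'a) malg" and Q :: "('r, 'f, 'q) malg"
    and \<pi> :: "'a \<Rightarrow> 'q" and l :: "'q \<Rightarrow> 'a" +
  assumes I_eq: "I = ideal_alg A Q \<pi>"
begin

lemma I_memI: "a \<in> carrier A \<Longrightarrow> \<pi> a = \<zero>\<^bsub>Q\<^esub> \<Longrightarrow> a \<in> carrier I"
  unfolding I_eq ideal_alg_def a_kernel_def' by simp

lemma I_subset: "carrier I \<subseteq> carrier A"
  using i_closed by blast

lemma I_simps [simp]: "x \<oplus>\<^bsub>I\<^esub> y = x \<oplus>\<^bsub>A\<^esub> y" "\<zero>\<^bsub>I\<^esub> = \<zero>\<^bsub>A\<^esub>" "r \<odot>\<^bsub>I\<^esub> x = r \<odot>\<^bsub>A\<^esub> x" "oper I = oper A"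
  unfolding I_eq ideal_alg_def by simp_all

subsection \<open>Derivations\<close>

abbreviation "der \<equiv> der_to_aut A I \<pi> l"

text \<open>Bypasses \<open>split_iso\<close>: subtracting \<open>d (\<pi> b)\<close>, an element of
  I, keeps the second coordinate and diminishes the first by the same amount.\<close>

lemma der_apply:
  assumes d: "d \<in> carrier Q \<rightarrow> carrier I" and b: "b \<in> carrier A"
  shows "der d b = b \<ominus>\<^bsub>A\<^esub> d (\<pi> b)"
proof -
  have inj: "inj_on (split_iso A \<pi> l) (carrier A)"
  proof (rule inj_onI)
    fix b c assume bc: "b \<in> carrier A" "c \<in> carrier A" and "split_iso A \<pi> l b = split_iso A \<pi> l c"
    then have "b \<ominus>\<^bsub>A\<^esub> l (\<pi> c) = c \<ominus>\<^bsub>A\<^esub> l (\<pi> c)"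
      by (auto simp: split_iso_def)
    then show "b = c"
      using bc B.minus_add_cancel[of b "l (\<pi> c)"] B.minus_add_cancel[of c "l (\<pi> c)"] by simp
  qed
  have dI: "d (\<pi> b) \<in> carrier I"
    using d b by auto
  then have "\<pi> (b \<ominus>\<^bsub>A\<^esub> d (\<pi> b)) = \<pi> b"
    using b by (simp add: a_minus_def)
  moreover have "b \<ominus>\<^bsub>A\<^esub> l (\<pi> b) \<in> carrier I"
    using b by (intro I_memI) (simp_all add: a_minus_def Q.r_neg)
  ultimately have "split_iso A \<pi> l (b \<ominus>\<^bsub>A\<^esub> d (\<pi> b))
      = (case split_iso A \<pi> l b of (a, x) \<Rightarrow> (a \<ominus>\<^bsub>I\<^esub> d x, x))"
    using dI b by (simp add: split_iso_def a_minus_def B.a_ac)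
  then show ?thesis
    using inj dI b by (simp add: der_to_aut_def inv_into_f_eq)
qed

lemma extension_map_der:
  assumes "d \<in> carrier Q \<rightarrow>\<^sub>E carrier I" "d \<zero>\<^bsub>Q\<^esub> = \<zero>\<^bsub>I\<^esub>"
  shows "extension_map V I A A Q \<pi> (\<lambda>a. a) l \<pi> (\<lambda>a. a) l d (der d)"
proof -
  have d: "d \<in> carrier Q \<rightarrow> carrier I"
    using assms(1) by auto
  have "der d (a \<oplus>\<^bsub>A\<^esub> l x) = a \<oplus>\<^bsub>A\<^esub> (l x \<ominus>\<^bsub>A\<^esub> d x)" if "a \<in> carrier I" "x \<in> carrier Q" for a x
  proof -
    have "d x \<in> carrier A"
      using d that I_subset by auto
    then show ?thesis
      using that by (simp add: der_apply[OF d] B.add_minus_eq)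
  qed
  then show ?thesis
    using assms algebra_extension_axioms
    by (simp add: extension_map_def extension_map_axioms_def)
qed

text \<open>\<open>der d\<close> is the map of \<open>extension_map\<close> for two copies of the
  same extension. Closure of derivations under sums and negatives thus comes from composites and
  inverses of homomorphisms.\<close>

lemma carrier_DerG:
  "d \<in> carrier (DerG V Q I coc) \<longleftrightarrow>
    d \<in> carrier Q \<rightarrow>\<^sub>E carrier I \<and> d \<zero>\<^bsub>Q\<^esub> = \<zero>\<^bsub>I\<^esub> \<and> der d \<in> malg_hom V A A"
proof -
  have "witnesses V Q I d coc coc \<Longrightarrow> d \<in> carrier Q \<rightarrow>\<^sub>E carrier I \<and> d \<zero>\<^bsub>Q\<^esub> = \<zero>\<^bsub>I\<^esub>"
    by (simp add: witnesses_def)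
  then show ?thesis
    using extension_map.witnesses_iff_hom[OF extension_map_der[of d]] by (auto simp: DerG_def)
qed

lemma der_add:
  assumes "d \<in> carrier Q \<rightarrow>\<^sub>E carrier I" "e \<in> carrier Q \<rightarrow>\<^sub>E carrier I"
  shows "der (\<lambda>x\<in>carrier Q. d x \<oplus>\<^bsub>I\<^esub> e x) = compose (carrier A) (der d) (der e)"
proof
  fix b
  have d: "d \<in> carrier Q \<rightarrow> carrier I" and e: "e \<in> carrier Q \<rightarrow> carrier I"
    using assms by auto
  then have de: "(\<lambda>x\<in>carrier Q. d x \<oplus>\<^bsub>I\<^esub> e x) \<in> carrier Q \<rightarrow> carrier I"
    using I.a_closed by (auto simp: Pi_iff)
  show "der (\<lambda>x\<in>carrier Q. d x \<oplus>\<^bsub>I\<^esub> e x) b = compose (carrier A) (der d) (der e) b"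
  proof (cases "b \<in> carrier A")
    case b: True
    have mem: "d (\<pi> b) \<in> carrier I" "e (\<pi> b) \<in> carrier I"
      using d e b by auto
    \<comment> \<open>Subtracting an element of I does not move the image in Q, so both corrections
      are evaluated at the same point.\<close>
    then have "\<pi> (b \<ominus>\<^bsub>A\<^esub> e (\<pi> b)) = \<pi> b"
      using b by (simp add: a_minus_def)
    then show ?thesis
      unfolding der_apply[OF de b] using b mem
      by (simp add: compose_def der_apply[OF d] der_apply[OF e] B.minus_minus_eq B.a_comm)
  qed (simp add: compose_def der_to_aut_def)
qed

lemma der_in_Aut:
  assumes "d \<in> carrier (DerG V Q I coc)"
  shows "der d \<in> carrier (AutG_pres V A I)"
proof -
  note d = assms[unfolded carrier_DerG]
  interpret D: extension_map V I A A Q \<pi> "\<lambda>a. a" l \<pi> "\<lambda>a. a" l d "der d"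
    using d by (intro extension_map_der) auto
  have "der d \<in> Bij (carrier A)"
    using D.bij_map by (simp add: Bij_def der_to_aut_def)
  moreover have "der d ` carrier I = carrier I"
    using D.map_i by (simp add: image_def)
  ultimately show ?thesis
    using d by (simp add: AutG_pres_def malg_aut_def)
qed

lemma DerG_zero: "(\<lambda>x\<in>carrier Q. \<zero>\<^bsub>I\<^esub>) \<in> carrier (DerG V Q I coc)"
proof -
  have zero: "(\<lambda>x\<in>carrier Q. \<zero>\<^bsub>I\<^esub>) \<in> carrier Q \<rightarrow>\<^sub>E carrier I"
    by (intro restrict_PiE_iff[THEN iffD2] ballI I.zero_closed)
  have "der (\<lambda>x\<in>carrier Q. \<zero>\<^bsub>I\<^esub>) \<in> malg_hom V A A"
  proof (rule B.malg_hom_cong[OF B.id_malg_hom])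
    fix b assume b: "b \<in> carrier A"
    show "der (\<lambda>x\<in>carrier Q. \<zero>\<^bsub>I\<^esub>) b = b"
      using b zero by (subst der_apply) (auto simp: a_minus_def)
  qed
  then show ?thesis
    using zero unfolding carrier_DerG by simp
qed

lemma DerG_add:
  assumes "d \<in> carrier (DerG V Q I coc)" "e \<in> carrier (DerG V Q I coc)"
  shows "(\<lambda>x\<in>carrier Q. d x \<oplus>\<^bsub>I\<^esub> e x) \<in> carrier (DerG V Q I coc)"
proof -
  note d = assms(1)[unfolded carrier_DerG] and e = assms(2)[unfolded carrier_DerG]
  have "der (\<lambda>x\<in>carrier Q. d x \<oplus>\<^bsub>I\<^esub> e x) \<in> malg_hom V A A"
  proof (rule B.malg_hom_cong[OF malg_hom_compose[of "der e" V A A "der d" A]])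
    fix b assume b: "b \<in> carrier A"
    show "der (\<lambda>x\<in>carrier Q. d x \<oplus>\<^bsub>I\<^esub> e x) b = der d (der e b)"
      unfolding der_add[OF conjunct1[OF d] conjunct1[OF e]] by (rule compose_eq[OF b])
  qed (use d e in simp_all)
  moreover have "(\<lambda>x\<in>carrier Q. d x \<oplus>\<^bsub>I\<^esub> e x) \<in> carrier Q \<rightarrow>\<^sub>E carrier I"
    by (intro restrict_PiE_iff[THEN iffD2] ballI I.a_closed) (use d e in auto)
  ultimately show ?thesis
    using d e unfolding carrier_DerG by simp
qed

lemma DerG_minus:
  assumes "d \<in> carrier (DerG V Q I coc)"
  shows "(\<lambda>x\<in>carrier Q. \<ominus>\<^bsub>I\<^esub> d x) \<in> carrier (DerG V Q I coc)"
proof -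
  note d = assms[unfolded carrier_DerG]
  let ?e = "\<lambda>x\<in>carrier Q. \<ominus>\<^bsub>I\<^esub> d x"
  interpret D: extension_map V I A A Q \<pi> "\<lambda>a. a" l \<pi> "\<lambda>a. a" l d "der d"
    using d by (intro extension_map_der) auto
  have e: "?e \<in> carrier Q \<rightarrow>\<^sub>E carrier I"
    by (intro restrict_PiE_iff[THEN iffD2] ballI I.a_inv_closed) (use d in auto)
  have mem: "d x \<in> carrier I" "d x \<in> carrier A" if "x \<in> carrier Q" for x
    using d that I_subset by auto
  have "der ?e \<in> malg_hom V A A"
  proof (rule B.malg_hom_cong[OF B.inv_into_malg_hom[of "der d" A]])
    fix b assume b: "b \<in> carrier A"
    \<comment> \<open>This element is the preimage of \<open>b\<close> under \<open>der d\<close>,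
      because \<open>d\<close> is evaluated at the unchanged \<open>\<pi> b\<close>.\<close>
    have c: "b \<oplus>\<^bsub>A\<^esub> d (\<pi> b) \<in> carrier A" "\<pi> (b \<oplus>\<^bsub>A\<^esub> d (\<pi> b)) = \<pi> b"
      using b mem by auto
    have "der d (b \<oplus>\<^bsub>A\<^esub> d (\<pi> b)) = b"
      using d b mem[of "\<pi> b"] by (subst der_apply[OF _ c(1)]) (auto simp: c(2) a_minus_def B.a_assoc B.r_neg)
    then have "inv_into (carrier A) (der d) b = b \<oplus>\<^bsub>A\<^esub> d (\<pi> b)"
      using D.bij_map c(1) by (intro inv_into_f_eq) (auto simp: bij_betw_def)
    moreover have "der ?e b = b \<oplus>\<^bsub>A\<^esub> d (\<pi> b)"
      using b mem[of "\<pi> b"] by (subst der_apply[OF _ b]) (use e in \<open>auto simp: a_minus_def B.minus_minus\<close>)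
    ultimately show "der ?e b = inv_into (carrier A) (der d) b"
      by simp
  qed (use d D.bij_map in auto)
  then show ?thesis
    using d e I.a_inv_zero unfolding carrier_DerG by simp
qed

lemma group_DerG: "group (DerG V Q I coc)"
proof (rule groupI)
  have mem: "d x \<in> carrier A" "d x \<in> carrier I" if "d \<in> carrier (DerG V Q I coc)" "x \<in> carrier Q" for d x
    using that I_subset by (auto simp: carrier_DerG)
  have ext: "d \<in> extensional (carrier Q)" if "d \<in> carrier (DerG V Q I coc)" for d
    using that by (simp add: carrier_DerG PiE_iff)
  show "d \<otimes>\<^bsub>DerG V Q I coc\<^esub> e \<in> carrier (DerG V Q I coc)"
    if "d \<in> carrier (DerG V Q I coc)" "e \<in> carrier (DerG V Q I coc)" for d e
    using DerG_add[OF that] by (simp add: DerG_def)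
  show "\<one>\<^bsub>DerG V Q I coc\<^esub> \<in> carrier (DerG V Q I coc)"
    using DerG_zero by (simp add: DerG_def)
  show "d \<otimes>\<^bsub>DerG V Q I coc\<^esub> e \<otimes>\<^bsub>DerG V Q I coc\<^esub> f = d \<otimes>\<^bsub>DerG V Q I coc\<^esub> (e \<otimes>\<^bsub>DerG V Q I coc\<^esub> f)"
    if "d \<in> carrier (DerG V Q I coc)" "e \<in> carrier (DerG V Q I coc)" "f \<in> carrier (DerG V Q I coc)" for d e f
    using mem[OF that(1)] mem[OF that(2)] mem[OF that(3)]
    by (auto simp: DerG_def fun_eq_iff B.a_assoc)
  show "\<one>\<^bsub>DerG V Q I coc\<^esub> \<otimes>\<^bsub>DerG V Q I coc\<^esub> d = d" if "d \<in> carrier (DerG V Q I coc)" for d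
    using mem[OF that] ext[OF that] by (auto simp: DerG_def fun_eq_iff extensional_def)
  show "\<exists>e\<in>carrier (DerG V Q I coc). e \<otimes>\<^bsub>DerG V Q I coc\<^esub> d = \<one>\<^bsub>DerG V Q I coc\<^esub>"
    if "d \<in> carrier (DerG V Q I coc)" for d
    using mem[OF that]
    by (intro bexI[OF _ DerG_minus[OF that]]) (auto simp: DerG_def fun_eq_iff B.l_neg)
qed

lemma group_Aut_pres: "group (AutG_pres V A I)"
  by (rule B.group_AutG_pres[OF I_subset])

lemma AutG_pres_mult:
  assumes "\<phi> \<in> carrier (AutG_pres V A I)" "\<psi> \<in> carrier (AutG_pres V A I)"
  shows "\<phi> \<otimes>\<^bsub>AutG_pres V A I\<^esub> \<psi> = compose (carrier A) \<phi> \<psi>"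
  using assms by (simp add: AutG_pres_def BijGroup_def malg_aut_def)

lemma group_hom_der: "group_hom (DerG V Q I coc) (AutG_pres V A I) der"
proof (intro group_hom.intro group_hom_axioms.intro group_DerG group_Aut_pres homI der_in_Aut)
  fix d e assume "d \<in> carrier (DerG V Q I coc)" "e \<in> carrier (DerG V Q I coc)"
  moreover have "d \<otimes>\<^bsub>DerG V Q I coc\<^esub> e = (\<lambda>x\<in>carrier Q. d x \<oplus>\<^bsub>I\<^esub> e x)"
    by (simp add: DerG_def)
  ultimately show "der (d \<otimes>\<^bsub>DerG V Q I coc\<^esub> e) = der d \<otimes>\<^bsub>AutG_pres V A I\<^esub> der e"
    using der_add[of d e] by (simp add: AutG_pres_mult der_in_Aut carrier_DerG del: I_simps)
qed

lemma inj_on_der: "inj_on der (carrier (DerG V Q I coc))"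
proof (rule inj_onI)
  fix d e assume d: "d \<in> carrier (DerG V Q I coc)" and e: "e \<in> carrier (DerG V Q I coc)"
    and eq: "der d = der e"
  show "d = e"
  proof (rule extensionalityI[of _ "carrier Q"])
    fix x assume x: "x \<in> carrier Q"
    have fs: "d \<in> carrier Q \<rightarrow> carrier I" "e \<in> carrier Q \<rightarrow> carrier I"
      using d e by (simp_all add: carrier_DerG PiE_def)
    then have mem: "d x \<in> carrier A" "e x \<in> carrier A"
      using x I_subset by blast+
    \<comment> \<open>Evaluation at the lift of \<open>x\<close> recovers
      \<open>d x\<close>.\<close>
    have "l x \<ominus>\<^bsub>A\<^esub> d x = l x \<ominus>\<^bsub>A\<^esub> e x"
      using fun_cong[OF eq, of "l x"] der_apply[OF fs(1) l_closed[OF x]] der_apply[OF fs(2) l_closed[OF x]]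
      by (simp only: p_l[OF x])
    then have "\<ominus>\<^bsub>A\<^esub> d x = \<ominus>\<^bsub>A\<^esub> e x"
      unfolding a_minus_def using mem x by simp
    then show "d x = e x"
      using B.minus_minus[OF mem(1)] B.minus_minus[OF mem(2)] by metis
  qed (use d e in \<open>simp_all add: carrier_DerG PiE_def\<close>)
qed

subsection \<open>Restriction to the kernel and the quotient\<close>

abbreviation "res \<equiv> psi Q I \<pi> l"

lemma Aut_presD:
  assumes "\<phi> \<in> carrier (AutG_pres V A I)"
  shows "\<phi> \<in> malg_hom V A A" "bij_betw \<phi> (carrier A) (carrier A)" "\<phi> \<in> extensional (carrier A)"
    "\<phi> ` carrier I = carrier I" "b \<in> carrier A \<Longrightarrow> \<phi> b \<in> carrier A"
    "a \<in> carrier I \<Longrightarrow> \<phi> a \<in> carrier I"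
proof -
  show "\<phi> \<in> malg_hom V A A" "bij_betw \<phi> (carrier A) (carrier A)" "\<phi> \<in> extensional (carrier A)"
    "\<phi> ` carrier I = carrier I"
    using assms by (simp_all add: AutG_pres_def malg_aut_def Bij_def)
  then show "b \<in> carrier A \<Longrightarrow> \<phi> b \<in> carrier A" "a \<in> carrier I \<Longrightarrow> \<phi> a \<in> carrier I"
    by (blast intro: malg_homD(1))+
qed

lemma carrier_AutG:
  "\<phi> \<in> carrier (AutG V C) \<longleftrightarrow>
    \<phi> \<in> malg_hom V C C \<and> \<phi> \<in> extensional (carrier C) \<and> bij_betw \<phi> (carrier C) (carrier C)"
  by (auto simp: AutG_def malg_aut_def Bij_def)

text \<open>\<open>b\<close> and \<open>l (\<pi> b)\<close> differ by an element of I, which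
  \<open>\<phi>\<close> keeps in I. This is the independence of the lifting, and it turns laws for
  the induced map on Q into laws for \<open>\<phi>\<close>.\<close>

lemma res_quotient:
  assumes \<phi>: "\<phi> \<in> carrier (AutG_pres V A I)" and b: "b \<in> carrier A"
  shows "snd (res \<phi>) (\<pi> b) = \<pi> (\<phi> b)"
proof -
  obtain a where a: "a \<in> carrier I" "b = a \<oplus>\<^bsub>A\<^esub> l (\<pi> b)"
    using b by (rule decompose)
  have "\<phi> (a \<oplus>\<^bsub>A\<^esub> l (\<pi> b)) = \<phi> a \<oplus>\<^bsub>A\<^esub> \<phi> (l (\<pi> b))"
    using malg_homD(2)[OF Aut_presD(1)[OF \<phi>], of a "l (\<pi> b)"] a(1) b I_subset by auto
  moreover have "\<phi> a \<in> carrier A" "\<pi> (\<phi> a) = \<zero>\<^bsub>Q\<^esub>" "\<phi> (l (\<pi> b)) \<in> carrier A"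
    using Aut_presD(6)[OF \<phi> a(1)] Aut_presD(5)[OF \<phi>] b by simp_all
  ultimately have "\<pi> (\<phi> (a \<oplus>\<^bsub>A\<^esub> l (\<pi> b))) = \<pi> (\<phi> (l (\<pi> b)))"
    by simp
  then show ?thesis
    using a(2) b by (simp add: psi_def)
qed

lemma res_eqI:
  assumes \<phi>: "\<phi> \<in> carrier (AutG_pres V A I)"
    and "\<sigma> \<in> extensional (carrier I)" "\<kappa> \<in> extensional (carrier Q)"
    and "\<And>a. a \<in> carrier I \<Longrightarrow> \<phi> a = \<sigma> a" "\<And>b. b \<in> carrier A \<Longrightarrow> \<pi> (\<phi> b) = \<kappa> (\<pi> b)"
  shows "res \<phi> = (\<sigma>, \<kappa>)"
proof -
  have "restrict \<phi> (carrier I) = \<sigma>"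
    by (rule extensionalityI[OF _ assms(2)]) (simp_all add: assms(4))
  moreover have "(\<lambda>x\<in>carrier Q. \<pi> (\<phi> (l x))) = \<kappa>"
    by (rule extensionalityI[OF _ assms(3)]) (simp_all add: assms(5))
  ultimately show ?thesis
    by (simp add: psi_def)
qed

lemma res_closed:
  assumes \<phi>: "\<phi> \<in> carrier (AutG_pres V A I)"
  shows "res \<phi> \<in> carrier (AutG V I \<times>\<times> AutG V Q)"
proof -
  note D = Aut_presD[OF \<phi>]
  have "fst (res \<phi>) \<in> carrier (AutG V I)"
  proof -
    have "\<phi> \<in> malg_hom V I I"
    proof (rule malg_homI)
      fix f v assume f: "f \<in> ops V" and v: "v \<in> tuples (ar V f) (carrier I)"
      then have "v \<in> tuples (ar V f) (carrier A)"
        using I_subset by (auto simp: PiE_iff)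
      then show "\<phi> (oper I f v) = oper I f (compose {1..ar V f} \<phi> v)"
        using malg_homD(4)[OF D(1) f] by simp
    qed (use D(6) malg_homD(2,3)[OF D(1)] I_subset in auto)
    then have "restrict \<phi> (carrier I) \<in> malg_hom V I I"
      by (rule I.malg_hom_cong) simp
    moreover have "bij_betw (restrict \<phi> (carrier I)) (carrier I) (carrier I)"
      using D(2,4) I_subset by (auto simp: bij_betw_def intro: inj_on_subset)
    ultimately show ?thesis
      by (simp add: psi_def carrier_AutG)
  qed
  moreover have "snd (res \<phi>) \<in> carrier (AutG V Q)"
  proof -
    let ?\<kappa> = "snd (res \<phi>)"
    note q = res_quotient[OF \<phi>]
    have hom: "?\<kappa> \<in> malg_hom V Q Q"
    proof (rule malg_homI)
      fix x assume "x \<in> carrier Q"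
      then show "?\<kappa> x \<in> carrier Q"
        using q[of "l x"] D(5) by simp
    next
      fix x y assume "x \<in> carrier Q" "y \<in> carrier Q"
      then show "?\<kappa> (x \<oplus>\<^bsub>Q\<^esub> y) = ?\<kappa> x \<oplus>\<^bsub>Q\<^esub> ?\<kappa> y"
        using q[of "l x \<oplus>\<^bsub>A\<^esub> l y"] q[of "l x"] q[of "l y"] D(5) malg_homD(2)[OF D(1), of "l x" "l y"]
        by simp
    next
      fix r x assume "r \<in> carrier (scalars V)" "x \<in> carrier Q"
      then show "?\<kappa> (r \<odot>\<^bsub>Q\<^esub> x) = r \<odot>\<^bsub>Q\<^esub> ?\<kappa> x"
        using q[of "r \<odot>\<^bsub>A\<^esub> l x"] q[of "l x"] D(5) malg_homD(3)[OF D(1), of r "l x"] malg_homD(3)[OF p_hom, of r]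
        by simp
    next
      fix f x assume f: "f \<in> ops V" and x: "x \<in> tuples (ar V f) (carrier Q)"
      let ?v = "compose {1..ar V f} l x"
      have v: "?v \<in> tuples (ar V f) (carrier A)"
        by (rule compose_l[OF x])
      have \<phi>v: "compose {1..ar V f} \<phi> ?v \<in> tuples (ar V f) (carrier A)"
        by (rule compose_tuples[OF _ v]) (use D(5) in auto)
      have "compose {1..ar V f} \<pi> ?v = x"
        using p_l x by (rule compose_tuples_id)
      moreover have "compose {1..ar V f} \<pi> (compose {1..ar V f} \<phi> ?v) = compose {1..ar V f} ?\<kappa> x"
        using x by (auto simp: compose_def psi_def fun_eq_iff PiE_iff)
      ultimately show "?\<kappa> (oper Q f x) = oper Q f (compose {1..ar V f} ?\<kappa> x)"
        using q[of "oper A f ?v"] f v \<phi>v malg_homD(4)[OF D(1) f v] malg_homD(4)[OF p_hom f]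
        by simp
    qed
    have "inj_on ?\<kappa> (carrier Q)"
    proof (rule inj_onI)
      fix x y assume x: "x \<in> carrier Q" and y: "y \<in> carrier Q" and eq: "?\<kappa> x = ?\<kappa> y"
      let ?c = "l x \<ominus>\<^bsub>A\<^esub> l y"
      have c: "?c \<in> carrier A"
        using x y by simp
      interpret \<phi>: abelian_group_hom A A \<phi>
        by (rule malg_hom_abelian_group_hom[OF B.multilinear_algebra_axioms B.multilinear_algebra_axioms D(1)])
      have "\<pi> (\<phi> ?c) = \<zero>\<^bsub>Q\<^esub>"
        using q[of "l x"] q[of "l y"] x y eq by (simp add: a_minus_def Q.r_neg)
      \<comment> \<open>\<open>\<phi>\<close> maps I onto I, not just into it: an element sent into
        I comes from I, which gives injectivity on the quotient.\<close>
      then have "\<phi> ?c \<in> \<phi> ` carrier I"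
        unfolding D(4) by (rule I_memI[OF D(5)[OF c]])
      then have "?c \<in> carrier I"
        using inj_on_image_mem_iff[OF bij_betw_imp_inj_on[OF D(2)] c I_subset] by simp
      then have "\<pi> ?c = \<zero>\<^bsub>Q\<^esub>"
        by (rule p_i)
      moreover have "\<pi> ?c = x \<ominus>\<^bsub>Q\<^esub> y"
        using x y by simp
      ultimately have "x \<ominus>\<^bsub>Q\<^esub> y = \<zero>\<^bsub>Q\<^esub>"
        by simp
      then show "x = y"
        using x y by (simp add: Q.minus_eq_iff)
    qed
    moreover have "?\<kappa> ` carrier Q = carrier Q"
    proof (intro equalityI subsetI)
      fix y assume y: "y \<in> carrier Q"
      then have "l y \<in> \<phi> ` carrier A"
        using D(2) by (simp add: bij_betw_def)
      then obtain b where b: "b \<in> carrier A" "l y = \<phi> b"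
        by auto
      then have "?\<kappa> (\<pi> b) = y"
        using q[of b] y by (simp flip: b(2))
      then show "y \<in> ?\<kappa> ` carrier Q"
        using b(1) by auto
    qed (use malg_homD(1)[OF hom] in auto)
    ultimately show ?thesis
      using hom by (simp add: carrier_AutG bij_betw_def psi_def)
  qed
  ultimately show ?thesis
    by (simp add: DirProd_def mem_Times_iff)
qed

lemma group_hom_res: "group_hom (AutG_pres V A I) (AutG V I \<times>\<times> AutG V Q) res"
proof (intro group_hom.intro group_hom_axioms.intro group_Aut_pres DirProd_group
    I.group_AutG Q.group_AutG homI res_closed)
  fix \<phi> \<psi> assume \<phi>: "\<phi> \<in> carrier (AutG_pres V A I)" and \<psi>: "\<psi> \<in> carrier (AutG_pres V A I)"
  have c: "res \<phi> \<in> carrier (AutG V I \<times>\<times> AutG V Q)" "res \<psi> \<in> carrier (AutG V I \<times>\<times> AutG V Q)"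
    using \<phi> \<psi> res_closed by auto
  have "\<phi> \<otimes>\<^bsub>AutG_pres V A I\<^esub> \<psi> \<in> carrier (AutG_pres V A I)"
    using group_Aut_pres \<phi> \<psi> by (intro monoid.m_closed group.is_monoid)
  then have cl: "compose (carrier A) \<phi> \<psi> \<in> carrier (AutG_pres V A I)"
    using AutG_pres_mult[OF \<phi> \<psi>] by simp
  have "res (compose (carrier A) \<phi> \<psi>)
      = (compose (carrier I) (fst (res \<phi>)) (fst (res \<psi>)), compose (carrier Q) (snd (res \<phi>)) (snd (res \<psi>)))"
  proof (rule res_eqI[OF cl])
    fix a assume "a \<in> carrier I"
    then show "compose (carrier A) \<phi> \<psi> a = compose (carrier I) (fst (res \<phi>)) (fst (res \<psi>)) a"
      using I_subset Aut_presD(6)[OF \<psi>] by (auto simp: compose_def psi_def)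
  next
    fix b assume b: "b \<in> carrier A"
    then show "\<pi> (compose (carrier A) \<phi> \<psi> b) = compose (carrier Q) (snd (res \<phi>)) (snd (res \<psi>)) (\<pi> b)"
      using Aut_presD(5)[OF \<psi>] by (simp add: compose_def res_quotient[OF \<phi>] res_quotient[OF \<psi>])
  qed (simp_all add: compose_extensional)
  also have "\<dots> = res \<phi> \<otimes>\<^bsub>AutG V I \<times>\<times> AutG V Q\<^esub> res \<psi>"
    using c by (auto simp: DirProd_def AutG_def BijGroup_def malg_aut_def case_prod_beta mem_Times_iff)
  finally show "res (\<phi> \<otimes>\<^bsub>AutG_pres V A I\<^esub> \<psi>) = res \<phi> \<otimes>\<^bsub>AutG V I \<times>\<times> AutG V Q\<^esub> res \<psi>"
    using AutG_pres_mult[OF \<phi> \<psi>] by simp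
qed

text \<open>An automorphism in the kernel is a morphism of the extension to itself over I and Q,
  hence is given by some \<open>d\<close> through \<open>extension_map_of_hom\<close>.\<close>

lemma kernel_res: "der ` carrier (DerG V Q I coc) = kernel (AutG_pres V A I) (AutG V I \<times>\<times> AutG V Q) res"
proof -
  have one: "\<one>\<^bsub>AutG V I \<times>\<times> AutG V Q\<^esub> = (\<lambda>a\<in>carrier I. a, \<lambda>x\<in>carrier Q. x)"
    by (simp add: DirProd_def AutG_def BijGroup_def)
  show ?thesis
  proof (intro equalityI subsetI)
    fix \<phi> assume "\<phi> \<in> der ` carrier (DerG V Q I coc)"
    then obtain d where d: "d \<in> carrier (DerG V Q I coc)" and \<phi>: "\<phi> = der d"
      by auto
    interpret D: extension_map V I A A Q \<pi> "\<lambda>a. a" l \<pi> "\<lambda>a. a" l d "der d"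
      using d by (intro extension_map_der) (auto simp: carrier_DerG)
    have "res (der d) = (\<lambda>a\<in>carrier I. a, \<lambda>x\<in>carrier Q. x)"
      by (rule res_eqI[OF der_in_Aut[OF d]]) (simp_all add: D.map_i D.p_map)
    then show "\<phi> \<in> kernel (AutG_pres V A I) (AutG V I \<times>\<times> AutG V Q) res"
      unfolding kernel_def one \<phi> using der_in_Aut[OF d] by simp
  next
    fix \<phi> assume "\<phi> \<in> kernel (AutG_pres V A I) (AutG V I \<times>\<times> AutG V Q) res"
    then have \<phi>: "\<phi> \<in> carrier (AutG_pres V A I)" and r: "res \<phi> = (\<lambda>a\<in>carrier I. a, \<lambda>x\<in>carrier Q. x)"
      unfolding kernel_def one by auto
    have "\<phi> a = a" if "a \<in> carrier I" for a
      using that r by (auto simp: psi_def dest: fun_cong[of _ _ a])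
    moreover have "\<pi> (\<phi> b) = \<pi> b" if "b \<in> carrier A" for b
      using res_quotient[OF \<phi> that] r that by simp
    ultimately have eh: "\<phi> \<in> extension_homs V I A \<pi> (\<lambda>a. a) A \<pi> (\<lambda>a. a)"
      using Aut_presD(1)[OF \<phi>] by (simp add: extension_homs_def)
    obtain d where d: "extension_map V I A A Q \<pi> (\<lambda>a. a) l \<pi> (\<lambda>a. a) l d \<phi>"
      using extension_map_of_hom[OF algebra_extension_axioms algebra_extension_axioms eh] by blast
    interpret D: extension_map V I A A Q \<pi> "\<lambda>a. a" l \<pi> "\<lambda>a. a" l d \<phi>
      by (rule d)
    interpret D': extension_map V I A A Q \<pi> "\<lambda>a. a" l \<pi> "\<lambda>a. a" l d "der d"
      by (rule extension_map_der[OF D.h D.h_zero])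
    \<comment> \<open>Both maps satisfy \<open>map_eq\<close> for the same \<open>d\<close>, hence
      agree on every decomposed element; off the carrier both are extensional.\<close>
    have "\<phi> = der d"
    proof (rule extensionalityI[OF Aut_presD(3)[OF \<phi>]])
      show "der d \<in> extensional (carrier A)"
        by (simp add: der_to_aut_def)
      fix b assume "b \<in> carrier A"
      then obtain a where a: "a \<in> carrier I" "b = a \<oplus>\<^bsub>A\<^esub> l (\<pi> b)" and x: "\<pi> b \<in> carrier Q"
        using decompose p_closed by blast
      then show "\<phi> b = der d b"
        using D.map_eq D'.map_eq by metis
    qed
    moreover have "d \<in> carrier (DerG V Q I coc)"
      using D.extension_homs_iff eh by (simp add: DerG_def)
    ultimately show "\<phi> \<in> der ` carrier (DerG V Q I coc)"
      by blast
  qed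
qed

subsection \<open>The Wells map\<close>

context
  fixes \<sigma> \<kappa>
  assumes \<sigma>: "\<sigma> \<in> carrier (AutG V I)" and \<kappa>: "\<kappa> \<in> carrier (AutG V Q)"
begin

abbreviation "\<sigma>' \<equiv> inv_into (carrier I) \<sigma>"
abbreviation "\<kappa>' \<equiv> inv_into (carrier Q) \<kappa>"

lemma \<sigma>': "a \<in> carrier I \<Longrightarrow> \<sigma>' a \<in> carrier I" "a \<in> carrier I \<Longrightarrow> \<sigma> (\<sigma>' a) = a"
  "a \<in> carrier I \<Longrightarrow> \<sigma>' (\<sigma> a) = a" "a \<in> carrier I \<Longrightarrow> \<sigma> a \<in> carrier I"
  using \<sigma> by (auto simp: carrier_AutG bij_betw_def inv_into_into f_inv_into_f)

lemma \<kappa>': "x \<in> carrier Q \<Longrightarrow> \<kappa>' x \<in> carrier Q" "x \<in> carrier Q \<Longrightarrow> \<kappa> (\<kappa>' x) = x"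
  "x \<in> carrier Q \<Longrightarrow> \<kappa>' (\<kappa> x) = x" "x \<in> carrier Q \<Longrightarrow> \<kappa> x \<in> carrier Q"
  using \<kappa> by (auto simp: carrier_AutG bij_betw_def inv_into_into f_inv_into_f)

lemma \<sigma>'_hom: "\<sigma>' \<in> malg_hom V I I" and \<kappa>'_hom: "\<kappa>' \<in> malg_hom V Q Q"
  using \<sigma> \<kappa> I.inv_into_malg_hom Q.inv_into_malg_hom by (auto simp: carrier_AutG)

lemma \<kappa>_zero: "\<kappa> \<zero>\<^bsub>Q\<^esub> = \<zero>\<^bsub>Q\<^esub>" "\<kappa>' \<zero>\<^bsub>Q\<^esub> = \<zero>\<^bsub>Q\<^esub>"
  using \<kappa> \<kappa>'_hom abelian_group_hom.hom_zero[OF malg_hom_abelian_group_hom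
      [OF Q.multilinear_algebra_axioms Q.multilinear_algebra_axioms]]
  by (auto simp: carrier_AutG)

lemma twisted_extension:
  "algebra_extension V I A Q (\<lambda>b. \<kappa> (\<pi> b)) \<sigma>' (\<lambda>x. l (\<kappa>' x))"
proof -
  have "\<kappa> x = \<zero>\<^bsub>Q\<^esub> \<longleftrightarrow> x = \<zero>\<^bsub>Q\<^esub>" if "x \<in> carrier Q" for x
    using \<kappa>'(3)[OF that] \<kappa>_zero by auto
  \<comment> \<open>\<open>\<kappa>\<close> is injective and fixes zero, so composing
    \<open>\<pi>\<close> with it leaves the kernel unchanged.\<close>
  then have I': "ideal_alg A Q (\<lambda>b. \<kappa> (\<pi> b)) = I"
    unfolding I_eq ideal_alg_def a_kernel_def' by (intro malg.equality) auto
  have "\<kappa> ` carrier Q = carrier Q"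
    using \<kappa> by (simp add: carrier_AutG bij_betw_def)
  then have "(\<lambda>b. \<kappa> (\<pi> b)) ` carrier A = carrier Q"
    using ext by (simp add: extension_def flip: image_image[of \<kappa> \<pi>])
  then have "extension V A Q (\<lambda>b. \<kappa> (\<pi> b))"
    using ext \<kappa> malg_hom_compose[OF p_hom, of \<kappa> Q] by (simp add: extension_def carrier_AutG)
  moreover have "lifting A Q (\<lambda>b. \<kappa> (\<pi> b)) (\<lambda>x. l (\<kappa>' x))"
    using \<kappa>' \<kappa>_zero by (simp add: lifting_def)
  moreover have "bij_betw \<sigma>' (carrier I) (carrier I)"
    using \<sigma> by (intro bij_betw_inv_into) (simp add: carrier_AutG)
  ultimately show ?thesis
    using \<sigma>'_hom by (intro algebra_extensionI V I.multilinear_algebra_axioms) (simp_all add: I')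
qed

text \<open>Reading a kernel element back in I through the inclusion \<open>\<sigma>'\<close>
  applies \<open>\<sigma>\<close> to the value, while arguments from I enter through
  \<open>\<sigma>'\<close> and arguments from Q through \<open>\<kappa>'\<close>; this is exactly
  the twist.\<close>

lemma coc_twist_eq: "coc_twist V Q I coc (\<sigma>, \<kappa>) = cocycle_of V Q I A \<sigma>' (\<lambda>x. l (\<kappa>' x))"
proof -
  interpret W: algebra_extension V I A Q "\<lambda>b. \<kappa> (\<pi> b)" \<sigma>' "\<lambda>x. l (\<kappa>' x)"
    by (rule twisted_extension)
  have eqI: "\<sigma> c = c'" if "c \<in> carrier I" "c' \<in> carrier I" "c = \<sigma>' c'" for c c'
    using that \<sigma>'(2) by simp
  show ?thesis
  proof (rule extensional_cocycle_eqI[OF extensional_coc_twist extensional_cocycle_of])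
    fix x y assume xy: "x \<in> carrier Q" "y \<in> carrier Q"
    show "coc_add (coc_twist V Q I coc (\<sigma>, \<kappa>)) x y = coc_add W.coc x y"
      using coc_add[OF \<kappa>'(1)[OF xy(1)] \<kappa>'(1)[OF xy(2)]] W.coc_add[OF xy] xy malg_homD(2)[OF \<kappa>'_hom xy]
      by (simp add: coc_twist_def Let_def eqI)
  next
    fix r x assume rx: "r \<in> carrier (scalars V)" "x \<in> carrier Q"
    show "coc_smult (coc_twist V Q I coc (\<sigma>, \<kappa>)) r x = coc_smult W.coc r x"
      using coc_smult[OF rx(1) \<kappa>'(1)[OF rx(2)]] W.coc_smult[OF rx] rx malg_homD(3)[OF \<kappa>'_hom rx]
      by (simp add: coc_twist_def Let_def eqI)
  next
    fix f x assume f: "f \<in> ops V" and x: "x \<in> tuples (ar V f) (carrier Q)"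
    have y: "compose {1..ar V f} \<kappa>' x \<in> tuples (ar V f) (carrier Q)"
      using \<kappa>'(1) x by (intro compose_tuples) auto
    have "compose {1..ar V f} l (compose {1..ar V f} \<kappa>' x) = compose {1..ar V f} (\<lambda>x. l (\<kappa>' x)) x"
      by (auto simp: compose_def)
    then show "coc_op (coc_twist V Q I coc (\<sigma>, \<kappa>)) f x = coc_op W.coc f x"
      using coc_op[OF f y] W.coc_op[OF f x] f x malg_homD(4)[OF \<kappa>'_hom f x]
      by (simp add: coc_twist_def Let_def eqI)
  next
    fix f s x a assume f: "f \<in> ops V" and s: "s \<in> proper_subsets (ar V f)"
      and x: "x \<in> tuples (ar V f) (carrier Q)" and a: "a \<in> tuples (ar V f) (carrier I)"
    have y: "compose {1..ar V f} \<kappa>' x \<in> tuples (ar V f) (carrier Q)"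
      using \<kappa>'(1) x by (intro compose_tuples) auto
    have c: "compose {1..ar V f} \<sigma>' a \<in> tuples (ar V f) (carrier I)"
      using \<sigma>'(1) a by (intro compose_tuples) auto
    have "override_on (compose {1..ar V f} l (compose {1..ar V f} \<kappa>' x)) (compose {1..ar V f} \<sigma>' a) s
        = override_on (compose {1..ar V f} (\<lambda>x. l (\<kappa>' x)) x) (\<lambda>k. \<sigma>' (a k)) s"
      using s by (auto simp: compose_def override_on_def proper_subsets_def fun_eq_iff)
    then show "coc_act (coc_twist V Q I coc (\<sigma>, \<kappa>)) f s x a = coc_act W.coc f s x a"
      using coc_act[OF f s y c] W.coc_act[OF f s x a] f s x a
      by (simp add: coc_twist_def Let_def eqI)
  qed
qed

lemma twist_in_Z2: "coc_twist V Q I coc (\<sigma>, \<kappa>) \<in> Z2 V Q I"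
  unfolding coc_twist_eq by (rule algebra_extension.coc_in_Z2[OF twisted_extension])

text \<open>Distinct generators of a free abelian group stay distinct, so the difference vanishes
  iff the two classes coincide; since both cocycles lie in \<open>Z2\<close>, this means that they
  are equivalent.\<close>

lemma wells_eq_0_iff_extension_homs:
  "wells V Q I coc (\<sigma>, \<kappa>) = 0 \<longleftrightarrow>
    extension_homs V I A (\<lambda>b. \<kappa> (\<pi> b)) \<sigma>' A \<pi> (\<lambda>a. a) \<noteq> {}"
proof -
  have "wells V Q I coc (\<sigma>, \<kappa>) = 0 \<longleftrightarrow>
      coc_class V Q I coc = coc_class V Q I (coc_twist V Q I coc (\<sigma>, \<kappa>))"
    unfolding wells_def right_minus_eq frag_of_eq ..
  also have "\<dots> \<longleftrightarrow> (coc, coc_twist V Q I coc (\<sigma>, \<kappa>)) \<in> coc_equiv V Q I"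
    unfolding coc_class_def
    by (rule eq_equiv_class_iff[OF equiv_coc_equiv[OF V I.multilinear_algebra_axioms] coc_in_Z2 twist_in_Z2])
  also have "\<dots> \<longleftrightarrow> extension_homs V I A (\<lambda>b. \<kappa> (\<pi> b)) \<sigma>' A \<pi> (\<lambda>a. a) \<noteq> {}"
  proof -
    have "(coc, coc_twist V Q I coc (\<sigma>, \<kappa>)) \<in> coc_equiv V Q I
        \<longleftrightarrow> (\<exists>h. witnesses V Q I h coc (coc_twist V Q I coc (\<sigma>, \<kappa>)))"
      using coc_in_Z2 twist_in_Z2 by (auto simp only: coc_equiv_def mem_Collect_eq case_prod_conv)
    then show ?thesis
      unfolding coc_twist_eq ex_witnesses_iff[OF algebra_extension_axioms twisted_extension] .
  qed
  finally show ?thesis .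
qed

lemma wells_eq_0_iff: "wells V Q I coc (\<sigma>, \<kappa>) = 0 \<longleftrightarrow> (\<sigma>, \<kappa>) \<in> res ` carrier (AutG_pres V A I)"
  unfolding wells_eq_0_iff_extension_homs
proof
  assume "extension_homs V I A (\<lambda>b. \<kappa> (\<pi> b)) \<sigma>' A \<pi> (\<lambda>a. a) \<noteq> {}"
  then obtain \<phi> where \<phi>: "\<phi> \<in> extension_homs V I A (\<lambda>b. \<kappa> (\<pi> b)) \<sigma>' A \<pi> (\<lambda>a. a)"
    by auto
  have bij: "bij_betw \<phi> (carrier A) (carrier A)"
    by (rule extension_map.bij_map[OF extension_map_of_hom[OF algebra_extension_axioms twisted_extension \<phi>]])
  have \<phi>\<sigma>: "\<phi> a = \<sigma> a" if "a \<in> carrier I" for a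
  proof -
    \<comment> \<open>The twisted inclusion is the inverse of \<open>\<sigma>\<close>, so the
      morphism condition taken at \<open>\<sigma> a\<close> says that \<open>\<phi>\<close>
      restricts to \<open>\<sigma>\<close>.\<close>
    have "\<phi> (\<sigma>' (\<sigma> a)) = \<sigma> a"
      using \<phi> \<sigma>'(4)[OF that] unfolding extension_homs_def by blast
    then show ?thesis
      unfolding \<sigma>'(3)[OF that] .
  qed
  have \<phi>\<kappa>: "\<pi> (\<phi> b) = \<kappa> (\<pi> b)" if "b \<in> carrier A" for b
    using \<phi> that unfolding extension_homs_def by blast
  \<comment> \<open>A morphism may take any values off the carrier; an element of the automorphism
    group may not.\<close>
  let ?\<phi> = "restrict \<phi> (carrier A)"
  have "?\<phi> \<in> malg_hom V A A"
    by (rule B.malg_hom_cong[of \<phi> A]) (use \<phi> in \<open>simp_all add: extension_homs_def\<close>)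
  moreover have "?\<phi> ` carrier I = carrier I"
  proof -
    have "?\<phi> ` carrier I = \<sigma> ` carrier I"
      by (intro image_cong refl) (simp add: \<phi>\<sigma>)
    then show ?thesis
      using \<sigma> by (simp add: carrier_AutG bij_betw_def)
  qed
  ultimately have Aut: "?\<phi> \<in> carrier (AutG_pres V A I)"
    using bij by (simp add: AutG_pres_def malg_aut_def Bij_def)
  have "res ?\<phi> = (\<sigma>, \<kappa>)"
    by (rule res_eqI[OF Aut]) (use \<sigma> \<kappa> in \<open>simp_all add: carrier_AutG \<phi>\<sigma> \<phi>\<kappa>\<close>)
  then show "(\<sigma>, \<kappa>) \<in> res ` carrier (AutG_pres V A I)"
    using Aut by (metis image_eqI)
next
  assume "(\<sigma>, \<kappa>) \<in> res ` carrier (AutG_pres V A I)"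
  then obtain \<phi> where \<phi>: "\<phi> \<in> carrier (AutG_pres V A I)" and r: "res \<phi> = (\<sigma>, \<kappa>)"
    by force
  have "\<phi> a = \<sigma> a" if "a \<in> carrier I" for a
    using that fun_cong[OF arg_cong[OF r, of fst], of a] by (simp add: psi_def)
  then have "\<phi> (\<sigma>' a) = a" if "a \<in> carrier I" for a
    using \<sigma>'(1,2)[OF that] by simp
  moreover have "\<pi> (\<phi> b) = \<kappa> (\<pi> b)" if "b \<in> carrier A" for b
    using res_quotient[OF \<phi> that] r by simp
  ultimately have "\<phi> \<in> extension_homs V I A (\<lambda>b. \<kappa> (\<pi> b)) \<sigma>' A \<pi> (\<lambda>a. a)"
    using Aut_presD(1)[OF \<phi>] by (simp add: extension_homs_def)
  then show "extension_homs V I A (\<lambda>b. \<kappa> (\<pi> b)) \<sigma>' A \<pi> (\<lambda>a. a) \<noteq> {}"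
    by auto
qed

lemma wells_closed: "wells V Q I coc (\<sigma>, \<kappa>) \<in> carrier (free_Abelian_group (H2 V Q I))"
proof -
  have "coc_class V Q I coc \<in> H2 V Q I" "coc_class V Q I (coc_twist V Q I coc (\<sigma>, \<kappa>)) \<in> H2 V Q I"
    using coc_in_Z2 twist_in_Z2 by (auto simp: coc_class_def H2_def intro: quotientI)
  then show ?thesis
    using keys_diff[of "frag_of (coc_class V Q I coc)" "frag_of (coc_class V Q I (coc_twist V Q I coc (\<sigma>, \<kappa>)))"]
    by (auto simp: wells_def)
qed

end

end

theorem theorem1p5:
  fixes V :: "('r, 'f) variety_data"
    and A I :: "('r, 'f, 'a) malg"
    and Q :: "('r, 'f, 'q) malg"
    and \<pi> :: "'a \<Rightarrow> 'q"
    and l :: "'q \<Rightarrow> 'a"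
    and T :: "('r, 'f, 'a, 'q) cocycle"
  assumes "variety V"
    and "extension V A Q \<pi>"
    and "I = ideal_alg A Q \<pi>"
    and "lifting A Q \<pi> l"
    and "T = cocycle_of V Q I A (\<lambda>a. a) l"
  shows "group_hom (DerG V Q I T) (AutG_pres V A I) (der_to_aut A I \<pi> l)
    \<and> inj_on (der_to_aut A I \<pi> l) (carrier (DerG V Q I T))
    \<and> group_hom (AutG_pres V A I) (AutG V I \<times>\<times> AutG V Q) (psi Q I \<pi> l)
    \<and> der_to_aut A I \<pi> l ` carrier (DerG V Q I T)
        = kernel (AutG_pres V A I) (AutG V I \<times>\<times> AutG V Q) (psi Q I \<pi> l)
    \<and> wells V Q I T \<in> carrier (AutG V I \<times>\<times> AutG V Q) \<rightarrow> carrier (free_Abelian_group (H2 V Q I))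
    \<and> psi Q I \<pi> l ` carrier (AutG_pres V A I)
        = {\<sigma>\<kappa> \<in> carrier (AutG V I \<times>\<times> AutG V Q).
             wells V Q I T \<sigma>\<kappa> = \<one>\<^bsub>free_Abelian_group (H2 V Q I)\<^esub>}"
proof -
  have alg: "multilinear_algebra V A" "multilinear_algebra V Q"
    using assms(2) by (auto simp: extension_def in_variety_def multilinear_algebra_iff)
  then have I: "multilinear_algebra V I"
    using assms(1-3) by (simp add: multilinear_algebra_ideal_alg extension_def)
  have "algebra_extension V I A Q \<pi> (\<lambda>a. a) l"
    using assms(1-4) I multilinear_algebra.id_malg_hom[OF I]
    by (intro algebra_extensionI) (simp_all add: bij_betw_def)
  then interpret ideal_extension V I A Q \<pi> l
    using assms(3) by (simp add: ideal_extension_def ideal_extension_axioms_def)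
  have "wells V Q I T \<in> carrier (AutG V I \<times>\<times> AutG V Q) \<rightarrow> carrier (free_Abelian_group (H2 V Q I))"
    using wells_closed unfolding assms(5) by (auto simp: DirProd_def simp del: carrier_free_Abelian_group_iff)
  moreover have "psi Q I \<pi> l ` carrier (AutG_pres V A I)
        = {\<sigma>\<kappa> \<in> carrier (AutG V I \<times>\<times> AutG V Q).
             wells V Q I T \<sigma>\<kappa> = \<one>\<^bsub>free_Abelian_group (H2 V Q I)\<^esub>}"
    using wells_eq_0_iff res_closed unfolding assms(5) one_free_Abelian_group
    by (fastforce simp: DirProd_def)
  ultimately show ?thesis
    using group_hom_der inj_on_der group_hom_res kernel_res unfolding assms(5) by blast
qed

end
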